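(* Let $p\geq 1$ be an integer and let $X_1,X_2,\ldots$ be independent real random variables. Assume that $E[X_k]=0$ and $E[X_k^2]=1$ for all $k$, and that there exists $\varepsilon>0$ such that $\sup_k E|X_k|^{2+\varepsilon}<\infty$. For any $m\geq 1$, let $n(m)\geq 1$ be an integer and let $Q_m\in\mathbb{R}[x_1,\ldots,x_{n(m)}]$ be a real polynomial of the form $$Q_m(x_1,\ldots,x_{n(m)})=\sum_{S\subset\{1,\ldots,n(m)\}}c_{S,m}\prod_{i\in S}x_i,\qquad c_{S,m}\in\mathbb{R},$$ with $\sum_{|S|>0}c_{S,m}^2=1$. Suppose moreover that $$\lim_{m\to\infty}\ \sup_{1\leq k\leq n(m)}\ \sum_{S:\,k\in S}c_{S,m}^2=0,$$ and that, for every $m$, the degree of $Q_m$ is at most $p$, that is, $$\max_{S:\,c_{S,m}\neq 0}|S|\leq p.$$ Let $F$ be a limit in law of $Q_m(X_1,\ldots,X_{n(m)})$ as $m\to\infty$, possibly along a subsequence only. Then the law of $F$ has a density with respect to the Lebesgue measure.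
   Context: The sums are over subsets $S$ of $\{1,\ldots,n(m)\}$, $|S|$ denotes the cardinality of $S$, and an empty product equals $1$. "$F$ is a limit in law of $Q_m(X_1,\ldots,X_{n(m)})$, possibly along a subsequence only" means that there is a strictly increasing sequence of integers $m_j$ such that $Q_{m_j}(X_1,\ldots,X_{n(m_j)})$ converges in distribution to $F$ as $j\to\infty$. *)

theory Defs
  imports "HOL-Probability.Probability"
begin

text \<open>
  A multilinear polynomial in the variables \<open>x 1, \<dots>, x n\<close> is given by its family of coefficients
  \<open>c S\<close>, \<open>S \<subseteq> {1..n}\<close>; the values of \<open>c\<close> on other sets are never used.
\<close>

definition multilinear_eval :: "nat \<Rightarrow> (nat set \<Rightarrow> real) \<Rightarrow> (nat \<Rightarrow> real) \<Rightarrow> real" where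
  "multilinear_eval n c x = (\<Sum>S\<in>Pow {1..n}. c S * (\<Prod>i\<in>S. x i))"

text \<open>Meaningful only if some coefficient \<open>c S\<close>, \<open>S \<subseteq> {1..n}\<close>, is nonzero (\<open>Max {}\<close> is unspecified).\<close>

definition multilinear_degree :: "nat \<Rightarrow> (nat set \<Rightarrow> real) \<Rightarrow> nat" where
  "multilinear_degree n c = Max (card ` {S \<in> Pow {1..n}. c S \<noteq> 0})"

text \<open>Meaningful only for \<open>n \<ge> 1\<close>; the supremum is then that of a nonempty finite set of reals.\<close>

definition max_influence :: "nat \<Rightarrow> (nat set \<Rightarrow> real) \<Rightarrow> real" where
  "max_influence n c = (SUP k\<in>{1..n}. \<Sum>S\<in>{S \<in> Pow {1..n}. k \<in> S}. (c S)\<^sup>2)"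

end

theory Submission
  imports Defs "HOL-Computational_Algebra.Fundamental_Theorem_Algebra"
begin

text \<open>
  Let \<open>X\<close> and \<open>Y\<close> be independent copies of the given sequence. For every angle \<open>\<theta>\<close> the variables
  \<open>cos \<theta> * X i + sin \<theta> * Y i\<close> are again independent and standardized, so by Lindeberg replacement
  (after truncation) \<open>T \<theta> = Q (cos \<theta> * X + sin \<theta> * Y)\<close> has the same limit law \<open>\<mu>\<close> as \<open>Q X\<close>; no Gaussian
  variables are needed. Hence \<open>\<mu>\<close> is the limit of mixtures of the occupation laws of the random trigonometric
  polynomials \<open>T\<close>, of degree at most \<open>p\<close>. The occupation law of a nonconstant trigonometric polynomial is absolutely
  continuous, quantitatively in terms of \<open>\<bar>T (pi / 2) - T 0\<bar>\<close>, and \<open>T 0\<close>, \<open>T (pi / 2)\<close> converge to independent copies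
  \<open>F\<close>, \<open>F'\<close> of the limit. Therefore \<open>\<mu> N \<le> P (F = F')\<close> for every Lebesgue null set \<open>N\<close>, where \<open>P (F = F')\<close> is the sum of
  \<open>\<mu> {a}\<^sup>2\<close> over the atoms \<open>a\<close>. With \<open>N\<close> the set of atoms this shows that every atom has mass 1, which the
  unit variance excludes; so there are no atoms and \<open>\<mu> N = 0\<close>.
\<close>

section \<open>Multilinear forms in independent variables\<close>

text \<open>The number of variables is not bounded along the sequence, so every constant has to
  depend on \<open>p\<close> and the truncation level alone. Two facts provide this. For bounded
  centred variables, hypercontractivity bounds the fourth moment of a form of degree
  \<open>p\<close> by the square of the sum of its squared coefficients, up to a constant. And along
  a rotation circle the form is a trigonometric polynomial of degree at most \<open>p\<close>,
  however many variables it has. Truncation makes fourth moments finite; its cost is measured in L2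
  and is controlled by uniform integrability of the squares. Convergence in law only sees continuous
  test functions. A null set is therefore replaced by a compact subset, and that by a continuous
  function of small Lebesgue integral. The occupation bound degenerates when \<open>T\<close> is
  nearly constant. A continuous cut-off in the increment \<open>T (pi / 2) - T 0\<close> isolates
  this event, and its probability survives in the limit as the coincidence probability. The constant
  coefficients come without an explicit bound, so oscillation is measured after centring.\<close>

text \<open>An arbitrary index set instead of \<open>{1..n}\<close>, so that a single variable can
  be split off, as the moment induction and the replacement argument require.\<close>

definition mlf :: "'i set \<Rightarrow> ('i set \<Rightarrow> real) \<Rightarrow> ('i \<Rightarrow> real) \<Rightarrow> real" where
  "mlf I c x = (\<Sum>S\<in>Pow I. c S * (\<Prod>i\<in>S. x i))"

lemma mlf_cong:
  assumes "\<And>i. i \<in> I \<Longrightarrow> x i = y i"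
  shows "mlf I c x = mlf I c y"
  unfolding mlf_def
proof (intro sum.cong refl)
  fix S assume "S \<in> Pow I"
  then have "(\<Prod>i\<in>S. x i) = (\<Prod>i\<in>S. y i)"
    using assms by (intro prod.cong) auto
  then show "c S * (\<Prod>i\<in>S. x i) = c S * (\<Prod>i\<in>S. y i)" by simp
qed

lemma sum_Pow_insert:
  fixes h :: "'i set \<Rightarrow> 'b::comm_monoid_add"
  assumes "finite I" "k \<notin> I"
  shows "sum h (Pow (insert k I)) = sum h (Pow I) + (\<Sum>S\<in>Pow I. h (insert k S))"
proof -
  have "sum h (Pow (insert k I)) = sum h (Pow I) + sum h (insert k ` Pow I)"
    unfolding Pow_insert using assms by (intro sum.union_disjoint) auto
  also have "sum h (insert k ` Pow I) = (\<Sum>S\<in>Pow I. h (insert k S))"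
  proof (subst sum.reindex)
    show "inj_on (insert k) (Pow I)"
      using assms(2) by (auto intro!: inj_onI)
  qed simp
  finally show ?thesis .
qed

text \<open>Sorting the monomials by whether they contain \<open>k\<close> shows the form to be
  affine in \<open>x k\<close>. The squared coefficients of the slope sum to the influence of
  \<open>k\<close>.\<close>

lemma mlf_insert:
  assumes "finite I" "k \<notin> I"
  shows "mlf (insert k I) c x = mlf I c x + x k * mlf I (\<lambda>S. c (insert k S)) x"
proof -
  have "(\<Sum>S\<in>Pow I. c (insert k S) * (\<Prod>i\<in>insert k S. x i)) = x k * mlf I (\<lambda>S. c (insert k S)) x"
    unfolding mlf_def sum_distrib_left
  proof (intro sum.cong refl)
    fix S assume "S \<in> Pow I"
    then have "finite S" "k \<notin> S" using assms finite_subset by auto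
    then show "c (insert k S) * (\<Prod>i\<in>insert k S. x i) = x k * (c (insert k S) * (\<Prod>i\<in>S. x i))"
      by simp
  qed
  then show ?thesis
    unfolding mlf_def sum_Pow_insert[OF assms] by simp
qed

text \<open>A shift only changes the coefficient of the empty set, so a recentred form is again a
  form and the moment bounds apply to it.\<close>

lemma mlf_diff_const:
  assumes "finite I"
  shows "mlf I c x - a = mlf I (c({} := c {} - a)) x"
proof -
  have "mlf I (c({} := c {} - a)) x = (\<Sum>S\<in>Pow I. c S * (\<Prod>i\<in>S. x i) - (if S = {} then a else 0))"
    unfolding mlf_def by (intro sum.cong) auto
  also have "\<dots> = mlf I c x - a"
    using assms by (simp add: mlf_def sum_subtractf)
  finally show ?thesis ..
qed

lemma sum_squares_shift:
  fixes c :: "'i set \<Rightarrow> real"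
  assumes "finite I"
  shows "(\<Sum>S\<in>Pow I. ((c({} := b)) S)\<^sup>2) = (\<Sum>S\<in>{S \<in> Pow I. card S > 0}. (c S)\<^sup>2) + b\<^sup>2"
proof -
  have "(\<Sum>S\<in>Pow I. ((c({} := b)) S)\<^sup>2)
    = (\<Sum>S\<in>Pow I. (if card S > 0 then (c S)\<^sup>2 else 0) + (if S = {} then b\<^sup>2 else 0))"
  proof (intro sum.cong refl)
    fix S assume "S \<in> Pow I"
    then have "finite S" using assms finite_subset by auto
    then show "((c({} := b)) S)\<^sup>2 = (if card S > 0 then (c S)\<^sup>2 else 0) + (if S = {} then b\<^sup>2 else 0)"
      by (simp add: card_gt_0_iff)
  qed
  also have "\<dots> = (\<Sum>S\<in>Pow I. if card S > 0 then (c S)\<^sup>2 else 0) + b\<^sup>2"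
    using assms by (simp add: sum.distrib)
  also have "(\<Sum>S\<in>Pow I. if card S > 0 then (c S)\<^sup>2 else 0) = (\<Sum>S\<in>{S \<in> Pow I. card S > 0}. (c S)\<^sup>2)"
    using assms by (intro sum.inter_filter[symmetric]) simp
  finally show ?thesis .
qed

lemma mlf_measurable:
  assumes "\<And>i. i \<in> I \<Longrightarrow> (\<lambda>\<omega>. x \<omega> i) \<in> borel_measurable M"
  shows "(\<lambda>\<omega>. mlf I c (x \<omega>)) \<in> borel_measurable M"
  unfolding mlf_def using assms
  by (intro borel_measurable_sum borel_measurable_times borel_measurable_prod) auto

text \<open>Crude, and dependent on the number of variables: it serves integrability and never
  enters a final estimate.\<close>

lemma mlf_bounded:
  assumes "\<And>i. i \<in> I \<Longrightarrow> \<bar>x i\<bar> \<le> C"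
  shows "\<bar>mlf I c x\<bar> \<le> (\<Sum>S\<in>Pow I. \<bar>c S\<bar> * C ^ card S)"
proof -
  have "\<bar>mlf I c x\<bar> \<le> (\<Sum>S\<in>Pow I. \<bar>c S * (\<Prod>i\<in>S. x i)\<bar>)"
    unfolding mlf_def by (rule sum_abs)
  also have "\<dots> \<le> (\<Sum>S\<in>Pow I. \<bar>c S\<bar> * C ^ card S)"
  proof (rule sum_mono)
    fix S assume "S \<in> Pow I"
    then have "\<bar>\<Prod>i\<in>S. x i\<bar> \<le> (\<Prod>i\<in>S. C)"
      unfolding abs_prod using assms by (intro prod_mono) auto
    then show "\<bar>c S * (\<Prod>i\<in>S. x i)\<bar> \<le> \<bar>c S\<bar> * C ^ card S"
      by (simp add: abs_mult mult_left_mono)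
  qed
  finally show ?thesis .
qed

section \<open>Independence and integrability tools, hypercontractivity\<close>

text \<open>Stated for general value spaces because it is applied to real factors in the moment
  induction and to pairs \<open>(U i, V i)\<close> in the replacement argument.\<close>

lemma (in prob_space) indep_var_insert:
  assumes ind: "indep_vars M' D (insert k I)" and k: "k \<notin> I"
    and g: "g \<in> measurable (PiM I M') L1" and h: "h \<in> measurable (M' k) L2"
  shows "indep_var L1 (\<lambda>\<omega>. g (\<lambda>i\<in>I. D i \<omega>)) L2 (\<lambda>\<omega>. h (D k \<omega>))"
proof -
  have 1: "indep_var (PiM I M') (\<lambda>\<omega>. \<lambda>i\<in>I. D i \<omega>) (PiM {k} M') (\<lambda>\<omega>. \<lambda>i\<in>{k}. D i \<omega>)"
    using ind k by (intro indep_var_restrict) auto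
  have 2: "(\<lambda>x. h (x k)) \<in> measurable (PiM {k} M') L2"
    using h by measurable
  show ?thesis
    using indep_var_compose[OF 1 g 2] by (simp add: comp_def)
qed

lemma (in prob_space) integrable_bounded:
  fixes f :: "'a \<Rightarrow> real"
  assumes "f \<in> borel_measurable M" "\<And>\<omega>. \<omega> \<in> space M \<Longrightarrow> \<bar>f \<omega>\<bar> \<le> B"
  shows "integrable M f"
  using assms by (intro integrable_const_bound[where B=B]) auto

lemma integrable_mult_of_squares:
  fixes f g :: "'a \<Rightarrow> real"
  assumes [measurable]: "f \<in> borel_measurable M" "g \<in> borel_measurable M"
    and "integrable M (\<lambda>x. (f x)\<^sup>2)" "integrable M (\<lambda>x. (g x)\<^sup>2)"
  shows "integrable M (\<lambda>x. f x * g x)"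
proof (rule Bochner_Integration.integrable_bound[of M "\<lambda>x. (f x)\<^sup>2 + (g x)\<^sup>2"])
  show "AE x in M. norm (f x * g x) \<le> norm ((f x)\<^sup>2 + (g x)\<^sup>2)"
  proof (rule AE_I2)
    fix x
    have "0 \<le> (\<bar>f x\<bar> - \<bar>g x\<bar>)\<^sup>2" by simp
    then have "2 * (\<bar>f x\<bar> * \<bar>g x\<bar>) \<le> (f x)\<^sup>2 + (g x)\<^sup>2"
      by (simp add: power2_diff)
    moreover have "0 \<le> \<bar>f x\<bar> * \<bar>g x\<bar>" by simp
    moreover have "norm (f x * g x) = \<bar>f x\<bar> * \<bar>g x\<bar>" "norm ((f x)\<^sup>2 + (g x)\<^sup>2) = (f x)\<^sup>2 + (g x)\<^sup>2"
      by (simp_all add: abs_mult)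
    ultimately show "norm (f x * g x) \<le> norm ((f x)\<^sup>2 + (g x)\<^sup>2)"
      by linarith
  qed
qed (use assms in auto)

text \<open>The integral of \<open>(f - t * g)\<^sup>2\<close> is a nonnegative quadratic in
  \<open>t\<close>, evaluated at its minimiser \<open>H / G\<close>. If \<open>G = 0\<close>, then
  \<open>g\<close> vanishes almost everywhere and both sides are zero.\<close>

lemma integral_Cauchy_Schwarz:
  fixes f g :: "'a \<Rightarrow> real"
  assumes [measurable]: "f \<in> borel_measurable M" "g \<in> borel_measurable M"
    and f: "integrable M (\<lambda>x. (f x)\<^sup>2)" and g: "integrable M (\<lambda>x. (g x)\<^sup>2)"
  shows "(\<integral>x. f x * g x \<partial>M)\<^sup>2 \<le> (\<integral>x. (f x)\<^sup>2 \<partial>M) * (\<integral>x. (g x)\<^sup>2 \<partial>M)"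
proof -
  note fg = integrable_mult_of_squares[OF assms]
  define F G H where "F = (\<integral>x. (f x)\<^sup>2 \<partial>M)" and "G = (\<integral>x. (g x)\<^sup>2 \<partial>M)"
    and "H = (\<integral>x. f x * g x \<partial>M)"
  have pos: "0 \<le> F - 2 * t * H + t\<^sup>2 * G" for t
  proof -
    have "0 \<le> (\<integral>x. (f x - t * g x)\<^sup>2 \<partial>M)" by simp
    also have "\<dots> = (\<integral>x. (f x)\<^sup>2 - 2 * t * (f x * g x) + t\<^sup>2 * (g x)\<^sup>2 \<partial>M)"
      by (intro Bochner_Integration.integral_cong) (auto simp: power2_diff power_mult_distrib)
    also have "\<dots> = F - 2 * t * H + t\<^sup>2 * G"
      using f g fg by (simp add: F_def G_def H_def)
    finally show ?thesis .
  qed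
  show ?thesis
  proof (cases "G = 0")
    case True
    then have "AE x in M. (g x)\<^sup>2 = 0"
      using integral_nonneg_eq_0_iff_AE[OF g] by (simp add: G_def)
    then have "H = (\<integral>x. 0 \<partial>M)"
      unfolding H_def by (intro integral_cong_AE) auto
    then show ?thesis
      using True by (simp add: F_def G_def H_def)
  next
    case False
    then have "G > 0" by (simp add: G_def order.strict_iff_order)
    have "0 \<le> F - 2 * (H / G) * H + (H / G)\<^sup>2 * G" by (rule pos)
    also have "\<dots> = F - H\<^sup>2 / G"
      using False by (simp add: power2_eq_square field_simps)
    finally show ?thesis
      using \<open>G > 0\<close> by (simp add: F_def G_def H_def field_simps)
  qed
qed

lemma (in prob_space) expectation_square_le:
  fixes f :: "'a \<Rightarrow> real"
  assumes [measurable]: "f \<in> borel_measurable M" and f: "integrable M (\<lambda>x. (f x)\<^sup>2)"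
  shows "(expectation f)\<^sup>2 \<le> expectation (\<lambda>x. (f x)\<^sup>2)"
  using integral_Cauchy_Schwarz[of f M "\<lambda>_. 1"] f by (simp add: prob_space)

text \<open>Bonami's inductive argument; the weights \<open>(4 C\<^sup>2) ^ card S\<close> make the induction close.\<close>

lemma (in prob_space) mlf_fourth_moment:
  assumes "finite I" and "indep_vars (\<lambda>_. borel) W I"
    and "\<And>i. i \<in> I \<Longrightarrow> expectation (W i) = 0"
    and "\<And>i \<omega>. i \<in> I \<Longrightarrow> \<omega> \<in> space M \<Longrightarrow> \<bar>W i \<omega>\<bar> \<le> C"
  shows "expectation (\<lambda>\<omega>. (mlf I c (\<lambda>i. W i \<omega>)) ^ 4) \<le> (\<Sum>S\<in>Pow I. (4 * C\<^sup>2) ^ card S * (c S)\<^sup>2)\<^sup>2"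
  using assms
proof (induction I arbitrary: c rule: finite_induct)
  case empty
  then show ?case by (simp add: mlf_def prob_space power_mult[symmetric])
next
  case (insert k I)
  have indI: "indep_vars (\<lambda>_. borel) W I"
    using insert.prems(1) by (rule indep_vars_subset) auto
  have [measurable]: "W i \<in> borel_measurable M" if "i \<in> insert k I" for i
    using insert.prems(1) that by (auto simp: indep_vars_def)
  \<comment> \<open>The form is \<open>a + W k * b\<close>, where \<open>a\<close> and
    \<open>b\<close> involve the variables in \<open>I\<close> only and are thus independent of
    \<open>W k\<close>.\<close>
  define a b where "a = (\<lambda>\<omega>. mlf I c (\<lambda>i. W i \<omega>))"
    and "b = (\<lambda>\<omega>. mlf I (\<lambda>S. c (insert k S)) (\<lambda>i. W i \<omega>))"
  define A B where "A = (\<Sum>S\<in>Pow I. (4 * C\<^sup>2) ^ card S * (c S)\<^sup>2)"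
    and "B = (\<Sum>S\<in>Pow I. (4 * C\<^sup>2) ^ card S * (c (insert k S))\<^sup>2)"
  have [measurable]: "a \<in> borel_measurable M" "b \<in> borel_measurable M"
    unfolding a_def b_def by (auto intro!: mlf_measurable)
  have A0: "0 \<le> A" "0 \<le> B" by (auto simp: A_def B_def intro!: sum_nonneg)
  obtain Ka where Ka: "\<And>\<omega>. \<omega> \<in> space M \<Longrightarrow> \<bar>a \<omega>\<bar> \<le> Ka"
  proof
    show "\<bar>a \<omega>\<bar> \<le> (\<Sum>S\<in>Pow I. \<bar>c S\<bar> * C ^ card S)" if "\<omega> \<in> space M" for \<omega>
      unfolding a_def using insert.prems(3) that by (intro mlf_bounded) auto
  qed
  obtain Kb where Kb: "\<And>\<omega>. \<omega> \<in> space M \<Longrightarrow> \<bar>b \<omega>\<bar> \<le> Kb"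
  proof
    show "\<bar>b \<omega>\<bar> \<le> (\<Sum>S\<in>Pow I. \<bar>(\<lambda>S. c (insert k S)) S\<bar> * C ^ card S)" if "\<omega> \<in> space M" for \<omega>
      unfolding b_def using insert.prems(3) that by (intro mlf_bounded) auto
  qed
  have bound: "\<bar>a \<omega> ^ i * b \<omega> ^ j\<bar> \<le> Ka ^ i * Kb ^ j" if "\<omega> \<in> space M" for \<omega> i j
    unfolding abs_mult power_abs using Ka[OF that] Kb[OF that]
    by (intro mult_mono power_mono) auto
  have int: "integrable M (\<lambda>\<omega>. a \<omega> ^ i * b \<omega> ^ j)" for i j
    using bound by (intro integrable_bounded) auto
  have intW: "integrable M (\<lambda>\<omega>. W k \<omega>)"
    using insert.prems(3)[of k] by (intro integrable_bounded) auto
  have ea: "expectation (\<lambda>\<omega>. a \<omega> ^ 4) \<le> A\<^sup>2"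
    unfolding a_def A_def using insert.prems indI by (intro insert.IH) auto
  have eb: "expectation (\<lambda>\<omega>. b \<omega> ^ 4) \<le> B\<^sup>2"
    unfolding b_def B_def using insert.prems indI by (intro insert.IH) auto
  have "(expectation (\<lambda>\<omega>. (a \<omega>)\<^sup>2 * (b \<omega>)\<^sup>2))\<^sup>2
      \<le> expectation (\<lambda>\<omega>. ((a \<omega>)\<^sup>2)\<^sup>2) * expectation (\<lambda>\<omega>. ((b \<omega>)\<^sup>2)\<^sup>2)"
    using int[of 4 0] int[of 0 4] by (intro integral_Cauchy_Schwarz) (auto simp: power_mult[symmetric])
  also have "\<dots> = expectation (\<lambda>\<omega>. a \<omega> ^ 4) * expectation (\<lambda>\<omega>. b \<omega> ^ 4)"
    by (simp add: power_mult[symmetric])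
  also have "\<dots> \<le> A\<^sup>2 * B\<^sup>2"
    using ea eb by (intro mult_mono) auto
  finally have "(expectation (\<lambda>\<omega>. (a \<omega>)\<^sup>2 * (b \<omega>)\<^sup>2))\<^sup>2 \<le> (A * B)\<^sup>2"
    by (simp add: power_mult_distrib)
  then have eab: "expectation (\<lambda>\<omega>. (a \<omega>)\<^sup>2 * (b \<omega>)\<^sup>2) \<le> A * B"
    using A0 by (simp add: power2_le_iff_abs_le)
  \<comment> \<open>Independence and the zero mean of \<open>W k\<close> remove the term of the
    expansion that is linear in \<open>W k\<close>.\<close>
  have ind: "indep_var borel (\<lambda>\<omega>. a \<omega> ^ 3 * b \<omega> ^ 1) borel (W k)"
  proof -
    have "indep_var borel (\<lambda>\<omega>. (\<lambda>x. mlf I c x ^ 3 * mlf I (\<lambda>S. c (insert k S)) x ^ 1) (\<lambda>i\<in>I. W i \<omega>))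
       borel (\<lambda>\<omega>. (\<lambda>x. x) (W k \<omega>))"
      using insert.prems(1) insert.hyps(2)
      by (rule indep_var_insert) (auto intro!: borel_measurable_times borel_measurable_power mlf_measurable)
    moreover have "mlf I d (\<lambda>i\<in>I. W i \<omega>) = mlf I d (\<lambda>i. W i \<omega>)" for d \<omega>
      by (rule mlf_cong) simp
    ultimately show ?thesis by (simp add: a_def b_def)
  qed
  have e0: "expectation (\<lambda>\<omega>. (a \<omega> ^ 3 * b \<omega> ^ 1) * W k \<omega>) = 0"
    using indep_var_lebesgue_integral[OF ind int intW] insert.prems(2)[of k] by simp
  have i0: "integrable M (\<lambda>\<omega>. (a \<omega> ^ 3 * b \<omega> ^ 1) * W k \<omega>)"
    by (rule indep_var_integrable[OF ind int intW])
  have pw: "(a \<omega> + W k \<omega> * b \<omega>) ^ 4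
    \<le> a \<omega> ^ 4 + 4 * ((a \<omega> ^ 3 * b \<omega> ^ 1) * W k \<omega>) + 8 * C\<^sup>2 * ((a \<omega>)\<^sup>2 * (b \<omega>)\<^sup>2) + 3 * C ^ 4 * b \<omega> ^ 4"
    if w: "\<omega> \<in> space M" for \<omega>
  proof -
    define x y z where "x = a \<omega>" and "y = b \<omega>" and "z = W k \<omega>"
    have z: "\<bar>z\<bar> \<le> C" using insert.prems(3) w by (simp add: z_def)
    then have z2: "z\<^sup>2 \<le> C\<^sup>2" by (metis abs_ge_zero power2_abs power_mono)
    then have z4: "z ^ 4 \<le> C ^ 4"
      using power_mono[OF z2, of 2] by (simp add: power_mult[symmetric])
    have "0 \<le> 2 * y\<^sup>2 * (x * z - y * z\<^sup>2)\<^sup>2" by simp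
    then have "4 * (x * y ^ 3 * z ^ 3) \<le> 2 * (x\<^sup>2 * y\<^sup>2) * z\<^sup>2 + 2 * y ^ 4 * z ^ 4"
      by (simp add: power2_eq_square power3_eq_cube power4_eq_xxxx algebra_simps)
    moreover have "(x + z * y) ^ 4 = x ^ 4 + 4 * ((x ^ 3 * y) * z) + 6 * (x\<^sup>2 * y\<^sup>2) * z\<^sup>2
        + 4 * (x * y ^ 3 * z ^ 3) + y ^ 4 * z ^ 4"
      by (simp add: power2_eq_square power3_eq_cube power4_eq_xxxx algebra_simps)
    moreover have "8 * (x\<^sup>2 * y\<^sup>2) * z\<^sup>2 \<le> 8 * (x\<^sup>2 * y\<^sup>2) * C\<^sup>2"
      using z2 by (intro mult_left_mono) auto
    moreover have "3 * y ^ 4 * z ^ 4 \<le> 3 * y ^ 4 * C ^ 4"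
      using z4 by (intro mult_left_mono) auto
    ultimately have "(x + z * y) ^ 4 \<le> x ^ 4 + 4 * ((x ^ 3 * y) * z) + 8 * C\<^sup>2 * (x\<^sup>2 * y\<^sup>2) + 3 * C ^ 4 * y ^ 4"
      by (simp add: algebra_simps)
    then show ?thesis by (simp add: x_def y_def z_def)
  qed
  have int4: "integrable M (\<lambda>\<omega>. a \<omega> ^ 4)" "integrable M (\<lambda>\<omega>. b \<omega> ^ 4)" "integrable M (\<lambda>\<omega>. (a \<omega>)\<^sup>2 * (b \<omega>)\<^sup>2)"
    using int[of 4 0] int[of 0 4] int[of 2 2] by auto
  have eq: "mlf (insert k I) c (\<lambda>i. W i \<omega>) = a \<omega> + W k \<omega> * b \<omega>" for \<omega>
    unfolding a_def b_def using insert.hyps by (rule mlf_insert)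
  have "expectation (\<lambda>\<omega>. (a \<omega> + W k \<omega> * b \<omega>) ^ 4)
    \<le> expectation (\<lambda>\<omega>. a \<omega> ^ 4 + 4 * ((a \<omega> ^ 3 * b \<omega> ^ 1) * W k \<omega>) + 8 * C\<^sup>2 * ((a \<omega>)\<^sup>2 * (b \<omega>)\<^sup>2) + 3 * C ^ 4 * b \<omega> ^ 4)"
  proof (rule integral_mono)
    show "integrable M (\<lambda>\<omega>. (a \<omega> + W k \<omega> * b \<omega>) ^ 4)"
    proof (rule integrable_bounded)
      fix \<omega> assume w: "\<omega> \<in> space M"
      have C0: "0 \<le> C" using insert.prems(3)[of k \<omega>] w by auto
      have "\<bar>W k \<omega> * b \<omega>\<bar> \<le> C * Kb"
        unfolding abs_mult using insert.prems(3)[of k \<omega>] w Kb[OF w] C0 by (intro mult_mono) auto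
      then show "\<bar>(a \<omega> + W k \<omega> * b \<omega>) ^ 4\<bar> \<le> (Ka + C * Kb) ^ 4"
        unfolding power_abs using Ka[OF w] by (intro power_mono) auto
    qed measurable
  qed (use int4 i0 pw in auto)
  also have "\<dots> = expectation (\<lambda>\<omega>. a \<omega> ^ 4) + 8 * C\<^sup>2 * expectation (\<lambda>\<omega>. (a \<omega>)\<^sup>2 * (b \<omega>)\<^sup>2)
      + 3 * C ^ 4 * expectation (\<lambda>\<omega>. b \<omega> ^ 4)"
    using int4 i0 e0 by simp
  also have "\<dots> \<le> A\<^sup>2 + 8 * C\<^sup>2 * (A * B) + 3 * C ^ 4 * B\<^sup>2"
    using ea eb eab by (intro add_mono mult_left_mono) auto
  \<comment> \<open>Weakening 3 to 16 produces the perfect square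
    \<open>(A + 4 * C\<^sup>2 * B)\<^sup>2\<close>. This is the claim for \<open>insert k I\<close>,
    since each set containing \<open>k\<close> gains one factor
    \<open>4 * C\<^sup>2\<close>.\<close>
  also have "\<dots> \<le> A\<^sup>2 + 8 * C\<^sup>2 * (A * B) + 16 * C ^ 4 * B\<^sup>2"
    by (intro add_left_mono mult_right_mono) auto
  also have "\<dots> = (A + 4 * C\<^sup>2 * B)\<^sup>2"
    by (simp add: power2_eq_square power4_eq_xxxx algebra_simps)
  also have "A + 4 * C\<^sup>2 * B = (\<Sum>S\<in>Pow (insert k I). (4 * C\<^sup>2) ^ card S * (c S)\<^sup>2)"
  proof -
    have "card (insert k S) = Suc (card S)" if "S \<in> Pow I" for S
      using that insert.hyps finite_subset by (subst card_insert_disjoint) auto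
    then have "(\<Sum>S\<in>Pow I. (4 * C\<^sup>2) ^ card (insert k S) * (c (insert k S))\<^sup>2) = 4 * C\<^sup>2 * B"
      unfolding B_def sum_distrib_left by (intro sum.cong) auto
    then show ?thesis
      unfolding sum_Pow_insert[OF insert.hyps] A_def by simp
  qed
  finally show ?case by (simp add: eq)
qed

section \<open>Second moments and perturbation of the variables\<close>

text \<open>Padding both products with ones turns them into a single product over \<open>I\<close>
  of independent factors \<open>D i\<close>. An index lying in exactly one of \<open>S\<close>,
  \<open>S'\<close> contributes a factor of mean zero. Independence is across indices only:
  \<open>A i\<close> and \<open>B i\<close> may depend on each other.\<close>

lemma (in prob_space) indep_products:
  fixes A B :: "'i \<Rightarrow> 'a \<Rightarrow> real"
  assumes I: "finite I" and S: "S \<subseteq> I" "S' \<subseteq> I"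
    and ind: "indep_vars (\<lambda>_. borel \<Otimes>\<^sub>M borel) (\<lambda>i \<omega>. (A i \<omega>, B i \<omega>)) I"
    and A: "\<And>i. i \<in> I \<Longrightarrow> integrable M (\<lambda>\<omega>. (A i \<omega>)\<^sup>2)" "\<And>i. i \<in> I \<Longrightarrow> expectation (A i) = 0"
    and B: "\<And>i. i \<in> I \<Longrightarrow> integrable M (\<lambda>\<omega>. (B i \<omega>)\<^sup>2)" "\<And>i. i \<in> I \<Longrightarrow> expectation (B i) = 0"
  shows "integrable M (\<lambda>\<omega>. (\<Prod>i\<in>S. A i \<omega>) * (\<Prod>i\<in>S'. B i \<omega>))"
    and "expectation (\<lambda>\<omega>. (\<Prod>i\<in>S. A i \<omega>) * (\<Prod>i\<in>S'. B i \<omega>))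
      = (if S = S' then \<Prod>i\<in>S. expectation (\<lambda>\<omega>. A i \<omega> * B i \<omega>) else 0)"
proof -
  have rv: "(\<lambda>\<omega>. (A i \<omega>, B i \<omega>)) \<in> measurable M (borel \<Otimes>\<^sub>M borel)" if "i \<in> I" for i
    using ind that by (auto simp: indep_vars_def)
  have mA: "A i \<in> borel_measurable M" and mB: "B i \<in> borel_measurable M" if "i \<in> I" for i
    using measurable_compose[OF rv[OF that] measurable_fst] measurable_compose[OF rv[OF that] measurable_snd]
    by auto
  have iA: "integrable M (A i)" and iB: "integrable M (B i)" if "i \<in> I" for i
    using that A B mA mB by (auto intro: square_integrable_imp_integrable)
  define D where "D i \<omega> = (if i \<in> S then A i \<omega> else 1) * (if i \<in> S' then B i \<omega> else 1)" for i \<omega>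
  have ind': "indep_vars (\<lambda>_. borel) D I"
  proof -
    have "indep_vars (\<lambda>_. borel) (\<lambda>i \<omega>. (\<lambda>(x, y). (if i \<in> S then x else 1) * (if i \<in> S' then y else (1::real))) (A i \<omega>, B i \<omega>)) I"
      using ind by (rule indep_vars_compose2) simp
    then show ?thesis by (simp add: D_def[abs_def])
  qed
  have intD: "integrable M (D i)" if "i \<in> I" for i
    unfolding D_def[abs_def]
    using iA[OF that] iB[OF that] integrable_mult_of_squares[OF mA[OF that] mB[OF that] A(1)[OF that] B(1)[OF that]]
    by (cases "i \<in> S"; cases "i \<in> S'") auto
  have eq: "(\<Prod>i\<in>S. A i \<omega>) * (\<Prod>i\<in>S'. B i \<omega>) = (\<Prod>i\<in>I. D i \<omega>)" for \<omega>
  proof -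
    have "(\<Prod>i\<in>I. D i \<omega>) = (\<Prod>i\<in>I. if i \<in> S then A i \<omega> else 1) * (\<Prod>i\<in>I. if i \<in> S' then B i \<omega> else 1)"
      unfolding D_def prod.distrib ..
    also have "\<dots> = (\<Prod>i\<in>S. A i \<omega>) * (\<Prod>i\<in>S'. B i \<omega>)"
      using I S by (simp add: prod.inter_restrict[symmetric] Int_absorb1)
    finally show ?thesis ..
  qed
  show "integrable M (\<lambda>\<omega>. (\<Prod>i\<in>S. A i \<omega>) * (\<Prod>i\<in>S'. B i \<omega>))"
    unfolding eq using I ind' intD by (rule indep_vars_integrable)
  have e: "expectation (\<lambda>\<omega>. (\<Prod>i\<in>S. A i \<omega>) * (\<Prod>i\<in>S'. B i \<omega>)) = (\<Prod>i\<in>I. expectation (D i))"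
    unfolding eq using I ind' intD by (rule indep_vars_lebesgue_integral)
  show "expectation (\<lambda>\<omega>. (\<Prod>i\<in>S. A i \<omega>) * (\<Prod>i\<in>S'. B i \<omega>))
      = (if S = S' then \<Prod>i\<in>S. expectation (\<lambda>\<omega>. A i \<omega> * B i \<omega>) else 0)"
  proof (cases "S = S'")
    case True
    have "(\<Prod>i\<in>I. expectation (D i)) = (\<Prod>i\<in>I. if i \<in> S then expectation (\<lambda>\<omega>. A i \<omega> * B i \<omega>) else 1)"
      using True by (intro prod.cong) (auto simp: D_def[abs_def] prob_space)
    then show ?thesis
      using I S True e by (simp add: prod.inter_restrict[symmetric] Int_absorb1)
  next
    case False
    then obtain i where "i \<in> I" "(i \<in> S \<and> i \<notin> S') \<or> (i \<notin> S \<and> i \<in> S')" using S by blast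
    then have "expectation (D i) = 0"
      using A B by (auto simp: D_def[abs_def])
    then have "(\<Prod>i\<in>I. expectation (D i)) = 0"
      using I \<open>i \<in> I\<close> by (intro prod_zero) auto
    then show ?thesis using False e by simp
  qed
qed

text \<open>Orthogonality of the monomials leaves the diagonal \<open>S = S'\<close>. Two families
  are allowed so that a form can be compared with the same form in truncated variables.\<close>

lemma (in prob_space) mlf_product_moment:
  fixes A B :: "'i \<Rightarrow> 'a \<Rightarrow> real"
  assumes I: "finite I"
    and ind: "indep_vars (\<lambda>_. borel \<Otimes>\<^sub>M borel) (\<lambda>i \<omega>. (A i \<omega>, B i \<omega>)) I"
    and A: "\<And>i. i \<in> I \<Longrightarrow> integrable M (\<lambda>\<omega>. (A i \<omega>)\<^sup>2)" "\<And>i. i \<in> I \<Longrightarrow> expectation (A i) = 0"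
    and B: "\<And>i. i \<in> I \<Longrightarrow> integrable M (\<lambda>\<omega>. (B i \<omega>)\<^sup>2)" "\<And>i. i \<in> I \<Longrightarrow> expectation (B i) = 0"
  shows "integrable M (\<lambda>\<omega>. mlf I c (\<lambda>i. A i \<omega>) * mlf I d (\<lambda>i. B i \<omega>))"
    and "expectation (\<lambda>\<omega>. mlf I c (\<lambda>i. A i \<omega>) * mlf I d (\<lambda>i. B i \<omega>))
      = (\<Sum>S\<in>Pow I. c S * d S * (\<Prod>i\<in>S. expectation (\<lambda>\<omega>. A i \<omega> * B i \<omega>)))"
proof -
  note prods = indep_products[OF I _ _ ind A B]
  have eq: "mlf I c (\<lambda>i. A i \<omega>) * mlf I d (\<lambda>i. B i \<omega>)
    = (\<Sum>S\<in>Pow I. \<Sum>S'\<in>Pow I. c S * d S' * ((\<Prod>i\<in>S. A i \<omega>) * (\<Prod>i\<in>S'. B i \<omega>)))" for \<omega>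
    unfolding mlf_def sum_product by (intro sum.cong) (auto simp: algebra_simps)
  show "integrable M (\<lambda>\<omega>. mlf I c (\<lambda>i. A i \<omega>) * mlf I d (\<lambda>i. B i \<omega>))"
    unfolding eq using prods(1) by (intro Bochner_Integration.integrable_sum integrable_mult_right) auto
  have "expectation (\<lambda>\<omega>. mlf I c (\<lambda>i. A i \<omega>) * mlf I d (\<lambda>i. B i \<omega>))
    = (\<Sum>S\<in>Pow I. \<Sum>S'\<in>Pow I. c S * d S' * expectation (\<lambda>\<omega>. (\<Prod>i\<in>S. A i \<omega>) * (\<Prod>i\<in>S'. B i \<omega>)))"
  proof -
    have int: "integrable M (\<lambda>\<omega>. c S * d S' * ((\<Prod>i\<in>S. A i \<omega>) * (\<Prod>i\<in>S'. B i \<omega>)))"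
      if "S \<in> Pow I" "S' \<in> Pow I" for S S'
      using that prods(1) by (intro integrable_mult_right) auto
    have "expectation (\<lambda>\<omega>. \<Sum>S'\<in>Pow I. c S * d S' * ((\<Prod>i\<in>S. A i \<omega>) * (\<Prod>i\<in>S'. B i \<omega>)))
      = (\<Sum>S'\<in>Pow I. c S * d S' * expectation (\<lambda>\<omega>. (\<Prod>i\<in>S. A i \<omega>) * (\<Prod>i\<in>S'. B i \<omega>)))"
      if "S \<in> Pow I" for S
      using int[OF that] by (subst Bochner_Integration.integral_sum) auto
    then show ?thesis
      unfolding eq using int
      by (subst Bochner_Integration.integral_sum) (auto intro!: Bochner_Integration.integrable_sum)
  qed
  also have "\<dots> = (\<Sum>S\<in>Pow I. \<Sum>S'\<in>Pow I. if S = S' then c S * d S * (\<Prod>i\<in>S. expectation (\<lambda>\<omega>. A i \<omega> * B i \<omega>)) else 0)"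
  proof (intro sum.cong refl)
    fix S S' assume "S \<in> Pow I" "S' \<in> Pow I"
    then show "c S * d S' * expectation (\<lambda>\<omega>. (\<Prod>i\<in>S. A i \<omega>) * (\<Prod>i\<in>S'. B i \<omega>)) = 
      (if S = S' then c S * d S * (\<Prod>i\<in>S. expectation (\<lambda>\<omega>. A i \<omega> * B i \<omega>)) else 0)"
      using prods(2)[of S S'] by auto
  qed
  also have "\<dots> = (\<Sum>S\<in>Pow I. c S * d S * (\<Prod>i\<in>S. expectation (\<lambda>\<omega>. A i \<omega> * B i \<omega>)))"
    using I by (simp add: sum.delta')
  finally show "expectation (\<lambda>\<omega>. mlf I c (\<lambda>i. A i \<omega>) * mlf I d (\<lambda>i. B i \<omega>))
      = (\<Sum>S\<in>Pow I. c S * d S * (\<Prod>i\<in>S. expectation (\<lambda>\<omega>. A i \<omega> * B i \<omega>)))" .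
qed

text \<open>The expectation of a product over \<open>S\<close> moves by at most \<open>card S * \<rho>\<close>, since all factors lie in \<open>[-1, 1]\<close>.\<close>

lemma (in prob_space) mlf_perturbation:
  fixes A B :: "'i \<Rightarrow> 'a \<Rightarrow> real"
  assumes I: "finite I"
    and ind: "indep_vars (\<lambda>_. borel \<Otimes>\<^sub>M borel) (\<lambda>i \<omega>. (A i \<omega>, B i \<omega>)) I"
    and A: "\<And>i. i \<in> I \<Longrightarrow> integrable M (\<lambda>\<omega>. (A i \<omega>)\<^sup>2)" "\<And>i. i \<in> I \<Longrightarrow> expectation (A i) = 0"
    and B: "\<And>i. i \<in> I \<Longrightarrow> integrable M (\<lambda>\<omega>. (B i \<omega>)\<^sup>2)" "\<And>i. i \<in> I \<Longrightarrow> expectation (B i) = 0"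
    and a: "\<And>i. i \<in> I \<Longrightarrow> expectation (\<lambda>\<omega>. (A i \<omega>)\<^sup>2) \<le> 1"
    and b: "\<And>i. i \<in> I \<Longrightarrow> expectation (\<lambda>\<omega>. (B i \<omega>)\<^sup>2) \<le> 1"
    and ra: "\<And>i. i \<in> I \<Longrightarrow> \<bar>expectation (\<lambda>\<omega>. (A i \<omega>)\<^sup>2) - expectation (\<lambda>\<omega>. A i \<omega> * B i \<omega>)\<bar> \<le> \<rho>"
    and rb: "\<And>i. i \<in> I \<Longrightarrow> \<bar>expectation (\<lambda>\<omega>. (B i \<omega>)\<^sup>2) - expectation (\<lambda>\<omega>. A i \<omega> * B i \<omega>)\<bar> \<le> \<rho>"
    and deg: "\<And>S. S \<subseteq> I \<Longrightarrow> c S \<noteq> 0 \<Longrightarrow> card S \<le> p"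
    and c: "(\<Sum>S\<in>{S \<in> Pow I. card S > 0}. (c S)\<^sup>2) \<le> 1" and \<rho>: "0 \<le> \<rho>"
  shows "integrable M (\<lambda>\<omega>. (mlf I c (\<lambda>i. A i \<omega>) - mlf I c (\<lambda>i. B i \<omega>))\<^sup>2)"
    and "expectation (\<lambda>\<omega>. (mlf I c (\<lambda>i. A i \<omega>) - mlf I c (\<lambda>i. B i \<omega>))\<^sup>2) \<le> 2 * real p * \<rho>"
proof -
  \<comment> \<open>Pairing each family with itself lets the product formula compute all three terms
    of the expanded square.\<close>
  have indA: "indep_vars (\<lambda>_. borel \<Otimes>\<^sub>M borel) (\<lambda>i \<omega>. (A i \<omega>, A i \<omega>)) I"
    using indep_vars_compose2[OF ind, of "\<lambda>_ (x, y). (x, x)" "\<lambda>_. borel \<Otimes>\<^sub>M borel"] by simp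
  have indB: "indep_vars (\<lambda>_. borel \<Otimes>\<^sub>M borel) (\<lambda>i \<omega>. (B i \<omega>, B i \<omega>)) I"
    using indep_vars_compose2[OF ind, of "\<lambda>_ (x, y). (y, y)" "\<lambda>_. borel \<Otimes>\<^sub>M borel"] by simp
  have rv: "(\<lambda>\<omega>. (A i \<omega>, B i \<omega>)) \<in> measurable M (borel \<Otimes>\<^sub>M borel)" if "i \<in> I" for i
    using ind that by (auto simp: indep_vars_def)
  have mA: "A i \<in> borel_measurable M" and mB: "B i \<in> borel_measurable M" if "i \<in> I" for i
    using measurable_compose[OF rv[OF that] measurable_fst] measurable_compose[OF rv[OF that] measurable_snd]
    by auto
  define \<alpha> \<beta> \<gamma> where "\<alpha> i = expectation (\<lambda>\<omega>. (A i \<omega>)\<^sup>2)" and "\<beta> i = expectation (\<lambda>\<omega>. (B i \<omega>)\<^sup>2)"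
    and "\<gamma> i = expectation (\<lambda>\<omega>. A i \<omega> * B i \<omega>)" for i
  \<comment> \<open>Cauchy-Schwarz puts the correlations into \<open>[-1, 1]\<close>, as the
    estimate for differences of products requires.\<close>
  have \<gamma>: "\<bar>\<gamma> i\<bar> \<le> 1" if "i \<in> I" for i
  proof -
    have "(\<gamma> i)\<^sup>2 \<le> \<alpha> i * \<beta> i"
      unfolding \<alpha>_def \<beta>_def \<gamma>_def using that mA mB A B by (intro integral_Cauchy_Schwarz) auto
    also have "\<dots> \<le> 1 * 1"
      using a[OF that] b[OF that] unfolding \<alpha>_def \<beta>_def by (intro mult_mono) auto
    finally show ?thesis by (simp add: abs_square_le_1)
  qed
  have \<alpha>: "\<bar>\<alpha> i\<bar> \<le> 1" and \<beta>: "\<bar>\<beta> i\<bar> \<le> 1" if "i \<in> I" for i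
    using a[OF that] b[OF that] unfolding \<alpha>_def \<beta>_def by auto
  define qa qb where "qa = (\<lambda>\<omega>. mlf I c (\<lambda>i. A i \<omega>))" and "qb = (\<lambda>\<omega>. mlf I c (\<lambda>i. B i \<omega>))"
  note aa = mlf_product_moment[where c=c and d=c, OF I indA A A]
    and ab = mlf_product_moment[where c=c and d=c, OF I ind A B]
    and bb = mlf_product_moment[where c=c and d=c, OF I indB B B]
  have eq: "(qa \<omega> - qb \<omega>)\<^sup>2 = (qa \<omega>)\<^sup>2 - 2 * (qa \<omega> * qb \<omega>) + (qb \<omega>)\<^sup>2" for \<omega>
    by (simp add: power2_diff)
  have aa1: "integrable M (\<lambda>\<omega>. (qa \<omega>)\<^sup>2)" and ab1: "integrable M (\<lambda>\<omega>. qa \<omega> * qb \<omega>)"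
    and bb1: "integrable M (\<lambda>\<omega>. (qb \<omega>)\<^sup>2)"
    using aa(1) ab(1) bb(1) unfolding qa_def qb_def power2_eq_square by auto
  show "integrable M (\<lambda>\<omega>. (mlf I c (\<lambda>i. A i \<omega>) - mlf I c (\<lambda>i. B i \<omega>))\<^sup>2)"
    unfolding qa_def[symmetric] qb_def[symmetric] using aa1 ab1 bb1
    unfolding eq[unfolded qa_def qb_def] qa_def qb_def by simp
  have "expectation (\<lambda>\<omega>. (qa \<omega> - qb \<omega>)\<^sup>2)
    = expectation (\<lambda>\<omega>. (qa \<omega>)\<^sup>2) - 2 * expectation (\<lambda>\<omega>. qa \<omega> * qb \<omega>) + expectation (\<lambda>\<omega>. (qb \<omega>)\<^sup>2)"
    unfolding eq using aa1 ab1 bb1 by simp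
  also have "\<dots> = (\<Sum>S\<in>Pow I. (c S)\<^sup>2 * (\<Prod>i\<in>S. \<alpha> i)) - 2 * (\<Sum>S\<in>Pow I. (c S)\<^sup>2 * (\<Prod>i\<in>S. \<gamma> i))
     + (\<Sum>S\<in>Pow I. (c S)\<^sup>2 * (\<Prod>i\<in>S. \<beta> i))"
    using aa(2) ab(2) bb(2)
    unfolding qa_def qb_def \<alpha>_def \<beta>_def \<gamma>_def power2_eq_square by simp
  also have "\<dots> = (\<Sum>S\<in>Pow I. (c S)\<^sup>2 * (((\<Prod>i\<in>S. \<alpha> i) - (\<Prod>i\<in>S. \<gamma> i)) + ((\<Prod>i\<in>S. \<beta> i) - (\<Prod>i\<in>S. \<gamma> i))))"
    by (simp add: sum_distrib_left sum_subtractf[symmetric] sum.distrib[symmetric] algebra_simps)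
  also have "\<dots> \<le> (\<Sum>S\<in>Pow I. if card S > 0 then (c S)\<^sup>2 * (2 * real p * \<rho>) else 0)"
  proof (rule sum_mono)
    fix S assume "S \<in> Pow I"
    then have S: "S \<subseteq> I" by simp
    have 1: "\<bar>(\<Prod>i\<in>S. \<alpha> i) - (\<Prod>i\<in>S. \<gamma> i)\<bar> \<le> (\<Sum>i\<in>S. \<bar>\<alpha> i - \<gamma> i\<bar>)"
      using norm_prod_diff[of S \<alpha> \<gamma>] \<alpha> \<gamma> S by (auto simp: subset_iff)
    have 2: "\<bar>(\<Prod>i\<in>S. \<beta> i) - (\<Prod>i\<in>S. \<gamma> i)\<bar> \<le> (\<Sum>i\<in>S. \<bar>\<beta> i - \<gamma> i\<bar>)"
      using norm_prod_diff[of S \<beta> \<gamma>] \<beta> \<gamma> S by (auto simp: subset_iff)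
    have 3: "(\<Sum>i\<in>S. \<bar>\<alpha> i - \<gamma> i\<bar>) \<le> card S * \<rho>" "(\<Sum>i\<in>S. \<bar>\<beta> i - \<gamma> i\<bar>) \<le> card S * \<rho>"
      using S ra rb unfolding \<alpha>_def \<beta>_def \<gamma>_def by (auto intro!: sum_bounded_above)
    show "(c S)\<^sup>2 * (((\<Prod>i\<in>S. \<alpha> i) - (\<Prod>i\<in>S. \<gamma> i)) + ((\<Prod>i\<in>S. \<beta> i) - (\<Prod>i\<in>S. \<gamma> i)))
      \<le> (if card S > 0 then (c S)\<^sup>2 * (2 * real p * \<rho>) else 0)"
    proof (cases "c S = 0")
      case False
      then have "card S * \<rho> \<le> p * \<rho>"
        using deg[OF S] \<rho> by (intro mult_right_mono) auto
      then have "(c S)\<^sup>2 * (((\<Prod>i\<in>S. \<alpha> i) - (\<Prod>i\<in>S. \<gamma> i)) + ((\<Prod>i\<in>S. \<beta> i) - (\<Prod>i\<in>S. \<gamma> i))) \<le> (c S)\<^sup>2 * (2 * real p * \<rho>)"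
        using 1 2 3 by (intro mult_left_mono) auto
      \<comment> \<open>The bound \<open>c\<close> says nothing about the coefficient of the empty
        set, but its term vanishes because all three empty products are 1.\<close>
      moreover have "S = {}" if "card S = 0"
        using that finite_subset[OF S I] by simp
      ultimately show ?thesis by auto
    qed auto
  qed
  also have "\<dots> = (\<Sum>S\<in>{S \<in> Pow I. card S > 0}. (c S)\<^sup>2) * (2 * real p * \<rho>)"
    unfolding sum_distrib_right using I by (intro sum.inter_filter[symmetric]) simp
  also have "\<dots> \<le> 1 * (2 * real p * \<rho>)"
    using c \<rho> by (intro mult_right_mono) auto
  finally show "expectation (\<lambda>\<omega>. (mlf I c (\<lambda>i. A i \<omega>) - mlf I c (\<lambda>i. B i \<omega>))\<^sup>2) \<le> 2 * real p * \<rho>"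
    unfolding qa_def qb_def by simp
qed

section \<open>Invariance principle\<close>

text \<open>In a second-order Taylor expansion around \<open>a\<close>, independence factors each
  term into an expectation in \<open>(a, b)\<close> and a moment of \<open>U\<close> or
  \<open>V\<close>. These moments agree, so only the two remainders are left, each at most
  \<open>C ^ 3 / 6\<close> times the third absolute moment of \<open>b\<close>.\<close>

lemma (in prob_space) iexp_replacement:
  fixes a b U V :: "'a \<Rightarrow> real"
  assumes [measurable]: "a \<in> borel_measurable M" "b \<in> borel_measurable M"
    "U \<in> borel_measurable M" "V \<in> borel_measurable M"
    and ab: "\<And>\<omega>. \<omega> \<in> space M \<Longrightarrow> \<bar>b \<omega>\<bar> \<le> K"
    and UV: "\<And>\<omega>. \<omega> \<in> space M \<Longrightarrow> \<bar>U \<omega>\<bar> \<le> C" "\<And>\<omega>. \<omega> \<in> space M \<Longrightarrow> \<bar>V \<omega>\<bar> \<le> C"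
    and ind: "\<And>(h::real \<times> real \<Rightarrow> complex) g. h \<in> borel_measurable borel \<Longrightarrow> g \<in> borel_measurable borel
        \<Longrightarrow> indep_var borel (\<lambda>\<omega>. h (a \<omega>, b \<omega>)) borel (\<lambda>\<omega>. g (U \<omega>))"
      "\<And>(h::real \<times> real \<Rightarrow> complex) g. h \<in> borel_measurable borel \<Longrightarrow> g \<in> borel_measurable borel
        \<Longrightarrow> indep_var borel (\<lambda>\<omega>. h (a \<omega>, b \<omega>)) borel (\<lambda>\<omega>. g (V \<omega>))"
    and mom: "expectation U = expectation V" "expectation (\<lambda>\<omega>. (U \<omega>)\<^sup>2) = expectation (\<lambda>\<omega>. (V \<omega>)\<^sup>2)"
  shows "cmod (expectation (\<lambda>\<omega>. iexp (a \<omega> + b \<omega> * U \<omega>)) - expectation (\<lambda>\<omega>. iexp (a \<omega> + b \<omega> * V \<omega>)))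
    \<le> C ^ 3 / 3 * expectation (\<lambda>\<omega>. \<bar>b \<omega>\<bar> ^ 3)"
proof -
  \<comment> \<open>\<open>h j\<close> is the factor in front of \<open>W ^ j / fact j\<close> in
    the expansion of \<open>iexp (a + b * W)\<close>.\<close>
  define h where "h j = (\<lambda>(x::real, y::real). iexp x * (\<i> * y) ^ j)" for j :: nat
  have h: "h j \<in> borel_measurable borel" for j
    unfolding h_def by (intro borel_measurable_continuous_onI) (auto simp: case_prod_beta intro!: continuous_intros)
  have hb: "cmod (h j (a \<omega>, b \<omega>)) \<le> K ^ j" if "\<omega> \<in> space M" for \<omega> j
    using power_mono[OF ab[OF that]] by (simp add: h_def norm_mult norm_power)
  have hm [measurable]: "(\<lambda>\<omega>. h j (a \<omega>, b \<omega>)) \<in> borel_measurable M" for j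
    using h by (rule measurable_compose[rotated]) (simp add: borel_prod[symmetric])
  have hint: "integrable M (\<lambda>\<omega>. h j (a \<omega>, b \<omega>))" for j
    using hb by (intro integrable_const_bound[where B="K ^ j"]) auto
  define P where "P W \<omega> = h 0 (a \<omega>, b \<omega>) + h 1 (a \<omega>, b \<omega>) * complex_of_real (W \<omega>)
      + h 2 (a \<omega>, b \<omega>) * complex_of_real ((W \<omega>)\<^sup>2) / 2" for W :: "'a \<Rightarrow> real" and \<omega>
  \<comment> \<open>\<open>G\<close> sees \<open>W\<close> only through its first two moments, so
    \<open>U\<close> and \<open>V\<close> have quadratic approximations of equal
    expectation.\<close>
  define G where "G x y = expectation (\<lambda>\<omega>. h 0 (a \<omega>, b \<omega>)) + expectation (\<lambda>\<omega>. h 1 (a \<omega>, b \<omega>)) * complex_of_real x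
       + expectation (\<lambda>\<omega>. h 2 (a \<omega>, b \<omega>)) * complex_of_real y / 2" for x y
  have main: "integrable M (P W) \<and> expectation (P W) = G (expectation W) (expectation (\<lambda>\<omega>. (W \<omega>)\<^sup>2))
    \<and> cmod (expectation (\<lambda>\<omega>. iexp (a \<omega> + b \<omega> * W \<omega>)) - expectation (P W)) \<le> C ^ 3 / 6 * expectation (\<lambda>\<omega>. \<bar>b \<omega>\<bar> ^ 3)"
    if [measurable]: "W \<in> borel_measurable M" and W: "\<And>\<omega>. \<omega> \<in> space M \<Longrightarrow> \<bar>W \<omega>\<bar> \<le> C"
      and iW: "\<And>(h::real \<times> real \<Rightarrow> complex) g. h \<in> borel_measurable borel \<Longrightarrow> g \<in> borel_measurable borel
        \<Longrightarrow> indep_var borel (\<lambda>\<omega>. h (a \<omega>, b \<omega>)) borel (\<lambda>\<omega>. g (W \<omega>))"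
    for W :: "'a \<Rightarrow> real"
  proof -
    have int: "integrable M (\<lambda>\<omega>. complex_of_real (W \<omega> ^ j))" for j
      using W power_mono[OF W, of _ j]
      by (intro integrable_const_bound[where B="C ^ j"]) (auto simp: norm_power)
    have ij: "indep_var borel (\<lambda>\<omega>. h k (a \<omega>, b \<omega>)) borel (\<lambda>\<omega>. complex_of_real (W \<omega> ^ j))" for k j
      by (rule iW[OF h]) simp
    have e: "expectation (\<lambda>\<omega>. h k (a \<omega>, b \<omega>) * complex_of_real (W \<omega> ^ j))
        = expectation (\<lambda>\<omega>. h k (a \<omega>, b \<omega>)) * of_real (expectation (\<lambda>\<omega>. W \<omega> ^ j))"
      and i: "integrable M (\<lambda>\<omega>. h k (a \<omega>, b \<omega>) * complex_of_real (W \<omega> ^ j))" for k j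
      using indep_var_lebesgue_integral[OF ij hint int] indep_var_integrable[OF ij hint int]
      by (simp_all only: integral_complex_of_real)
    have i1: "integrable M (\<lambda>\<omega>. h 1 (a \<omega>, b \<omega>) * complex_of_real (W \<omega>))"
      and e1: "expectation (\<lambda>\<omega>. h 1 (a \<omega>, b \<omega>) * complex_of_real (W \<omega>))
        = expectation (\<lambda>\<omega>. h 1 (a \<omega>, b \<omega>)) * of_real (expectation W)"
      using i[of 1 1] e[of 1 1] by simp_all
    have intP: "integrable M (P W)"
      unfolding P_def using hint i1 i[of 2 2] by (intro Bochner_Integration.integrable_add integrable_divide) auto
    have eP: "expectation (P W) = G (expectation W) (expectation (\<lambda>\<omega>. (W \<omega>)\<^sup>2))"
      unfolding P_def G_def using hint i1 i[of 2 2] e1 e[of 2 2] by simp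
    have inte: "integrable M (\<lambda>\<omega>. iexp (a \<omega> + b \<omega> * W \<omega>))"
      by (intro integrable_const_bound[where B=1]) auto
    have intb: "integrable M (\<lambda>\<omega>. \<bar>b \<omega>\<bar> ^ 3)"
      using power_mono[OF ab, of _ 3] by (intro integrable_bounded[where B="K ^ 3"]) auto
    have pw: "cmod (iexp (a \<omega> + b \<omega> * W \<omega>) - P W \<omega>) \<le> C ^ 3 / 6 * \<bar>b \<omega>\<bar> ^ 3" if w: "\<omega> \<in> space M" for \<omega>
    proof -
      have "iexp (a \<omega> + b \<omega> * W \<omega>) - P W \<omega>
        = iexp (a \<omega>) * (iexp (b \<omega> * W \<omega>) - (\<Sum>k\<le>2. (\<i> * (b \<omega> * W \<omega>)) ^ k / fact k))"
        by (simp add: P_def h_def numeral_2_eq_2 exp_add algebra_simps power2_eq_square)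
      then have "cmod (iexp (a \<omega> + b \<omega> * W \<omega>) - P W \<omega>)
        = cmod (iexp (b \<omega> * W \<omega>) - (\<Sum>k\<le>2. (\<i> * (b \<omega> * W \<omega>)) ^ k / fact k))"
        by (simp add: norm_mult)
      also have "\<dots> \<le> \<bar>b \<omega> * W \<omega>\<bar> ^ Suc 2 / fact (Suc 2)" by (rule iexp_approx1)
      also have "\<dots> = \<bar>b \<omega>\<bar> ^ 3 * \<bar>W \<omega>\<bar> ^ 3 / 6"
      proof -
        have "Suc 2 = 3" by simp
        then show ?thesis
          by (simp only:) (simp add: abs_mult power_mult_distrib fact_numeral)
      qed
      also have "\<dots> \<le> \<bar>b \<omega>\<bar> ^ 3 * C ^ 3 / 6"
        using W[OF w] by (intro divide_right_mono mult_left_mono power_mono) auto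
      finally show ?thesis by (simp add: mult.commute)
    qed
    have "cmod (expectation (\<lambda>\<omega>. iexp (a \<omega> + b \<omega> * W \<omega>)) - expectation (P W))
      = cmod (expectation (\<lambda>\<omega>. iexp (a \<omega> + b \<omega> * W \<omega>) - P W \<omega>))"
      using inte intP by simp
    also have "\<dots> \<le> expectation (\<lambda>\<omega>. cmod (iexp (a \<omega> + b \<omega> * W \<omega>) - P W \<omega>))"
      by (rule integral_norm_bound)
    also have "\<dots> \<le> expectation (\<lambda>\<omega>. C ^ 3 / 6 * \<bar>b \<omega>\<bar> ^ 3)"
      using inte intP intb pw by (intro integral_mono) auto
    also have "\<dots> = C ^ 3 / 6 * expectation (\<lambda>\<omega>. \<bar>b \<omega>\<bar> ^ 3)" by simp
    finally show ?thesis using intP eP by blast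
  qed
  note mU = main[OF assms(3) UV(1) ind(1)] and mV = main[OF assms(4) UV(2) ind(2)]
  have eq: "expectation (P U) = expectation (P V)"
    using mU mV unfolding mom by metis
  have "cmod (expectation (\<lambda>\<omega>. iexp (a \<omega> + b \<omega> * U \<omega>)) - expectation (P U)) \<le> C ^ 3 / 6 * expectation (\<lambda>\<omega>. \<bar>b \<omega>\<bar> ^ 3)"
    "cmod (expectation (\<lambda>\<omega>. iexp (a \<omega> + b \<omega> * V \<omega>)) - expectation (P V)) \<le> C ^ 3 / 6 * expectation (\<lambda>\<omega>. \<bar>b \<omega>\<bar> ^ 3)"
    using mU mV by blast+
  then show ?thesis
    unfolding eq using norm_triangle_ineq4[of "expectation (\<lambda>\<omega>. iexp (a \<omega> + b \<omega> * U \<omega>)) - expectation (P V)"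
      "expectation (\<lambda>\<omega>. iexp (a \<omega> + b \<omega> * V \<omega>)) - expectation (P V)"]
    by simp
qed

text \<open>Double counting: the square of \<open>c S\<close> is counted \<open>card S\<close>
  times, hence at most \<open>p\<close> times. This lets one-variable errors be added without a
  factor for the number of variables.\<close>

lemma sum_influences:
  fixes c :: "'i set \<Rightarrow> real"
  assumes I: "finite I" and deg: "\<And>S. S \<subseteq> I \<Longrightarrow> c S \<noteq> 0 \<Longrightarrow> card S \<le> p"
    and c: "(\<Sum>S\<in>{S \<in> Pow I. card S > 0}. (c S)\<^sup>2) \<le> 1"
  shows "(\<Sum>k\<in>I. \<Sum>S\<in>{S \<in> Pow I. k \<in> S}. (c S)\<^sup>2) \<le> p"
proof -
  have "(\<Sum>k\<in>I. \<Sum>S\<in>{S \<in> Pow I. k \<in> S}. (c S)\<^sup>2) = (\<Sum>k\<in>I. \<Sum>S\<in>Pow I. if k \<in> S then (c S)\<^sup>2 else 0)"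
    using I by (intro sum.cong sum.inter_filter refl) simp
  also have "\<dots> = (\<Sum>S\<in>Pow I. \<Sum>k\<in>I. if k \<in> S then (c S)\<^sup>2 else 0)"
    by (rule sum.swap)
  also have "\<dots> \<le> (\<Sum>S\<in>Pow I. if card S > 0 then p * (c S)\<^sup>2 else 0)"
  proof (rule sum_mono)
    fix S assume "S \<in> Pow I"
    then have S: "S \<subseteq> I" by simp
    have "(\<Sum>k\<in>I. if k \<in> S then (c S)\<^sup>2 else 0) = card S * (c S)\<^sup>2"
      using I S by (simp add: sum.If_cases Int_absorb1)
    then show "(\<Sum>k\<in>I. if k \<in> S then (c S)\<^sup>2 else 0) \<le> (if card S > 0 then p * (c S)\<^sup>2 else 0)"
      using deg[OF S] by (cases "c S = 0") (auto intro!: mult_right_mono)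
  qed
  also have "\<dots> = (\<Sum>S\<in>{S \<in> Pow I. card S > 0}. p * (c S)\<^sup>2)"
    using I by (intro sum.inter_filter[symmetric]) simp
  also have "\<dots> = p * (\<Sum>S\<in>{S \<in> Pow I. card S > 0}. (c S)\<^sup>2)"
    by (rule sum_distrib_left[symmetric])
  also have "\<dots> \<le> p * 1"
    using mult_left_mono[OF c, of "real p"] by simp
  finally show ?thesis by simp
qed

text \<open>As \<open>4 * C\<^sup>2\<close> is at least 1, every weight is dominated by its
  \<open>p\<close>-th power, which gives a constant depending on \<open>C\<close> and
  \<open>p\<close> alone.\<close>

lemma (in prob_space) mlf_fourth_moment_degree:
  fixes W :: "'i \<Rightarrow> 'a \<Rightarrow> real"
  assumes W: "finite I" "indep_vars (\<lambda>_. borel) W I" "\<And>i. i \<in> I \<Longrightarrow> expectation (W i) = 0"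
      "\<And>i \<omega>. i \<in> I \<Longrightarrow> \<omega> \<in> space M \<Longrightarrow> \<bar>W i \<omega>\<bar> \<le> C"
    and C: "1 \<le> C" and deg: "\<And>S. S \<subseteq> I \<Longrightarrow> c S \<noteq> 0 \<Longrightarrow> card S \<le> p"
  shows "expectation (\<lambda>\<omega>. mlf I c (\<lambda>i. W i \<omega>) ^ 4) \<le> ((4 * C\<^sup>2) ^ p * (\<Sum>S\<in>Pow I. (c S)\<^sup>2))\<^sup>2"
proof -
  have "1 \<le> C\<^sup>2" using C by simp
  then have \<kappa>: "1 \<le> 4 * C\<^sup>2" by simp
  have "(\<Sum>S\<in>Pow I. (4 * C\<^sup>2) ^ card S * (c S)\<^sup>2) \<le> (4 * C\<^sup>2) ^ p * (\<Sum>S\<in>Pow I. (c S)\<^sup>2)"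
    unfolding sum_distrib_left
  proof (rule sum_mono)
    fix S assume "S \<in> Pow I"
    then show "(4 * C\<^sup>2) ^ card S * (c S)\<^sup>2 \<le> (4 * C\<^sup>2) ^ p * (c S)\<^sup>2"
      using deg[of S] \<kappa> by (cases "c S = 0") (simp, intro mult_right_mono power_increasing, auto)
  qed
  then have "(\<Sum>S\<in>Pow I. (4 * C\<^sup>2) ^ card S * (c S)\<^sup>2)\<^sup>2 \<le> ((4 * C\<^sup>2) ^ p * (\<Sum>S\<in>Pow I. (c S)\<^sup>2))\<^sup>2"
    by (intro power_mono sum_nonneg) auto
  with mlf_fourth_moment[OF W] show ?thesis by (rule order_trans)
qed

text \<open>The third moment is interpolated between the second and the fourth by the inequality of
  arithmetic and geometric means with parameter \<open>l\<close>. The result is \<open>v\<close>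
  times a factor that is small once \<open>l\<close> is small and then \<open>\<tau>\<close> is
  small compared with \<open>l\<close>. The remaining factor \<open>v\<close> is kept for summation
  over the variables.\<close>

lemma (in prob_space) mlf_third_abs_moment:
  fixes W :: "'i \<Rightarrow> 'a \<Rightarrow> real"
  assumes I: "finite I" and ind: "indep_vars (\<lambda>_. borel) W I"
    and W: "\<And>i. i \<in> I \<Longrightarrow> expectation (W i) = 0"
    and bd: "\<And>i \<omega>. i \<in> I \<Longrightarrow> \<omega> \<in> space M \<Longrightarrow> \<bar>W i \<omega>\<bar> \<le> C" and C: "1 \<le> C"
    and deg: "\<And>S. S \<subseteq> I \<Longrightarrow> c S \<noteq> 0 \<Longrightarrow> card S \<le> p"
    and v: "(\<Sum>S\<in>Pow I. (c S)\<^sup>2) = v" and \<tau>: "v \<le> \<tau>" and l: "0 < l"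
  shows "expectation (\<lambda>\<omega>. \<bar>mlf I c (\<lambda>i. W i \<omega>)\<bar> ^ 3)
    \<le> (l * (4 * C\<^sup>2) ^ p + ((4 * C\<^sup>2) ^ p)\<^sup>2 * \<tau> / l) / 2 * v"
proof -
  define b where "b = (\<lambda>\<omega>. mlf I c (\<lambda>i. W i \<omega>))"
  define \<kappa> where "\<kappa> = 4 * C\<^sup>2"
  have "W i \<in> borel_measurable M" if "i \<in> I" for i
    using ind that by (auto simp: indep_vars_def)
  then have [measurable]: "b \<in> borel_measurable M"
    unfolding b_def by (intro mlf_measurable)
  have "1 \<le> C\<^sup>2" using C by simp
  then have \<kappa>: "1 \<le> \<kappa>" by (simp add: \<kappa>_def)
  obtain K where K: "\<And>\<omega>. \<omega> \<in> space M \<Longrightarrow> \<bar>b \<omega>\<bar> \<le> K"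
  proof
    show "\<bar>b \<omega>\<bar> \<le> (\<Sum>S\<in>Pow I. \<bar>c S\<bar> * C ^ card S)" if "\<omega> \<in> space M" for \<omega>
      unfolding b_def using bd that by (intro mlf_bounded) auto
  qed
  have int: "integrable M (\<lambda>\<omega>. b \<omega> ^ j)" "integrable M (\<lambda>\<omega>. \<bar>b \<omega>\<bar> ^ j)" for j
    using power_mono[OF K, of _ j] by (auto intro!: integrable_bounded[where B="K ^ j"] simp: power_abs)
  have v0: "0 \<le> v" using v by (auto intro: sum_nonneg)
  have e4: "expectation (\<lambda>\<omega>. b \<omega> ^ 4) \<le> (\<kappa> ^ p * v)\<^sup>2"
    unfolding b_def \<kappa>_def v[symmetric] using I ind W bd C deg by (rule mlf_fourth_moment_degree)
  \<comment> \<open>Jensen's inequality derives the second moment bound from the fourth moment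
    bound.\<close>
  have "(expectation (\<lambda>\<omega>. (b \<omega>)\<^sup>2))\<^sup>2 \<le> expectation (\<lambda>\<omega>. ((b \<omega>)\<^sup>2)\<^sup>2)"
    using int(1)[of 4] by (intro expectation_square_le) (auto simp: power_mult[symmetric])
  also have "\<dots> = expectation (\<lambda>\<omega>. b \<omega> ^ 4)"
    by (simp add: power_mult[symmetric])
  finally have "(expectation (\<lambda>\<omega>. (b \<omega>)\<^sup>2))\<^sup>2 \<le> (\<kappa> ^ p * v)\<^sup>2" using e4 by simp
  then have e2: "expectation (\<lambda>\<omega>. (b \<omega>)\<^sup>2) \<le> \<kappa> ^ p * v"
    using \<kappa> v0 by - (rule power2_le_imp_le, auto)
  have id: "x\<^sup>2 * (l - x)\<^sup>2 = l\<^sup>2 * x\<^sup>2 - 2 * l * x ^ 3 + x ^ 4" for x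
    by (simp add: power2_eq_square power3_eq_cube power4_eq_xxxx algebra_simps)
  have "expectation (\<lambda>\<omega>. \<bar>b \<omega>\<bar> ^ 3) \<le> expectation (\<lambda>\<omega>. (l * (b \<omega>)\<^sup>2 + b \<omega> ^ 4 / l) / 2)"
  proof (rule integral_mono)
    fix \<omega>
    have "0 \<le> \<bar>b \<omega>\<bar>\<^sup>2 * (l - \<bar>b \<omega>\<bar>)\<^sup>2" by simp
    also have "\<dots> = l\<^sup>2 * \<bar>b \<omega>\<bar>\<^sup>2 - 2 * l * \<bar>b \<omega>\<bar> ^ 3 + \<bar>b \<omega>\<bar> ^ 4"
      by (rule id)
    finally have "2 * l * \<bar>b \<omega>\<bar> ^ 3 \<le> l\<^sup>2 * (b \<omega>)\<^sup>2 + b \<omega> ^ 4" by simp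
    then show "\<bar>b \<omega>\<bar> ^ 3 \<le> (l * (b \<omega>)\<^sup>2 + b \<omega> ^ 4 / l) / 2"
      using l by (simp add: field_simps power2_eq_square)
  qed (use int[of 3] int[of 2] int[of 4] in auto)
  also have "\<dots> = (l * expectation (\<lambda>\<omega>. (b \<omega>)\<^sup>2) + expectation (\<lambda>\<omega>. b \<omega> ^ 4) / l) / 2"
    using int(1)[of 2] int(1)[of 4] by simp
  also have "\<dots> \<le> (l * (\<kappa> ^ p * v) + (\<kappa> ^ p * v)\<^sup>2 / l) / 2"
    using e2 e4 l by (intro divide_right_mono add_mono mult_left_mono) auto
  also have "\<dots> = (l * \<kappa> ^ p + (\<kappa> ^ p)\<^sup>2 * v / l) / 2 * v"
    by (simp add: power2_eq_square field_simps)
  also have "\<dots> \<le> (l * \<kappa> ^ p + (\<kappa> ^ p)\<^sup>2 * \<tau> / l) / 2 * v"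
    using \<tau> l v0 by (intro mult_right_mono divide_right_mono add_left_mono mult_left_mono) auto
  finally show ?thesis by (simp add: b_def \<kappa>_def)
qed

text \<open>Lindeberg replacement, one coordinate at a time; \<open>l\<close> is a free parameter
  that avoids taking roots of the influences.\<close>

lemma (in prob_space) mlf_invariance:
  fixes U V :: "'i \<Rightarrow> 'a \<Rightarrow> real"
  assumes I: "finite I"
    and ind: "indep_vars (\<lambda>_. borel \<Otimes>\<^sub>M borel) (\<lambda>i \<omega>. (U i \<omega>, V i \<omega>)) I"
    and mean: "\<And>i. i \<in> I \<Longrightarrow> expectation (U i) = 0" "\<And>i. i \<in> I \<Longrightarrow> expectation (V i) = 0"
    and var: "\<And>i. i \<in> I \<Longrightarrow> expectation (\<lambda>\<omega>. (U i \<omega>)\<^sup>2) = expectation (\<lambda>\<omega>. (V i \<omega>)\<^sup>2)"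
    and bd: "\<And>i \<omega>. i \<in> I \<Longrightarrow> \<omega> \<in> space M \<Longrightarrow> \<bar>U i \<omega>\<bar> \<le> C"
      "\<And>i \<omega>. i \<in> I \<Longrightarrow> \<omega> \<in> space M \<Longrightarrow> \<bar>V i \<omega>\<bar> \<le> C" and C: "1 \<le> C"
    and deg: "\<And>S. S \<subseteq> I \<Longrightarrow> c S \<noteq> 0 \<Longrightarrow> card S \<le> p"
    and c: "(\<Sum>S\<in>{S \<in> Pow I. card S > 0}. (c S)\<^sup>2) \<le> 1"
    and inf: "\<And>k. k \<in> I \<Longrightarrow> (\<Sum>S\<in>{S \<in> Pow I. k \<in> S}. (c S)\<^sup>2) \<le> \<tau>" and l: "0 < l" and \<tau>: "0 \<le> \<tau>"
  shows "cmod (expectation (\<lambda>\<omega>. iexp (t * mlf I c (\<lambda>i. U i \<omega>))) - expectation (\<lambda>\<omega>. iexp (t * mlf I c (\<lambda>i. V i \<omega>))))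
    \<le> C ^ 3 / 3 * (\<bar>t\<bar> ^ 3 * ((l * (4 * C\<^sup>2) ^ p + ((4 * C\<^sup>2) ^ p)\<^sup>2 * \<tau> / l) / 2)) * p"
proof -
  define E where "E = (l * (4 * C\<^sup>2) ^ p + ((4 * C\<^sup>2) ^ p)\<^sup>2 * \<tau> / l) / 2"
  define v where "v k = (\<Sum>S\<in>{S \<in> Pow I. k \<in> S}. (c S)\<^sup>2)" for k
  \<comment> \<open>Hybrid family: the variables in \<open>J\<close> are already replaced by
    \<open>V\<close>, the others are still \<open>U\<close>.\<close>
  define W where "W J i \<omega> = (if i \<in> J then V i \<omega> else U i \<omega>)" for J i \<omega>
  have rv: "(\<lambda>\<omega>. (U i \<omega>, V i \<omega>)) \<in> measurable M (borel \<Otimes>\<^sub>M borel)" if "i \<in> I" for i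
    using ind that by (auto simp: indep_vars_def)
  have mU: "U i \<in> borel_measurable M" and mV: "V i \<in> borel_measurable M" if "i \<in> I" for i
    using measurable_compose[OF rv[OF that] measurable_fst] measurable_compose[OF rv[OF that] measurable_snd]
    by auto
  have mW: "W J i \<in> borel_measurable M" if "i \<in> I" for J i
    unfolding W_def[abs_def] using mU[OF that] mV[OF that] by (cases "i \<in> J") auto
  have step: "cmod (expectation (\<lambda>\<omega>. iexp (t * mlf I c (\<lambda>i. W J i \<omega>)))
      - expectation (\<lambda>\<omega>. iexp (t * mlf I c (\<lambda>i. W (insert k J) i \<omega>)))) \<le> C ^ 3 / 3 * (\<bar>t\<bar> ^ 3 * E) * v k"
    if k: "k \<in> I" "k \<notin> J" for k J
  proof -
    define K where "K = I - {k}"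
    have K: "finite K" "k \<notin> K" "I = insert k K" using I k by (auto simp: K_def)
    define ck where "ck S = c (insert k S)" for S
    define a b where "a \<omega> = mlf K c (\<lambda>i. W J i \<omega>)" and "b \<omega> = mlf K ck (\<lambda>i. W J i \<omega>)" for \<omega>
    have eqK: "mlf K d (\<lambda>i. W (insert k J) i \<omega>) = mlf K d (\<lambda>i. W J i \<omega>)" for d \<omega>
      using K by (intro mlf_cong) (auto simp: W_def)
    have eqU: "t * mlf I c (\<lambda>i. W J i \<omega>) = t * a \<omega> + t * b \<omega> * U k \<omega>"
      and eqV: "t * mlf I c (\<lambda>i. W (insert k J) i \<omega>) = t * a \<omega> + t * b \<omega> * V k \<omega>" for \<omega>
      using k unfolding K(3) mlf_insert[OF K(1,2)] eqK
      by (simp_all add: a_def b_def ck_def[abs_def] W_def algebra_simps)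
    have [measurable]: "a \<in> borel_measurable M" "b \<in> borel_measurable M"
      unfolding a_def b_def using K mW by (auto intro!: mlf_measurable)
    have bK: "\<bar>t * b \<omega>\<bar> \<le> \<bar>t\<bar> * (\<Sum>S\<in>Pow K. \<bar>ck S\<bar> * C ^ card S)" if "\<omega> \<in> space M" for \<omega>
      unfolding b_def abs_mult using bd that K by (intro mult_left_mono mlf_bounded) (auto simp: W_def)
    \<comment> \<open>\<open>a\<close> and \<open>b\<close> are functions of the pairs with index in
      \<open>K\<close>, while \<open>U k\<close> and \<open>V k\<close> are functions of the pair
      with index \<open>k\<close>. The two members of one pair may be dependent, as they are for two
      rotations of the same variables.\<close>
    have indk: "indep_var borel (\<lambda>\<omega>. h (t * a \<omega>, t * b \<omega>)) borel (\<lambda>\<omega>. g (f (U k \<omega>, V k \<omega>)))"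
      if [measurable]: "h \<in> borel_measurable borel" "g \<in> borel_measurable borel"
        "f \<in> borel_measurable (borel \<Otimes>\<^sub>M borel)" for h :: "real \<times> real \<Rightarrow> complex" and g :: "real \<Rightarrow> complex" and f
    proof -
      have "indep_var borel (\<lambda>\<omega>. (\<lambda>x. h (t * mlf K c (\<lambda>i. if i \<in> J then snd (x i) else fst (x i)),
          t * mlf K ck (\<lambda>i. if i \<in> J then snd (x i) else fst (x i)))) (\<lambda>i\<in>K. (U i \<omega>, V i \<omega>)))
          borel (\<lambda>\<omega>. (\<lambda>x. g (f x)) (U k \<omega>, V k \<omega>))"
      proof (rule indep_var_insert[OF ind[unfolded K(3)] K(2)])
        have [measurable]: "(\<lambda>x. mlf K d (\<lambda>i. if i \<in> J then snd (x i) else fst (x i)))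
          \<in> borel_measurable (PiM K (\<lambda>_. borel \<Otimes>\<^sub>M borel))" for d
        proof (rule mlf_measurable)
          fix i assume "i \<in> K"
          then have [measurable]: "(\<lambda>x. x i) \<in> measurable (PiM K (\<lambda>_. borel \<Otimes>\<^sub>M borel)) (borel \<Otimes>\<^sub>M borel)"
            by (rule measurable_component_singleton)
          show "(\<lambda>x. if i \<in> J then snd (x i) else fst (x i)) \<in> borel_measurable (PiM K (\<lambda>_. borel \<Otimes>\<^sub>M borel))"
            by (cases "i \<in> J") (simp_all, measurable)
        qed
        show "(\<lambda>x. h (t * mlf K c (\<lambda>i. if i \<in> J then snd (x i) else fst (x i)),
          t * mlf K ck (\<lambda>i. if i \<in> J then snd (x i) else fst (x i))))
            \<in> borel_measurable (PiM K (\<lambda>_. borel \<Otimes>\<^sub>M borel))"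
        proof (rule measurable_compose[OF _ that(1)])
          show "(\<lambda>x. (t * mlf K c (\<lambda>i. if i \<in> J then snd (x i) else fst (x i)),
            t * mlf K ck (\<lambda>i. if i \<in> J then snd (x i) else fst (x i))))
            \<in> measurable (PiM K (\<lambda>_. borel \<Otimes>\<^sub>M borel)) borel"
            unfolding borel_prod[symmetric] by measurable
        qed
      qed measurable
      moreover have "mlf K d (\<lambda>i. if i \<in> J then snd ((\<lambda>i\<in>K. (U i \<omega>, V i \<omega>)) i) else fst ((\<lambda>i\<in>K. (U i \<omega>, V i \<omega>)) i))
        = mlf K d (\<lambda>i. W J i \<omega>)" for d \<omega>
        by (rule mlf_cong) (simp add: W_def)
      ultimately show ?thesis by (simp add: a_def b_def)
    qed
    have indU: "indep_var borel (\<lambda>\<omega>. h (t * a \<omega>, t * b \<omega>)) borel (\<lambda>\<omega>. g (U k \<omega>))"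
      and indV: "indep_var borel (\<lambda>\<omega>. h (t * a \<omega>, t * b \<omega>)) borel (\<lambda>\<omega>. g (V k \<omega>))"
      if "h \<in> borel_measurable borel" "g \<in> borel_measurable borel" for h :: "real \<times> real \<Rightarrow> complex" and g :: "real \<Rightarrow> complex"
      using indk[OF that measurable_fst] indk[OF that measurable_snd] by simp_all
    have 1: "cmod (expectation (\<lambda>\<omega>. iexp (t * a \<omega> + t * b \<omega> * U k \<omega>)) - expectation (\<lambda>\<omega>. iexp (t * a \<omega> + t * b \<omega> * V k \<omega>)))
      \<le> C ^ 3 / 3 * expectation (\<lambda>\<omega>. \<bar>t * b \<omega>\<bar> ^ 3)"
      by (rule iexp_replacement[where a="\<lambda>\<omega>. t * a \<omega>" and b="\<lambda>\<omega>. t * b \<omega>" and U="U k" and V="V k", OF _ _ mU[OF k(1)] mV[OF k(1)] bK bd(1)[OF k(1)] bd(2)[OF k(1)] indU indV])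
        (simp_all add: mean[OF k(1)] var[OF k(1)])
    \<comment> \<open>The squared coefficient norm of the slope in variable \<open>k\<close> is
      exactly the influence of \<open>k\<close>.\<close>
    have vk: "(\<Sum>S\<in>Pow K. (ck S)\<^sup>2) = v k"
    proof -
      have "v k = (\<Sum>S\<in>Pow I. if k \<in> S then (c S)\<^sup>2 else 0)"
        unfolding v_def using I by (intro sum.inter_filter) simp
      also have "\<dots> = (\<Sum>S\<in>Pow K. if k \<in> S then (c S)\<^sup>2 else 0) + (\<Sum>S\<in>Pow K. (ck S)\<^sup>2)"
        unfolding K(3) sum_Pow_insert[OF K(1,2)] by (simp add: ck_def)
      also have "(\<Sum>S\<in>Pow K. if k \<in> S then (c S)\<^sup>2 else 0) = 0"
        using K(2) by (intro sum.neutral) auto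
      finally show ?thesis by simp
    qed
    have "indep_vars (\<lambda>_. borel \<Otimes>\<^sub>M borel) (\<lambda>i \<omega>. (U i \<omega>, V i \<omega>)) K"
      using ind by (rule indep_vars_subset) (auto simp: K_def)
    moreover have "(\<lambda>(x, y). if i \<in> J then y else x) \<in> borel_measurable (borel \<Otimes>\<^sub>M borel)" for i
      by (cases "i \<in> J") auto
    ultimately have "indep_vars (\<lambda>_. borel) (\<lambda>i \<omega>. (\<lambda>i (x, y). if i \<in> J then y else x) i (U i \<omega>, V i \<omega>)) K"
      by (rule indep_vars_compose2)
    then have indW: "indep_vars (\<lambda>_. borel) (W J) K"
      by (simp add: W_def[abs_def])
    have 2: "expectation (\<lambda>\<omega>. \<bar>b \<omega>\<bar> ^ 3) \<le> E * v k"
      unfolding b_def E_def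
    proof (rule mlf_third_abs_moment[OF K(1) indW])
      show "expectation (W J i) = 0" if "i \<in> K" for i
        using that mean K by (cases "i \<in> J") (auto simp: W_def[abs_def])
      show "card S \<le> p" if "S \<subseteq> K" "ck S \<noteq> 0" for S
      proof -
        have "card S \<le> card (insert k S)"
          using finite_subset[OF that(1) K(1)] by (intro card_mono) auto
        also have "\<dots> \<le> p" using that K by (intro deg) (auto simp: ck_def)
        finally show ?thesis .
      qed
      show "v k \<le> \<tau>" using inf[OF k(1)] by (simp add: v_def)
    qed (use bd C K l vk in \<open>auto simp: W_def\<close>)
    have C3: "0 \<le> C ^ 3 / 3" using C by simp
    have "expectation (\<lambda>\<omega>. \<bar>t * b \<omega>\<bar> ^ 3) = \<bar>t\<bar> ^ 3 * expectation (\<lambda>\<omega>. \<bar>b \<omega>\<bar> ^ 3)"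
      by (simp add: abs_mult power_mult_distrib)
    also have "\<dots> \<le> \<bar>t\<bar> ^ 3 * (E * v k)"
      using 2 by (intro mult_left_mono) auto
    finally have "C ^ 3 / 3 * expectation (\<lambda>\<omega>. \<bar>t * b \<omega>\<bar> ^ 3) \<le> C ^ 3 / 3 * (\<bar>t\<bar> ^ 3 * (E * v k))"
      using C3 by (rule mult_left_mono)
    then show ?thesis
      unfolding eqU eqV using 1 by (simp add: mult.assoc)
  qed
  have "cmod (expectation (\<lambda>\<omega>. iexp (t * mlf I c (\<lambda>i. W {} i \<omega>))) - expectation (\<lambda>\<omega>. iexp (t * mlf I c (\<lambda>i. W J i \<omega>))))
     \<le> (\<Sum>k\<in>J. C ^ 3 / 3 * (\<bar>t\<bar> ^ 3 * E) * v k)" if "finite J" "J \<subseteq> I" for J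
    using that
  proof (induction J rule: finite_induct)
    case (insert k J)
    then have "cmod (expectation (\<lambda>\<omega>. iexp (t * mlf I c (\<lambda>i. W {} i \<omega>))) - expectation (\<lambda>\<omega>. iexp (t * mlf I c (\<lambda>i. W J i \<omega>))))
       \<le> (\<Sum>k\<in>J. C ^ 3 / 3 * (\<bar>t\<bar> ^ 3 * E) * v k)"
      by auto
    moreover have "cmod (expectation (\<lambda>\<omega>. iexp (t * mlf I c (\<lambda>i. W J i \<omega>)))
      - expectation (\<lambda>\<omega>. iexp (t * mlf I c (\<lambda>i. W (insert k J) i \<omega>)))) \<le> C ^ 3 / 3 * (\<bar>t\<bar> ^ 3 * E) * v k"
      using insert by (intro step) auto
    ultimately have "cmod (expectation (\<lambda>\<omega>. iexp (t * mlf I c (\<lambda>i. W {} i \<omega>)))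
        - expectation (\<lambda>\<omega>. iexp (t * mlf I c (\<lambda>i. W (insert k J) i \<omega>))))
      \<le> (\<Sum>k\<in>J. C ^ 3 / 3 * (\<bar>t\<bar> ^ 3 * E) * v k) + C ^ 3 / 3 * (\<bar>t\<bar> ^ 3 * E) * v k"
      by (rule norm_diff_triangle_le)
    then show ?case using insert.hyps by (simp add: add.commute)
  qed simp
  from this[OF I order_refl]
  have "cmod (expectation (\<lambda>\<omega>. iexp (t * mlf I c (\<lambda>i. W {} i \<omega>))) - expectation (\<lambda>\<omega>. iexp (t * mlf I c (\<lambda>i. W I i \<omega>))))
     \<le> C ^ 3 / 3 * (\<bar>t\<bar> ^ 3 * E) * (\<Sum>k\<in>I. v k)"
    by (simp only: sum_distrib_left)
  \<comment> \<open>Each replacement costs a fixed multiple of one influence, and the influences sum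
    to at most \<open>p\<close>.\<close>
  also have "\<dots> \<le> C ^ 3 / 3 * (\<bar>t\<bar> ^ 3 * E) * p"
    unfolding v_def using C l \<tau> I deg c
    by (intro mult_left_mono sum_influences) (auto simp: E_def)
  finally have *: "cmod (expectation (\<lambda>\<omega>. iexp (t * mlf I c (\<lambda>i. W {} i \<omega>)))
      - expectation (\<lambda>\<omega>. iexp (t * mlf I c (\<lambda>i. W I i \<omega>)))) \<le> C ^ 3 / 3 * (\<bar>t\<bar> ^ 3 * E) * p" .
  have "mlf I c (\<lambda>i. W {} i \<omega>) = mlf I c (\<lambda>i. U i \<omega>)" "mlf I c (\<lambda>i. W I i \<omega>) = mlf I c (\<lambda>i. V i \<omega>)" for \<omega>
    by (auto intro!: mlf_cong simp: W_def)
  with * show ?thesis by (simp add: E_def)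
qed

section \<open>Real trigonometric polynomials\<close>

text \<open>On the unit circle \<open>T x = z powi (- p) * P z\<close> with \<open>z = cis x\<close>: the frequencies of \<open>T\<close> range from \<open>- p\<close> to \<open>p\<close>.\<close>

definition trig_poly :: "nat \<Rightarrow> (real \<Rightarrow> real) \<Rightarrow> bool" where
  "trig_poly p T \<longleftrightarrow> (\<exists>P. degree P \<le> 2 * p \<and> (\<forall>x. complex_of_real (T x) * cis x ^ p = poly P (cis x)))"

lemma trig_polyI:
  "degree P \<le> 2 * p \<Longrightarrow> (\<And>x. complex_of_real (T x) * cis x ^ p = poly P (cis x)) \<Longrightarrow> trig_poly p T"
  unfolding trig_poly_def by blast

lemma trig_polyE:
  assumes "trig_poly p T"
  obtains P where "degree P \<le> 2 * p" "\<And>x. complex_of_real (T x) * cis x ^ p = poly P (cis x)"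
  using assms unfolding trig_poly_def by blast

lemma trig_poly_const: "trig_poly p (\<lambda>_. c)"
  by (rule trig_polyI[of "monom (of_real c) p"]) (auto simp: poly_monom degree_monom_eq intro: degree_monom_le[THEN order_trans])

lemma trig_poly_add:
  assumes "trig_poly p S" "trig_poly p T"
  shows "trig_poly p (\<lambda>x. S x + T x)"
proof -
  obtain P Q where P: "degree P \<le> 2 * p" "\<And>x. complex_of_real (S x) * cis x ^ p = poly P (cis x)"
    and Q: "degree Q \<le> 2 * p" "\<And>x. complex_of_real (T x) * cis x ^ p = poly Q (cis x)"
    using assms by (metis trig_polyE)
  show ?thesis
    by (rule trig_polyI[of "P + Q"]) (use P Q degree_add_le in \<open>auto simp: ring_distribs\<close>)
qed

lemma trig_poly_mult:
  assumes "trig_poly p S" "trig_poly q T"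
  shows "trig_poly (p + q) (\<lambda>x. S x * T x)"
proof -
  obtain P Q where P: "degree P \<le> 2 * p" "\<And>x. complex_of_real (S x) * cis x ^ p = poly P (cis x)"
    and Q: "degree Q \<le> 2 * q" "\<And>x. complex_of_real (T x) * cis x ^ q = poly Q (cis x)"
    using assms by (metis trig_polyE)
  show ?thesis
  proof (rule trig_polyI[of "P * Q"])
    show "degree (P * Q) \<le> 2 * (p + q)"
      using degree_mult_le[of P Q] P(1) Q(1) by simp
    show "complex_of_real (S x * T x) * cis x ^ (p + q) = poly (P * Q) (cis x)" for x
      by (simp add: P(2)[symmetric] Q(2)[symmetric] power_add)
  qed
qed

lemma trig_poly_sum:
  "finite A \<Longrightarrow> (\<And>i. i \<in> A \<Longrightarrow> trig_poly p (T i)) \<Longrightarrow> trig_poly p (\<lambda>x. \<Sum>i\<in>A. T i x)"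
  by (induction A rule: finite_induct) (auto intro: trig_poly_const trig_poly_add)

lemma trig_poly_prod:
  "finite A \<Longrightarrow> (\<And>i. i \<in> A \<Longrightarrow> trig_poly 1 (T i)) \<Longrightarrow> trig_poly (card A) (\<lambda>x. \<Prod>i\<in>A. T i x)"
proof (induction A rule: finite_induct)
  case (insert i A)
  then show ?case using trig_poly_mult[of 1 "T i" "card A"] by simp
qed (auto intro: trig_poly_const)

lemma trig_poly_mono:
  assumes "trig_poly p T" "p \<le> q"
  shows "trig_poly q T"
  using trig_poly_mult[OF assms(1) trig_poly_const[of "q - p" 1]] assms(2) by simp

text \<open>With \<open>z = cis x\<close> the function is half the sum of
  \<open>Complex a b / z\<close> and \<open>Complex a (- b) * z\<close>; multiplication by
  \<open>z\<close> gives the displayed polynomial.\<close>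

lemma trig_poly_rotation: "trig_poly 1 (\<lambda>x. cos x * a + sin x * b)"
proof (rule trig_polyI[of "[: Complex a b / 2, 0, Complex a (- b) / 2 :]"])
  fix x :: real
  have h: "u * (cos x * cos x) + u * (sin x * sin x) = u" for u
    by (simp add: distrib_left[symmetric] power2_eq_square[symmetric])
  show "complex_of_real (cos x * a + sin x * b) * cis x ^ 1
      = poly [: Complex a b / 2, 0, Complex a (- b) / 2 :] (cis x)"
    using h[of a] h[of b] by (simp add: complex_eq_iff field_simps power2_eq_square)
qed simp

text \<open>Every monomial with a nonzero coefficient is a product of at most \<open>p\<close>
  rotations of degree 1, so the degree does not grow with the number of variables.\<close>

lemma trig_poly_mlf:
  assumes I: "finite I" and deg: "\<And>S. S \<subseteq> I \<Longrightarrow> c S \<noteq> 0 \<Longrightarrow> card S \<le> p"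
  shows "trig_poly p (\<lambda>x. mlf I c (\<lambda>i. cos x * a i + sin x * b i))"
  unfolding mlf_def
proof (rule trig_poly_sum)
  fix S assume "S \<in> Pow I"
  then have S: "S \<subseteq> I" "finite S" using I finite_subset by auto
  show "trig_poly p (\<lambda>x. c S * (\<Prod>i\<in>S. cos x * a i + sin x * b i))"
  proof (cases "c S = 0")
    case True
    then show ?thesis by (simp add: trig_poly_const)
  next
    case False
    have "trig_poly (0 + card S) (\<lambda>x. c S * (\<Prod>i\<in>S. cos x * a i + sin x * b i))"
      by (intro trig_poly_mult trig_poly_const trig_poly_prod trig_poly_rotation S)
    then show ?thesis
      using deg[OF S(1) False] by (auto intro: trig_poly_mono)
  qed
qed (use I in simp)

lemma trig_poly_period: "trig_poly p T \<Longrightarrow> T (2 * pi) = T 0"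
proof (elim trig_polyE)
  fix P assume P: "\<And>x. complex_of_real (T x) * cis x ^ p = poly P (cis x)"
  show "T (2 * pi) = T 0"
    using P[of 0] P[of "2 * pi"] by (simp flip: of_real_eq_iff[where 'a=complex])
qed

lemma cis_has_vector_derivative: "((\<lambda>x. cis (a * x)) has_vector_derivative (\<i> * of_real a * cis (a * x))) (at x)"
proof -
  have "((\<lambda>z. exp (\<i> * of_real a * z)) has_field_derivative (\<i> * of_real a * exp (\<i> * of_real a * of_real x))) (at (of_real x))"
    by (auto intro!: derivative_eq_intros)
  then have "((\<lambda>x. exp (\<i> * of_real a * of_real x)) has_vector_derivative (\<i> * of_real a * exp (\<i> * of_real a * of_real x))) (at x)"
    by (rule has_vector_derivative_real_field)
  then show ?thesis by (simp add: cis_conv_exp mult.assoc)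
qed

lemma poly_extended_sum:
  fixes P :: "complex poly"
  assumes "degree P \<le> n"
  shows "poly P z = (\<Sum>k\<le>n. coeff P k * z ^ k)"
  unfolding poly_altdef using assms
  by (intro sum.mono_neutral_left) (auto simp: coeff_eq_0)

text \<open>Each Fourier coefficient is at most the L1 norm divided by \<open>2 * pi\<close>; there
  are \<open>2 * p + 1\<close> frequencies, each of modulus at most \<open>p\<close>. This crude
  Bernstein inequality bounds the derivative uniformly by an L1 norm, whose expectation can be
  controlled later.\<close>

lemma trig_poly_derivative:
  assumes "trig_poly p T"
  obtains T' where "trig_poly p T'" "\<And>x. (T has_real_derivative T' x) (at x)"
    "\<And>x. \<bar>T' x\<bar> \<le> real ((2 * p + 1) * p) / (2 * pi) * integral {0..2 * pi} (\<lambda>y. \<bar>T y\<bar>)"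
proof -
  obtain P where P: "degree P \<le> 2 * p" "\<And>x. complex_of_real (T x) * cis x ^ p = poly P (cis x)"
    using assms by (rule trig_polyE) blast
  \<comment> \<open>\<open>m k\<close> is the frequency that belongs to the coefficient of index
    \<open>k\<close> of \<open>P\<close>.\<close>
  define m where "m k = real k - real p" for k
  define D where "D x = (\<Sum>k\<le>2 * p. coeff P k * (\<i> * of_real (m k) * cis (m k * x)))" for x
  have cisp: "cis (m k * x) * cis x ^ p = cis x ^ k" for k x
  proof -
    have "m k * x + real p * x = real k * x" by (simp add: m_def algebra_simps)
    then show ?thesis by (simp only: Complex.DeMoivre cis_mult)
  qed
  have Teq: "complex_of_real (T x) = (\<Sum>k\<le>2 * p. coeff P k * cis (m k * x))" for x
  proof -
    have "(\<Sum>k\<le>2 * p. coeff P k * cis (m k * x)) * cis x ^ p = (\<Sum>k\<le>2 * p. coeff P k * cis x ^ k)"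
      unfolding sum_distrib_right mult.assoc cisp ..
    also have "\<dots> = complex_of_real (T x) * cis x ^ p"
      by (simp add: P poly_extended_sum[OF P(1)])
    finally show ?thesis by simp
  qed
  have vd: "((\<lambda>x. complex_of_real (T x)) has_vector_derivative D x) (at x)" for x
    unfolding Teq D_def
    by (intro has_vector_derivative_sum has_vector_derivative_mult_right cis_has_vector_derivative)
  define T' where "T' x = Re (D x)" for x
  have der: "(T has_real_derivative T' x) (at x)" for x
    using has_field_derivative_Re[OF vd] by (simp add: T'_def)
  \<comment> \<open>\<open>D\<close> differentiates a real-valued function and is therefore real;
    uniqueness of derivatives identifies it with \<open>T'\<close>.\<close>
  have "((\<lambda>x. complex_of_real (T x)) has_vector_derivative complex_of_real (T' x)) (at x)" for x
    using der by (rule has_vector_derivative_of_real)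
  then have DT': "complex_of_real (T' x) = D x" for x
    using vd vector_derivative_unique_at by blast
  define R where "R = (\<Sum>k\<le>2 * p. monom (coeff P k * (\<i> * of_real (m k))) k)"
  have "trig_poly p T'"
  proof (rule trig_polyI[of R])
    show "degree R \<le> 2 * p"
      unfolding R_def by (intro degree_sum_le) (auto intro: degree_monom_le[THEN order_trans])
    show "complex_of_real (T' x) * cis x ^ p = poly R (cis x)" for x
    proof -
      have "D x * cis x ^ p = (\<Sum>k\<le>2 * p. coeff P k * (\<i> * of_real (m k)) * (cis (m k * x) * cis x ^ p))"
        unfolding D_def sum_distrib_right by (intro sum.cong) (auto simp: mult_ac)
      then show ?thesis unfolding DT' cisp by (simp add: R_def poly_sum poly_monom)
    qed
  qed
  have contT: "continuous_on A T" for A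
    using der by (meson DERIV_continuous continuous_at_imp_continuous_on)
  define J where "J = integral {0..2 * pi} (\<lambda>y. \<bar>T y\<bar>)"
  have J: "0 \<le> J" unfolding J_def using contT
    by (intro integral_nonneg integrable_continuous_real continuous_intros) auto
  have coeff: "cmod (coeff P j) \<le> J / (2 * pi)" if "j \<le> 2 * p" for j
  proof -
    \<comment> \<open>Orthogonality of the exponentials: integrating \<open>T\<close> against
      \<open>cis (- m j * x)\<close> isolates \<open>coeff P j\<close>.\<close>
    have int: "((\<lambda>x. cis ((real k - real j) * x)) has_integral (if k = j then 2 * pi else 0)) {0..2 * pi}" for k
    proof (cases "k = j")
      case True
      then show ?thesis using has_integral_const_real[of "1::complex" 0 "2 * pi"] by (simp add: scaleR_conv_of_real)
    next
      case False
      define a where "a = real k - real j"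
      have a: "a \<noteq> 0" using False by (simp add: a_def)
      have "((\<lambda>x. cis (a * x)) has_integral (cis (a * (2 * pi)) / (\<i> * of_real a) - cis (a * 0) / (\<i> * of_real a))) {0..2 * pi}"
      proof (rule fundamental_theorem_of_calculus)
        fix x :: real
        have "((\<lambda>x. cis (a * x) / (\<i> * of_real a)) has_vector_derivative (\<i> * of_real a * cis (a * x)) / (\<i> * of_real a)) (at x)"
          by (intro has_vector_derivative_divide cis_has_vector_derivative)
        then show "((\<lambda>x. cis (a * x) / (\<i> * of_real a)) has_vector_derivative cis (a * x)) (at x within {0..2 * pi})"
          using a by (simp add: has_vector_derivative_at_within)
      qed simp
      moreover have "cis (a * (2 * pi)) = 1"
      proof -
        have "a \<in> \<int>" unfolding a_def by simp
        then have "cis (2 * pi * a) = 1" by (rule cis_multiple_2pi)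
        then show ?thesis by (simp add: mult_ac)
      qed
      ultimately show ?thesis using False by (simp add: a_def)
    qed
    have eq: "complex_of_real (T x) * cis (- m j * x) = (\<Sum>k\<le>2 * p. coeff P k * cis ((real k - real j) * x))" for x
      unfolding Teq sum_distrib_right mult.assoc cis_mult by (simp add: m_def algebra_simps)
    have "((\<lambda>x. \<Sum>k\<le>2 * p. coeff P k * cis ((real k - real j) * x))
        has_integral (\<Sum>k\<le>2 * p. coeff P k * (if k = j then 2 * pi else 0))) {0..2 * pi}"
      by (intro has_integral_sum has_integral_mult_right int) simp
    also have "(\<Sum>k\<le>2 * p. coeff P k * (if k = j then 2 * pi else 0)) = (\<Sum>k\<le>2 * p. if k = j then coeff P k * (2 * pi) else 0)"
      by (intro sum.cong) auto
    also have "\<dots> = coeff P j * (2 * pi)"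
      using that by (simp add: sum.delta)
    finally have hi: "((\<lambda>x. complex_of_real (T x) * cis (- m j * x)) has_integral coeff P j * (2 * pi)) {0..2 * pi}"
      unfolding eq .
    have "cmod (coeff P j * (2 * pi)) = cmod (integral {0..2 * pi} (\<lambda>x. complex_of_real (T x) * cis (- m j * x)))"
      using hi by (simp add: integral_unique)
    also have "\<dots> \<le> J"
      unfolding J_def
    proof (rule integral_norm_bound_integral)
      show "(\<lambda>x. complex_of_real (T x) * cis (- m j * x)) integrable_on {0..2 * pi}"
        using hi by blast
      show "(\<lambda>y. \<bar>T y\<bar>) integrable_on {0..2 * pi}"
        by (intro integrable_continuous_real continuous_intros contT)
    qed (simp add: norm_mult)
    finally show ?thesis by (simp add: norm_mult field_simps)
  qed
  have "\<bar>T' x\<bar> \<le> real ((2 * p + 1) * p) / (2 * pi) * J" for x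
  proof -
    have "\<bar>T' x\<bar> = cmod (D x)" by (simp add: DT'[symmetric])
    also have "\<dots> \<le> (\<Sum>k\<le>2 * p. cmod (coeff P k * (\<i> * of_real (m k) * cis (m k * x))))"
      unfolding D_def by (rule norm_sum)
    also have "\<dots> \<le> (\<Sum>k\<le>2 * p. J / (2 * pi) * real p)"
    proof (rule sum_mono)
      fix k assume k: "k \<in> {..2 * p}"
      have "\<bar>m k\<bar> \<le> p" using k by (auto simp: m_def)
      then have "cmod (coeff P k) * \<bar>m k\<bar> \<le> J / (2 * pi) * real p"
        using coeff[of k] k J by (intro mult_mono) auto
      then show "cmod (coeff P k * (\<i> * of_real (m k) * cis (m k * x))) \<le> J / (2 * pi) * real p"
        by (simp add: norm_mult)
    qed
    also have "\<dots> = real ((2 * p + 1) * p) / (2 * pi) * J" by (simp add: field_simps)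
    finally show ?thesis .
  qed
  with \<open>trig_poly p T'\<close> der show thesis
    unfolding J_def by (rule that)
qed

lemma trig_poly_continuous: "trig_poly p T \<Longrightarrow> continuous_on A T"
  by (meson trig_poly_derivative DERIV_continuous continuous_at_imp_continuous_on)

section \<open>Sublevel sets and occupation times of trigonometric polynomials\<close>

lemma fmeasurable_Icc: "{a..b::real} \<in> fmeasurable lborel"
  by (cases "a \<le> b") (auto intro!: fmeasurableI)

lemma sin_lower_bound:
  assumes "0 < e" "e \<le> pi / 2" "e \<le> x" "x \<le> pi - e"
  shows "sin e \<le> sin x"
proof (cases "x \<le> pi / 2")
  case True
  then show ?thesis using assms by (intro sin_monotone_2pi_le) auto
next
  case False
  then have "sin e \<le> sin (pi - x)" using assms by (intro sin_monotone_2pi_le) auto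
  then show ?thesis by simp
qed

lemma norm_cis_diff: "cmod (cis x - cis y) = 2 * \<bar>sin ((x - y) / 2)\<bar>"
proof -
  have "cis x - cis y = cis y * (cis (x - y) - 1)"
    by (simp add: right_diff_distrib cis_mult)
  then have "cmod (cis x - cis y) = cmod (cis (x - y) - 1)"
    by (simp add: norm_mult)
  also have "\<dots> = 2 * \<bar>sin ((x - y) / 2)\<bar>"
    using dist_exp_i_1[of "x - y"] by (simp add: cis_conv_exp)
  finally show ?thesis .
qed

text \<open>The centre of the disc may lie off the circle, so all points are compared with one point
  \<open>y\<close> of the set. The chord from \<open>x\<close> to \<open>y\<close> is shorter than
  \<open>2 * sin e\<close>, hence \<open>x\<close> is within \<open>2 * e\<close> of
  \<open>y\<close> up to a full turn. Wrapping around can only happen within \<open>2 * e\<close> of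
  the endpoints of \<open>{0..2 * pi}\<close>, and the lengths add up to
  \<open>4 * e + 2 * e + 2 * e\<close>.\<close>

lemma arc_measure:
  assumes e: "0 < e" "e \<le> pi / 2"
  shows "measure lborel {x \<in> {0..2 * pi}. cmod (cis x - \<zeta>) < sin e} \<le> 8 * e"
proof (cases "{x \<in> {0..2 * pi}. cmod (cis x - \<zeta>) < sin e} = {}")
  case True
  then show ?thesis using e by (simp only: measure_empty)
next
  case False
  then obtain y where y: "y \<in> {0..2 * pi}" "cmod (cis y - \<zeta>) < sin e" by blast
  have "{x \<in> {0..2 * pi}. cmod (cis x - \<zeta>) < sin e} \<subseteq> {y - 2 * e..y + 2 * e} \<union> ({0..2 * e} \<union> {2 * pi - 2 * e..2 * pi})"
  proof
    fix x assume x: "x \<in> {x \<in> {0..2 * pi}. cmod (cis x - \<zeta>) < sin e}"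
    have "cmod (cis x - cis y) < sin e + sin e"
      using x y norm_triangle_ineq4[of "cis x - \<zeta>" "cis y - \<zeta>"] by simp
    then have s: "\<bar>sin ((x - y) / 2)\<bar> < sin e" by (simp add: norm_cis_diff)
    define d where "d = \<bar>x - y\<bar> / 2"
    have "sin d < sin e"
    proof -
      have "d = (x - y) / 2 \<or> d = - ((x - y) / 2)" by (auto simp: d_def abs_if field_simps)
      then have "sin d = sin ((x - y) / 2) \<or> sin d = - sin ((x - y) / 2)" by (metis sin_minus)
      then show ?thesis using s by linarith
    qed
    then have "d < e \<or> d > pi - e"
      using sin_lower_bound[OF e, of d] by linarith
    then show "x \<in> {y - 2 * e..y + 2 * e} \<union> ({0..2 * e} \<union> {2 * pi - 2 * e..2 * pi})"
      using x y unfolding d_def by (auto simp: abs_if split: if_splits)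
  qed
  then have "measure lborel {x \<in> {0..2 * pi}. cmod (cis x - \<zeta>) < sin e}
    \<le> measure lborel ({y - 2 * e..y + 2 * e} \<union> ({0..2 * e} \<union> {2 * pi - 2 * e..2 * pi}))"
  proof (rule measure_mono_fmeasurable)
    show "{x \<in> {0..2 * pi}. cmod (cis x - \<zeta>) < sin e} \<in> sets lborel"
    proof -
      have "(\<lambda>x. cmod (cis x - \<zeta>)) \<in> borel_measurable borel"
        by (intro borel_measurable_continuous_onI continuous_intros)
      then show ?thesis by measurable
    qed
  qed (auto intro!: fmeasurable.Un fmeasurable_Icc)
  also have "\<dots> \<le> measure lborel {y - 2 * e..y + 2 * e} + measure lborel ({0..2 * e} \<union> {2 * pi - 2 * e..2 * pi})"
    by (rule measure_Un_le) auto
  also have "\<dots> \<le> measure lborel {y - 2 * e..y + 2 * e} + (measure lborel {0..2 * e} + measure lborel {2 * pi - 2 * e..2 * pi})"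
    by (intro add_left_mono measure_Un_le) auto
  also have "\<dots> = 8 * e" using e by simp
  finally show ?thesis .
qed

text \<open>\<open>Z\<close> collects roots, split off one at a time: outside the disc around a
  root, each linear factor loses at most the factor \<open>r / 3\<close> against its value at
  \<open>z0\<close>. Comparing values at two points of the circle avoids any reference to the
  leading coefficient.\<close>

lemma poly_lower_bound_off_discs:
  fixes P :: "complex poly"
  assumes "degree P \<le> n" and r: "0 < r" "r \<le> 1" and z0: "cmod z0 = 1"
  shows "\<exists>Z. finite Z \<and> card Z \<le> n \<and>
    (\<forall>z. cmod z = 1 \<longrightarrow> (\<forall>\<zeta>\<in>Z. r \<le> cmod (z - \<zeta>)) \<longrightarrow> cmod (poly P z0) * (r / 3) ^ n \<le> cmod (poly P z))"
  using assms(1)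
proof (induction n arbitrary: P)
  case 0
  then obtain c where "P = [:c:]" by (metis degree_eq_zeroE le_zero_eq)
  then show ?case by (intro exI[of _ "{}"]) auto
next
  case (Suc n)
  show ?case
  proof (cases "degree P = 0")
    case True
    then obtain c where "P = [:c:]" by (metis degree_eq_zeroE)
    moreover have "(r / 3) ^ Suc n \<le> 1" using r by (intro power_le_one) auto
    ultimately show ?thesis
      by (intro exI[of _ "{}"]) (auto simp del: power_Suc intro: mult_left_le)
  next
    case False
    then have "\<not> constant (poly P)" by (simp add: constant_degree)
    then obtain \<zeta> where "poly P \<zeta> = 0" using fundamental_theorem_of_algebra by blast
    then obtain Q where PQ: "P = [:- \<zeta>, 1:] * Q"
      unfolding poly_eq_0_iff_dvd by (elim dvdE)
    with False have "Q \<noteq> 0" by auto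
    then have "degree P = degree [:- \<zeta>, 1:] + degree Q"
      unfolding PQ by (intro degree_mult_eq) auto
    then have "degree Q \<le> n" using Suc.prems by simp
    from Suc.IH[OF this] obtain Z where Z: "finite Z" "card Z \<le> n"
      "\<And>z. cmod z = 1 \<Longrightarrow> (\<forall>\<zeta>\<in>Z. r \<le> cmod (z - \<zeta>)) \<Longrightarrow> cmod (poly Q z0) * (r / 3) ^ n \<le> cmod (poly Q z)"
      by blast
    show ?thesis
    proof (intro exI[of _ "insert \<zeta> Z"] conjI allI impI)
      show "card (insert \<zeta> Z) \<le> Suc n" using Z card_insert_le_m1[of "Suc n" Z \<zeta>] by simp
      fix z :: complex assume z: "cmod z = 1" "\<forall>\<xi>\<in>insert \<zeta> Z. r \<le> cmod (z - \<xi>)"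
      have "cmod (z0 - \<zeta>) * (r / 3) \<le> cmod (z - \<zeta>)"
      \<comment> \<open>A near root is handled by the radius \<open>r\<close> of its disc, a far one
        by its distance from the circle. The threshold 2 is where
        \<open>(1 + s) / 3 \<le> s - 1\<close> starts to hold.\<close>
      proof (cases "cmod \<zeta> \<le> 2")
        case True
        have "cmod (z0 - \<zeta>) \<le> 3" using True z0 norm_triangle_ineq4[of z0 \<zeta>] by linarith
        then have "cmod (z0 - \<zeta>) * (r / 3) \<le> 3 * (r / 3)" using r by (intro mult_right_mono) auto
        then show ?thesis using z(2) by simp
      next
        case False
        have "cmod (z0 - \<zeta>) * (r / 3) \<le> (1 + cmod \<zeta>) * (1 / 3)"
          using r z0 norm_triangle_ineq4[of z0 \<zeta>] by (intro mult_mono) auto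
        also have "\<dots> \<le> cmod \<zeta> - 1" using False by simp
        also have "\<dots> \<le> cmod (z - \<zeta>)" using z(1) norm_triangle_ineq3[of z \<zeta>] by linarith
        finally show ?thesis .
      qed
      then have "(cmod (z0 - \<zeta>) * (r / 3)) * (cmod (poly Q z0) * (r / 3) ^ n) \<le> cmod (z - \<zeta>) * cmod (poly Q z)"
        using Z(3) z r by (intro mult_mono) auto
      then show "cmod (poly P z0) * (r / 3) ^ Suc n \<le> cmod (poly P z)"
        by (simp only: PQ poly_mult norm_mult) (simp add: mult_ac)
    qed (use Z in simp)
  qed
qed

text \<open>On the circle \<open>\<bar>g x\<bar>\<close> is the modulus of the associated
  polynomial, which is bounded below outside at most \<open>2 * p\<close> short arcs. The threshold
  \<open>\<eta>\<close> depends on \<open>p\<close>, \<open>\<epsilon>\<close> and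
  \<open>\<delta>\<close> but not on \<open>g\<close>.\<close>

lemma trig_poly_sublevel:
  fixes \<epsilon> \<delta> :: real
  assumes "0 < \<epsilon>" "0 < \<delta>"
  shows "\<exists>\<eta>>0. \<forall>g x0. trig_poly p g \<longrightarrow> \<delta> \<le> \<bar>g x0\<bar> \<longrightarrow> measure lborel {x \<in> {0..2 * pi}. \<bar>g x\<bar> < \<eta>} \<le> \<epsilon>"
proof -
  \<comment> \<open>At most \<open>2 * p\<close> arcs of measure at most \<open>8 * e\<close> are
    removed; \<open>2 * p + 1\<close> keeps the denominator positive for
    \<open>p = 0\<close>.\<close>
  define e where "e = min (pi / 2) (\<epsilon> / (8 * (2 * real p + 1)))"
  have e: "0 < e" "e \<le> pi / 2" 
    using assms unfolding e_def by (simp, intro min.cobounded1)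
  have "e * (8 * (2 * real p + 1)) \<le> \<epsilon> / (8 * (2 * real p + 1)) * (8 * (2 * real p + 1))"
    by (intro mult_right_mono) (auto simp: e_def)
  then have e3: "e * (8 * (2 * real p + 1)) \<le> \<epsilon>" by simp
  define r where "r = sin e"
  have r: "0 < r" "r \<le> 1" using e sin_gt_zero[of e] by (auto simp: r_def)
  define \<eta> where "\<eta> = \<delta> * (r / 3) ^ (2 * p)"
  have "measure lborel {x \<in> {0..2 * pi}. \<bar>g x\<bar> < \<eta>} \<le> \<epsilon>"
    if g: "trig_poly p g" and x0: "\<delta> \<le> \<bar>g x0\<bar>" for g x0
  proof -
    obtain P where P: "degree P \<le> 2 * p" "\<And>x. complex_of_real (g x) * cis x ^ p = poly P (cis x)"
      using g by (rule trig_polyE) blast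
    have gP: "cmod (poly P (cis x)) = \<bar>g x\<bar>" for x
      by (simp add: P(2)[symmetric] norm_mult norm_power)
    obtain Z where Z: "finite Z" "card Z \<le> 2 * p"
      "\<And>z. cmod z = 1 \<Longrightarrow> (\<forall>\<zeta>\<in>Z. r \<le> cmod (z - \<zeta>)) \<Longrightarrow> cmod (poly P (cis x0)) * (r / 3) ^ (2 * p) \<le> cmod (poly P z)"
      using poly_lower_bound_off_discs[OF P(1) r, of "cis x0"] by auto
    define A where "A \<zeta> = {x \<in> {0..2 * pi}. cmod (cis x - \<zeta>) < sin e}" for \<zeta>
    have A: "A \<zeta> \<in> sets borel" for \<zeta>
    proof -
      have "(\<lambda>x. cmod (cis x - \<zeta>)) \<in> borel_measurable borel"
        by (intro borel_measurable_continuous_onI continuous_intros)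
      then show ?thesis unfolding A_def by measurable
    qed
    have gm: "g \<in> borel_measurable borel"
      using g by (intro borel_measurable_continuous_onI trig_poly_continuous)
    have Afin: "A \<zeta> \<in> fmeasurable lborel" for \<zeta>
    proof (rule fmeasurableI2[OF fmeasurable_Icc])
      show "A \<zeta> \<subseteq> {0..2 * pi}" by (auto simp: A_def)
    qed (use A in simp)
    have "{x \<in> {0..2 * pi}. \<bar>g x\<bar> < \<eta>} \<subseteq> (\<Union>\<zeta>\<in>Z. A \<zeta>)"
    proof (rule subsetI, rule ccontr)
      fix x assume x: "x \<in> {x \<in> {0..2 * pi}. \<bar>g x\<bar> < \<eta>}" "x \<notin> (\<Union>\<zeta>\<in>Z. A \<zeta>)"
      then have "\<bar>g x0\<bar> * (r / 3) ^ (2 * p) \<le> \<bar>g x\<bar>"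
        using Z(3)[of "cis x"] by (auto simp: A_def gP r_def not_less)
      moreover have "\<eta> \<le> \<bar>g x0\<bar> * (r / 3) ^ (2 * p)"
        unfolding \<eta>_def using x0 r by (intro mult_right_mono) auto
      ultimately show False using x by auto
    qed
    then have "measure lborel {x \<in> {0..2 * pi}. \<bar>g x\<bar> < \<eta>} \<le> measure lborel (\<Union>\<zeta>\<in>Z. A \<zeta>)"
      using gm Z(1) Afin by (intro measure_mono_fmeasurable fmeasurable.finite_UN) auto
    also have "\<dots> \<le> (\<Sum>\<zeta>\<in>Z. measure lborel (A \<zeta>))"
      using Z(1) A by (intro measure_UNION_le) auto
    also have "\<dots> \<le> card Z * (8 * e)"
      unfolding A_def using arc_measure[OF e] by (intro sum_bounded_above) auto
    also have "\<dots> \<le> (2 * p + 1) * (8 * e)"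
      using Z(2) e by (intro mult_right_mono) auto
    also have "\<dots> \<le> \<epsilon>" using e3 by (simp add: algebra_simps)
    finally show ?thesis .
  qed
  moreover have "0 < \<eta>" using assms r by (simp add: \<eta>_def)
  ultimately show ?thesis by blast
qed

text \<open>Integrating by parts along the circle against \<open>T' / (T'\<^sup>2 + \<eta>\<^sup>2)\<close> bounds the occupation time of a set
  of small Lebesgue measure, apart from the time during which \<open>T'\<close> is small.\<close>

lemma trig_poly_occupation_by_parts:
  fixes f :: "real \<Rightarrow> real"
  assumes T: "\<And>x. (T has_real_derivative T1 x) (at x)" "\<And>x. (T1 has_real_derivative T2 x) (at x)"
    and per: "T (2 * pi) = T 0" "T1 (2 * pi) = T1 0"
    and B: "\<And>x. \<bar>T2 x\<bar> \<le> B" and \<eta>: "0 < \<eta>"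
    and f: "continuous_on UNIV f" "\<And>x. 0 \<le> f x" "\<And>x. f x \<le> 1"
    and \<kappa>: "\<And>a b. integral {a..b} f \<le> \<kappa>"
  shows "integral {0..2 * pi} (\<lambda>x. f (T x))
    \<le> 2 * pi * (\<kappa> * B / \<eta>\<^sup>2) + integral {0..2 * pi} (\<lambda>x. \<eta>\<^sup>2 / ((T1 x)\<^sup>2 + \<eta>\<^sup>2))"
proof -
  have cT: "continuous_on A T" and cT1: "continuous_on A T1" for A
    using T by (meson DERIV_continuous continuous_at_imp_continuous_on)+
  have pos: "0 < u\<^sup>2 + \<eta>\<^sup>2" for u using \<eta> by (simp add: add_nonneg_pos)
  \<comment> \<open>Strict bounds keep \<open>T x\<close> in the interior of \<open>{a..b}\<close>,
    where the derivative of the primitive is two-sided.\<close>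
  obtain a b where ab: "\<And>x. x \<in> {0..2 * pi} \<Longrightarrow> a < T x \<and> T x < b"
  proof -
    have "compact (T ` {0..2 * pi})" by (intro compact_continuous_image cT) auto
    then obtain K where "\<forall>y\<in>T ` {0..2 * pi}. \<bar>y\<bar> \<le> K"
      using compact_imp_bounded bounded_iff by (metis real_norm_def)
    then have "- K - 1 < T x \<and> T x < K + 1" if "x \<in> {0..2 * pi}" for x
      using that by (force simp: abs_le_iff)
    then show thesis by (rule that)
  qed
  define F where "F y = integral {a..y} f" for y
  have intf: "f integrable_on {u..v}" for u v
    using f(1) by (intro integrable_continuous_real) (rule continuous_on_subset, auto)
  have F: "0 \<le> F y" "F y \<le> \<kappa>" for y
    unfolding F_def using \<kappa> f intf by (auto intro: integral_nonneg)
  have \<kappa>0: "0 \<le> \<kappa>" using F[of 0] by linarith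
  have B0: "0 \<le> B" using B[of 0] by linarith
  have F': "(F has_real_derivative f (T x)) (at (T x))" if "x \<in> {0..2 * pi}" for x
  proof -
    have "(F has_real_derivative f (T x)) (at (T x) within {a..b})"
      unfolding F_def using ab[OF that] f(1)
      by (intro integral_has_real_derivative) (auto intro: continuous_on_subset)
    moreover have "at (T x) within {a..b} = at (T x)"
      using ab[OF that] by (intro at_within_interior) auto
    ultimately show ?thesis by simp
  qed
  \<comment> \<open>Dividing by \<open>T1\<close> would recover \<open>f (T x)\<close> from the
    derivative of \<open>F (T x)\<close>, but \<open>T1\<close> has zeros; the quotient is a
    regularized reciprocal. Periodicity makes the integral of \<open>H'\<close> vanish.\<close>
  define H where "H x = F (T x) * (T1 x / ((T1 x)\<^sup>2 + \<eta>\<^sup>2))" for x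
  define G where "G x = (\<eta>\<^sup>2 - (T1 x)\<^sup>2) * T2 x / ((T1 x)\<^sup>2 + \<eta>\<^sup>2)\<^sup>2" for x
  define H' where "H' x = f (T x) * T1 x * (T1 x / ((T1 x)\<^sup>2 + \<eta>\<^sup>2)) + F (T x) * G x" for x
  have H': "(H has_real_derivative H' x) (at x)" if x: "x \<in> {0..2 * pi}" for x
  proof -
    have 1: "((\<lambda>x. F (T x)) has_real_derivative f (T x) * T1 x) (at x)"
      using DERIV_chain2[OF F'[OF x] T(1)] .
    have 2: "((\<lambda>x. T1 x / ((T1 x)\<^sup>2 + \<eta>\<^sup>2)) has_real_derivative G x) (at x)"
      using pos[of "T1 x"] by (auto intro!: derivative_eq_intros T(2) simp: G_def power2_eq_square field_simps)
    show ?thesis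
      using DERIV_mult[OF 1 2] by (simp add: H_def[abs_def] H'_def algebra_simps)
  qed
  have "(H' has_integral H (2 * pi) - H 0) {0..2 * pi}"
    using H' by (intro fundamental_theorem_of_calculus)
      (auto simp: has_real_derivative_iff_has_vector_derivative intro: has_vector_derivative_at_within)
  then have hi: "(H' has_integral 0) {0..2 * pi}" by (simp add: H_def per)
  \<comment> \<open>The constant bounds the term in which the derivative falls on the quotient; the
    last summand compensates for the regularization, using \<open>f \<le> 1\<close>.\<close>
  have pw: "f (T x) \<le> H' x + (\<kappa> * B / \<eta>\<^sup>2 + \<eta>\<^sup>2 / ((T1 x)\<^sup>2 + \<eta>\<^sup>2))" for x
  proof -
    define u where "u = T1 x"
    have "\<bar>\<eta>\<^sup>2 - u\<^sup>2\<bar> / (u\<^sup>2 + \<eta>\<^sup>2)\<^sup>2 \<le> 1 / \<eta>\<^sup>2"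
    proof -
      have "\<bar>\<eta>\<^sup>2 - u\<^sup>2\<bar> * \<eta>\<^sup>2 \<le> (u\<^sup>2 + \<eta>\<^sup>2) * (u\<^sup>2 + \<eta>\<^sup>2)"
        by (intro mult_mono) (auto simp: abs_le_iff)
      then show ?thesis using pos[of u] \<eta> by (simp add: divide_simps power2_eq_square)
    qed
    then have "\<bar>\<eta>\<^sup>2 - u\<^sup>2\<bar> / (u\<^sup>2 + \<eta>\<^sup>2)\<^sup>2 * \<bar>T2 x\<bar> \<le> 1 / \<eta>\<^sup>2 * B"
      using B[of x] \<eta> by (intro mult_mono) auto
    then have "\<bar>G x\<bar> \<le> B / \<eta>\<^sup>2" by (simp add: G_def u_def abs_mult)
    then have "\<bar>F (T x) * G x\<bar> \<le> \<kappa> * (B / \<eta>\<^sup>2)"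
      unfolding abs_mult using F[of "T x"] \<kappa>0 by (intro mult_mono) auto
    moreover have "f (T x) = f (T x) * u * (u / (u\<^sup>2 + \<eta>\<^sup>2)) + f (T x) * (\<eta>\<^sup>2 / (u\<^sup>2 + \<eta>\<^sup>2))"
    proof -
      have "u * (u / (u\<^sup>2 + \<eta>\<^sup>2)) + \<eta>\<^sup>2 / (u\<^sup>2 + \<eta>\<^sup>2) = 1"
        using pos[of u] \<eta> by (simp only: times_divide_eq_right add_divide_distrib[symmetric] power2_eq_square[symmetric]) simp
      then have "f (T x) * (u * (u / (u\<^sup>2 + \<eta>\<^sup>2)) + \<eta>\<^sup>2 / (u\<^sup>2 + \<eta>\<^sup>2)) = f (T x)" by simp
      then show ?thesis by (simp add: ring_distribs mult.assoc)
    qed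
    moreover have "f (T x) * (\<eta>\<^sup>2 / (u\<^sup>2 + \<eta>\<^sup>2)) \<le> 1 * (\<eta>\<^sup>2 / (u\<^sup>2 + \<eta>\<^sup>2))"
      using f(3) by (intro mult_right_mono) auto
    ultimately show ?thesis by (simp add: H'_def u_def abs_le_iff)
  qed
  have fT: "(\<lambda>x. f (T x)) integrable_on {0..2 * pi}"
    using f(1) by (intro integrable_continuous_real continuous_on_compose2[OF f(1) cT]) auto
  have g: "(\<lambda>x. \<eta>\<^sup>2 / ((T1 x)\<^sup>2 + \<eta>\<^sup>2)) integrable_on {0..2 * pi}"
    using pos by (intro integrable_continuous_real continuous_intros cT1) (auto simp: less_imp_neq[THEN not_sym])
  have "integral {0..2 * pi} (\<lambda>x. f (T x)) \<le> integral {0..2 * pi} (\<lambda>x. H' x + (\<kappa> * B / \<eta>\<^sup>2 + \<eta>\<^sup>2 / ((T1 x)\<^sup>2 + \<eta>\<^sup>2)))"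
    using fT hi g pw by (intro integral_le integrable_add) auto
  also have "\<dots> = integral {0..2 * pi} H' + (integral {0..2 * pi} (\<lambda>x. \<kappa> * B / \<eta>\<^sup>2) + integral {0..2 * pi} (\<lambda>x. \<eta>\<^sup>2 / ((T1 x)\<^sup>2 + \<eta>\<^sup>2)))"
    using hi g by (subst integral_add | force intro: integrable_add)+
  also have "integral {0..2 * pi} H' = 0" using hi by (rule integral_unique)
  finally show ?thesis by (simp add: mult_ac)
qed

text \<open>\<open>K\<close> is uniform over all \<open>T\<close>, \<open>f\<close> and
  \<open>c\<close>. Two applications of the derivative bound control the second derivative by the L1
  norm of \<open>T - c\<close>, for any \<open>c\<close>, since differentiation removes constants.
  An increment of size \<open>\<delta>\<close> makes the first derivative large at some point, so
  its small values take up little of the circle.\<close>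

lemma trig_poly_occupation:
  fixes \<epsilon> \<delta> :: real
  assumes \<epsilon>: "0 < \<epsilon>" and \<delta>: "0 < \<delta>"
  shows "\<exists>K\<ge>0. \<forall>T f \<kappa> c. trig_poly p T \<longrightarrow> \<delta> \<le> \<bar>T (pi / 2) - T 0\<bar> \<longrightarrow> continuous_on UNIV f \<longrightarrow>
    (\<forall>x. 0 \<le> f x \<and> f x \<le> 1) \<longrightarrow> (\<forall>a b. integral {a..b} f \<le> \<kappa>) \<longrightarrow>
    integral {0..2 * pi} (\<lambda>x. f (T x)) \<le> K * \<kappa> * integral {0..2 * pi} (\<lambda>x. \<bar>T x - c\<bar>) + \<epsilon>"
proof -
  define C where "C = real ((2 * p + 1) * p) / (2 * pi)"
  have C0: "0 \<le> C" by (simp add: C_def)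
  obtain \<eta>' where \<eta>': "0 < \<eta>'" "\<And>g x0. trig_poly p g \<Longrightarrow> \<delta> / 2 \<le> \<bar>g x0\<bar> \<Longrightarrow>
      measure lborel {x \<in> {0..2 * pi}. \<bar>g x\<bar> < \<eta>'} \<le> \<epsilon> / 2"
    using trig_poly_sublevel[of "\<epsilon> / 2" "\<delta> / 2" p] \<epsilon> \<delta> by auto
  \<comment> \<open>Where \<open>\<bar>T1 x\<bar> \<ge> \<eta>'\<close>, the regularization error is
    at most \<open>\<eta>\<^sup>2 / \<eta>'\<^sup>2 = \<epsilon> / (4 * pi)\<close>, which costs
    \<open>\<epsilon> / 2\<close> over the circle. The complementary set costs the other
    half.\<close>
  define \<eta> where "\<eta> = \<eta>' * sqrt (\<epsilon> / (4 * pi))"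
  have \<eta>: "0 < \<eta>" using \<eta>' \<epsilon> by (simp add: \<eta>_def)
  have \<eta>2: "\<eta>\<^sup>2 = \<eta>'\<^sup>2 * (\<epsilon> / (4 * pi))" using \<epsilon> by (simp add: \<eta>_def power_mult_distrib)
  define K where "K = 2 * pi * (C * (2 * pi) * C) / \<eta>\<^sup>2"
  have "integral {0..2 * pi} (\<lambda>x. f (T x)) \<le> K * \<kappa> * integral {0..2 * pi} (\<lambda>x. \<bar>T x - c\<bar>) + \<epsilon>"
    if T: "trig_poly p T" and osc: "\<delta> \<le> \<bar>T (pi / 2) - T 0\<bar>" and f: "continuous_on UNIV f" "\<And>x. 0 \<le> f x" "\<And>x. f x \<le> 1"
      and \<kappa>: "\<And>a b. integral {a..b} f \<le> \<kappa>" for T f \<kappa> c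
  proof -
    define J where "J = integral {0..2 * pi} (\<lambda>x. \<bar>T x - c\<bar>)"
    have Tc: "trig_poly p (\<lambda>x. T x - c)"
      using trig_poly_add[OF T trig_poly_const[of p "- c"]] by simp
    obtain T1 where T1: "trig_poly p T1" "\<And>x. ((\<lambda>x. T x - c) has_real_derivative T1 x) (at x)"
        "\<And>x. \<bar>T1 x\<bar> \<le> C * J"
      by (rule trig_poly_derivative[OF Tc, folded C_def J_def]) blast
    obtain T2 where T2: "\<And>x. (T1 has_real_derivative T2 x) (at x)"
        "\<And>x. \<bar>T2 x\<bar> \<le> C * integral {0..2 * pi} (\<lambda>x. \<bar>T1 x\<bar>)"
      by (rule trig_poly_derivative[OF T1(1), folded C_def]) blast
    have T': "(T has_real_derivative T1 x) (at x)" for x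
      using DERIV_add[OF T1(2) DERIV_const[of c]] by simp
    have J1: "integral {0..2 * pi} (\<lambda>x. \<bar>T1 x\<bar>) \<le> (2 * pi) * (C * J)"
    proof -
      have "integral {0..2 * pi} (\<lambda>x. \<bar>T1 x\<bar>) \<le> integral {0..2 * pi} (\<lambda>x. C * J)"
        using T1(3) by (intro integral_le integrable_continuous_real continuous_intros trig_poly_continuous[OF T1(1)]) auto
      then show ?thesis by (simp add: mult_ac)
    qed
    have B: "\<bar>T2 x\<bar> \<le> C * ((2 * pi) * (C * J))" for x
      using T2(2) mult_left_mono[OF J1 C0] by (rule order_trans)
    have 1: "integral {0..2 * pi} (\<lambda>x. f (T x))
      \<le> 2 * pi * (\<kappa> * (C * ((2 * pi) * (C * J))) / \<eta>\<^sup>2) + integral {0..2 * pi} (\<lambda>x. \<eta>\<^sup>2 / ((T1 x)\<^sup>2 + \<eta>\<^sup>2))"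
      using T' T2(1) trig_poly_period[OF T] trig_poly_period[OF T1(1)] B \<eta> f \<kappa>
      by (rule trig_poly_occupation_by_parts)
    define A where "A = {x \<in> {0..2 * pi}. \<bar>T1 x\<bar> < \<eta>'}"
    \<comment> \<open>The mean value theorem on an interval of length \<open>pi / 2 \<le> 2\<close>
      turns the increment into a value of the derivative, which explains the factor in
      \<open>\<delta> / 2\<close>.\<close>
    have "\<exists>x0. \<delta> / 2 \<le> \<bar>T1 x0\<bar>"
    proof -
      obtain z where "T (pi / 2) - T 0 = (pi / 2 - 0) * T1 z"
        using MVT2[of 0 "pi / 2" T T1] T' by auto
      then have "\<bar>T (pi / 2) - T 0\<bar> = pi / 2 * \<bar>T1 z\<bar>" by (simp only: abs_mult) simp
      then have z: "\<delta> \<le> pi / 2 * \<bar>T1 z\<bar>" using osc by simp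
      also have "\<dots> \<le> 2 * \<bar>T1 z\<bar>"
        using pi_less_4 by (intro mult_right_mono) auto
      finally show ?thesis by (intro exI[of _ z]) simp
    qed
    then have mA: "measure lborel A \<le> \<epsilon> / 2"
      unfolding A_def using \<eta>'(2)[OF T1(1)] by blast
    have T1m: "T1 \<in> borel_measurable borel"
      using T1(1) by (intro borel_measurable_continuous_onI trig_poly_continuous)
    have A: "A \<in> sets borel" unfolding A_def using T1m by measurable
    have Afin: "A \<in> fmeasurable lborel"
    proof (rule fmeasurableI2[OF fmeasurable_Icc])
      show "A \<subseteq> {0..2 * pi}" by (auto simp: A_def)
    qed (use A in simp)
    have hA: "((indicator A :: real \<Rightarrow> real) has_integral measure lborel A) {0..2 * pi}"
    proof -
      have "((\<lambda>x. 1 :: real) has_integral measure lborel A) A"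
        using has_integral_measure_lborel[OF A] Afin by (simp add: fmeasurable_def)
      moreover have "A \<subseteq> {0..2 * pi}" by (auto simp: A_def)
      ultimately have "((\<lambda>x. if x \<in> A then 1 else 0 :: real) has_integral measure lborel A) {0..2 * pi}"
        by (simp only: has_integral_restrict)
      then show ?thesis by (simp add: indicator_def[abs_def] of_bool_def)
    qed
    have pos: "0 < u\<^sup>2 + \<eta>\<^sup>2" for u using \<eta> by (simp add: add_nonneg_pos)
    have "integral {0..2 * pi} (\<lambda>x. \<eta>\<^sup>2 / ((T1 x)\<^sup>2 + \<eta>\<^sup>2)) \<le> integral {0..2 * pi} (\<lambda>x. indicator A x + \<epsilon> / (4 * pi))"
    proof (rule integral_le)
      show "(\<lambda>x. \<eta>\<^sup>2 / ((T1 x)\<^sup>2 + \<eta>\<^sup>2)) integrable_on {0..2 * pi}"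
        using pos by (intro integrable_continuous_real continuous_intros trig_poly_continuous[OF T1(1)])
          (auto simp: less_imp_neq[THEN not_sym])
      show "(\<lambda>x. indicator A x + \<epsilon> / (4 * pi)) integrable_on {0..2 * pi}"
        using hA by (intro integrable_add) auto
      fix x assume x: "x \<in> {0..2 * pi}"
      show "\<eta>\<^sup>2 / ((T1 x)\<^sup>2 + \<eta>\<^sup>2) \<le> indicator A x + \<epsilon> / (4 * pi)"
      proof (cases "x \<in> A")
        case True
        have "\<eta>\<^sup>2 / ((T1 x)\<^sup>2 + \<eta>\<^sup>2) \<le> 1" using pos[of "T1 x"] by simp
        then show ?thesis using True \<epsilon> by (simp add: add_increasing2)
      next
        case False
        then have "\<eta>' \<le> \<bar>T1 x\<bar>" using x by (simp add: A_def)
        then have "\<eta>'\<^sup>2 \<le> \<bar>T1 x\<bar>\<^sup>2" using \<eta>' by (intro power_mono) auto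
        then have "\<eta>'\<^sup>2 \<le> (T1 x)\<^sup>2 + \<eta>\<^sup>2" by (simp add: add_increasing2)
        then have "\<eta>\<^sup>2 / ((T1 x)\<^sup>2 + \<eta>\<^sup>2) \<le> \<eta>\<^sup>2 / \<eta>'\<^sup>2"
          using \<eta>'(1) pos[of "T1 x"] by (intro divide_left_mono) auto
        also have "\<dots> = \<epsilon> / (4 * pi)" using \<eta>'(1) by (simp add: \<eta>2)
        finally show ?thesis using False by simp
      qed
    qed
    also have "\<dots> = measure lborel A + integral {0..2 * pi} (\<lambda>x. \<epsilon> / (4 * pi))"
      using hA by (subst integral_add) (auto simp: integral_unique)
    also have "\<dots> \<le> \<epsilon> / 2 + \<epsilon> / 2" using mA by (intro add_mono) auto
    finally have "integral {0..2 * pi} (\<lambda>x. f (T x)) \<le> 2 * pi * (\<kappa> * (C * ((2 * pi) * (C * J))) / \<eta>\<^sup>2) + \<epsilon>"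
      using 1 by linarith
    also have "2 * pi * (\<kappa> * (C * ((2 * pi) * (C * J))) / \<eta>\<^sup>2) = K * \<kappa> * J"
      by (simp add: K_def mult_ac)
    finally show ?thesis unfolding J_def .
  qed
  moreover have "0 \<le> K" using C0 by (simp add: K_def)
  ultimately show ?thesis by blast
qed

section \<open>Two independent copies\<close>

lemma (in pair_sigma_finite) integral_product_function:
  fixes f :: "'a \<Rightarrow> 'c::{real_normed_field, banach, second_countable_topology}"
  assumes f: "integrable M1 f" and g: "integrable M2 g"
  shows "integrable (M1 \<Otimes>\<^sub>M M2) (\<lambda>z. f (fst z) * g (snd z))"
    and "(\<integral>z. f (fst z) * g (snd z) \<partial>(M1 \<Otimes>\<^sub>M M2)) = (\<integral>x. f x \<partial>M1) * (\<integral>y. g y \<partial>M2)"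
proof -
  have [measurable]: "f \<in> borel_measurable M1" "g \<in> borel_measurable M2"
    using f g by auto
  show int: "integrable (M1 \<Otimes>\<^sub>M M2) (\<lambda>z. f (fst z) * g (snd z))"
  proof (rule Fubini_integrable)
    show "integrable M1 (\<lambda>x. \<integral>y. norm (f (fst (x, y)) * g (snd (x, y))) \<partial>M2)"
      using f by (simp add: norm_mult)
    show "AE x in M1. integrable M2 (\<lambda>y. f (fst (x, y)) * g (snd (x, y)))"
      using g by simp
  qed measurable
  show "(\<integral>z. f (fst z) * g (snd z) \<partial>(M1 \<Otimes>\<^sub>M M2)) = (\<integral>x. f x \<partial>M1) * (\<integral>y. g y \<partial>M2)"
    using integral_fst'[OF int] by simp
qed

lemma (in prob_space) pair_self: "pair_prob_space M M" ..

text \<open>Zero means cancel the mixed products of the two copies, and the squares of cosine and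
  sine add up to 1. Two functions are allowed so that the moment of a variable against its
  truncation is covered as well.\<close>

lemma (in prob_space) rotation_moment:
  fixes u v :: "'a \<Rightarrow> real"
  assumes u: "u \<in> borel_measurable M" "integrable M (\<lambda>x. (u x)\<^sup>2)" "expectation u = 0"
    and v: "v \<in> borel_measurable M" "integrable M (\<lambda>x. (v x)\<^sup>2)" "expectation v = 0"
  shows "(\<integral>z. (cos \<theta> * u (fst z) + sin \<theta> * u (snd z)) * (cos \<theta> * v (fst z) + sin \<theta> * v (snd z)) \<partial>(M \<Otimes>\<^sub>M M))
    = expectation (\<lambda>x. u x * v x)"
proof -
  interpret P: pair_prob_space M M by (rule pair_self)
  have iu: "integrable M u" and iv: "integrable M v"
    using u v by (auto intro: square_integrable_imp_integrable)
  have iuv: "integrable M (\<lambda>x. u x * v x)"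
    using u v by (intro integrable_mult_of_squares) auto
  have i1: "integrable M (\<lambda>_. 1 :: real)" by simp
  define E where "E = expectation (\<lambda>x. u x * v x)"
  note p1 = P.integral_product_function[OF iuv i1, simplified]
    and p2 = P.integral_product_function[OF i1 iuv, simplified]
    and p3 = P.integral_product_function[OF iu iv]
    and p4 = P.integral_product_function[OF iv iu]
  have eq: "(cos \<theta> * u (fst z) + sin \<theta> * u (snd z)) * (cos \<theta> * v (fst z) + sin \<theta> * v (snd z))
    = (cos \<theta>)\<^sup>2 * (u (fst z) * v (fst z)) + (sin \<theta>)\<^sup>2 * (u (snd z) * v (snd z))
      + cos \<theta> * sin \<theta> * (u (fst z) * v (snd z)) + cos \<theta> * sin \<theta> * (v (fst z) * u (snd z))" for z
    by (simp add: power2_eq_square algebra_simps)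
  have "(\<integral>z. (cos \<theta> * u (fst z) + sin \<theta> * u (snd z)) * (cos \<theta> * v (fst z) + sin \<theta> * v (snd z)) \<partial>(M \<Otimes>\<^sub>M M))
    = (cos \<theta>)\<^sup>2 * E + (sin \<theta>)\<^sup>2 * E"
    unfolding eq using p1 p2 p3 p4 u(3) v(3) by (simp add: E_def prob_space)
  also have "\<dots> = E" by (simp add: distrib_right[symmetric])
  finally show ?thesis by (simp add: E_def)
qed

lemma (in prob_space) rotation_square_integrable:
  fixes u :: "'a \<Rightarrow> real"
  assumes u: "u \<in> borel_measurable M" "integrable M (\<lambda>x. (u x)\<^sup>2)"
  shows "integrable (M \<Otimes>\<^sub>M M) (\<lambda>z. (cos \<theta> * u (fst z) + sin \<theta> * u (snd z))\<^sup>2)"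
proof -
  interpret P: pair_prob_space M M by (rule pair_self)
  have iu: "integrable M u"
    using u by (auto intro: square_integrable_imp_integrable)
  have i1: "integrable M (\<lambda>_. 1 :: real)" by simp
  note p1 = P.integral_product_function[OF u(2) i1, simplified]
    and p2 = P.integral_product_function[OF i1 u(2), simplified]
    and p3 = P.integral_product_function[OF iu iu]
  have eq: "(cos \<theta> * u (fst z) + sin \<theta> * u (snd z))\<^sup>2
    = (cos \<theta>)\<^sup>2 * (u (fst z))\<^sup>2 + (sin \<theta>)\<^sup>2 * (u (snd z))\<^sup>2 + 2 * cos \<theta> * sin \<theta> * (u (fst z) * u (snd z))" for z
    by (simp add: power2_eq_square algebra_simps)
  show ?thesis unfolding eq using p1 p2 p3 by simp
qed

lemma (in prob_space) rotation_mean: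
  fixes u :: "'a \<Rightarrow> real"
  assumes u: "integrable M u" "expectation u = 0"
  shows "(\<integral>z. cos \<theta> * u (fst z) + sin \<theta> * u (snd z) \<partial>(M \<Otimes>\<^sub>M M)) = 0"
proof -
  interpret P: pair_prob_space M M by (rule pair_self)
  have i1: "integrable M (\<lambda>_. 1 :: real)" by simp
  note p1 = P.integral_product_function[OF u(1) i1, simplified]
    and p2 = P.integral_product_function[OF i1 u(1), simplified]
  show ?thesis using p1 p2 u(2) by (simp add: prob_space)
qed

text \<open>Independence is tested on rectangles, an intersection-stable generator on which the
  product measure splits into two factors. The empty index set is separate because an intersection
  over it is not confined to the sample space.\<close>

lemma (in prob_space) indep_vars_pair:
  fixes X :: "'i \<Rightarrow> 'a \<Rightarrow> real"
  assumes I: "finite I" and ind: "indep_vars (\<lambda>_. borel) X I"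
  shows "prob_space.indep_vars (M \<Otimes>\<^sub>M M) (\<lambda>_. borel \<Otimes>\<^sub>M borel) (\<lambda>i z. (X i (fst z), X i (snd z))) I"
proof (cases "I = {}")
  case True
  interpret P: pair_prob_space M M by (rule pair_self)
  show ?thesis unfolding True P.indep_vars_def by (simp add: P.indep_sets_def)
next
  case False
  interpret P: pair_prob_space M M by (rule pair_self)
  have X[measurable]: "X i \<in> borel_measurable M" if "i \<in> I" for i
    using ind that by (auto simp: indep_vars_def)
  let ?E = "{a \<times> b | a b. a \<in> sets borel \<and> b \<in> sets (borel :: real measure)} :: (real \<times> real) set set"
  have prod: "prob (\<Inter>j\<in>I. X j -` A j \<inter> space M) = (\<Prod>j\<in>I. prob (X j -` A j \<inter> space M))"
    if "\<And>j. j \<in> I \<Longrightarrow> A j \<in> sets borel" for A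
    using that False I by (intro indep_varsD[OF ind]) auto
  show ?thesis
  proof (subst P.indep_vars_finite[where E="\<lambda>_. ?E"])
    show "sets (borel \<Otimes>\<^sub>M borel :: (real \<times> real) measure)
        = sigma_sets (space (borel \<Otimes>\<^sub>M borel)) ?E"
      by (simp add: sets_pair_measure space_pair_measure)
    show "Int_stable ?E"
      by (rule Int_stable_pair_measure_generator)
    show "space (borel \<Otimes>\<^sub>M borel :: (real \<times> real) measure) \<in> ?E"
      by (auto simp: space_pair_measure intro!: exI[of _ UNIV])
    show "\<forall>A\<in>I \<rightarrow> ?E. P.prob (\<Inter>j\<in>I. (\<lambda>z. (X j (fst z), X j (snd z))) -` A j \<inter> space (M \<Otimes>\<^sub>M M))
      = (\<Prod>j\<in>I. P.prob ((\<lambda>z. (X j (fst z), X j (snd z))) -` A j \<inter> space (M \<Otimes>\<^sub>M M)))"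
    proof
      fix A assume "A \<in> I \<rightarrow> ?E"
      then have "\<forall>j\<in>I. \<exists>a b. A j = a \<times> b \<and> a \<in> sets borel \<and> b \<in> sets borel" by blast
      then obtain a b where ab: "\<And>j. j \<in> I \<Longrightarrow> A j = a j \<times> b j"
        and a: "\<And>j. j \<in> I \<Longrightarrow> a j \<in> sets borel" and b: "\<And>j. j \<in> I \<Longrightarrow> b j \<in> sets borel"
        by metis
      have rect: "P.prob (S \<times> S') = prob S * prob S'" if "S \<in> sets M" "S' \<in> sets M" for S S'
        using that by (simp add: measure_def emeasure_pair_measure_Times enn2real_mult)
      have 1: "(\<Inter>j\<in>I. (\<lambda>z. (X j (fst z), X j (snd z))) -` A j \<inter> space (M \<Otimes>\<^sub>M M))
        = (\<Inter>j\<in>I. X j -` a j \<inter> space M) \<times> (\<Inter>j\<in>I. X j -` b j \<inter> space M)"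
        using False by (auto simp: ab space_pair_measure)
      have 2: "(\<lambda>z. (X j (fst z), X j (snd z))) -` A j \<inter> space (M \<Otimes>\<^sub>M M)
        = (X j -` a j \<inter> space M) \<times> (X j -` b j \<inter> space M)" if "j \<in> I" for j
        using that by (auto simp: ab space_pair_measure)
      have sa: "X j -` a j \<inter> space M \<in> sets M" and sb: "X j -` b j \<inter> space M \<in> sets M" if "j \<in> I" for j
        using that X a b by (auto intro: measurable_sets)
      have "P.prob (\<Inter>j\<in>I. (\<lambda>z. (X j (fst z), X j (snd z))) -` A j \<inter> space (M \<Otimes>\<^sub>M M))
        = (\<Prod>j\<in>I. prob (X j -` a j \<inter> space M)) * (\<Prod>j\<in>I. prob (X j -` b j \<inter> space M))"
      proof -
        have "(\<Inter>j\<in>I. X j -` a j \<inter> space M) \<in> sets M" "(\<Inter>j\<in>I. X j -` b j \<inter> space M) \<in> sets M"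
          using I False sa sb by (auto intro!: sets.finite_INT simp del: INT_simps)
        then show ?thesis unfolding 1 using prod[of a, OF a] prod[of b, OF b] by (simp only: rect)
      qed
      also have "\<dots> = (\<Prod>j\<in>I. P.prob ((\<lambda>z. (X j (fst z), X j (snd z))) -` A j \<inter> space (M \<Otimes>\<^sub>M M)))"
        unfolding prod.distrib[symmetric] using sa sb by (intro prod.cong refl) (simp add: 2 rect)
      finally show "P.prob (\<Inter>j\<in>I. (\<lambda>z. (X j (fst z), X j (snd z))) -` A j \<inter> space (M \<Otimes>\<^sub>M M))
        = (\<Prod>j\<in>I. P.prob ((\<lambda>z. (X j (fst z), X j (snd z))) -` A j \<inter> space (M \<Otimes>\<^sub>M M)))" .
    qed
    show "(\<lambda>z. (X i (fst z), X i (snd z))) \<in> measurable (M \<Otimes>\<^sub>M M) (borel \<Otimes>\<^sub>M borel)" if "i \<in> I" for i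
      using X[OF that] by measurable
  qed (use False I in \<open>auto simp: space_pair_measure\<close>)
qed

text \<open>The function \<open>iexp\<close> is 1-Lipschitz, and Jensen's inequality bounds the L1
  distance by the L2 distance.\<close>

lemma (in prob_space) iexp_dist_le:
  fixes f g :: "'a \<Rightarrow> real"
  assumes [measurable]: "f \<in> borel_measurable M" "g \<in> borel_measurable M"
    and int: "integrable M (\<lambda>x. (f x - g x)\<^sup>2)" and le: "expectation (\<lambda>x. (f x - g x)\<^sup>2) \<le> s"
  shows "cmod (expectation (\<lambda>x. iexp (t * f x)) - expectation (\<lambda>x. iexp (t * g x))) \<le> \<bar>t\<bar> * sqrt s"
proof -
  have i: "integrable M (\<lambda>x. iexp (t * f x))" "integrable M (\<lambda>x. iexp (t * g x))"
    by (auto intro!: integrable_const_bound[where B=1])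
  have i2: "integrable M (\<lambda>x. f x - g x)"
    using int by (rule square_integrable_imp_integrable[rotated]) simp
  have lip: "cmod (iexp a - iexp b) \<le> \<bar>a - b\<bar>" for a b
  proof -
    have "iexp a - iexp b = iexp b * (iexp (a - b) - 1)"
    proof -
      have "iexp a = exp (\<i> * of_real b + \<i> * of_real (a - b))" by (simp add: algebra_simps)
      then show ?thesis by (simp only: exp_add) (simp add: algebra_simps)
    qed
    then have "cmod (iexp a - iexp b) = cmod (iexp (a - b) - 1)" by (simp only: norm_mult norm_exp_i_times mult_1)
    also have "\<dots> \<le> \<bar>a - b\<bar>" using iexp_approx1[of "a - b" 0] by simp
    finally show ?thesis .
  qed
  have "cmod (expectation (\<lambda>x. iexp (t * f x)) - expectation (\<lambda>x. iexp (t * g x)))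
    = cmod (expectation (\<lambda>x. iexp (t * f x) - iexp (t * g x)))"
    using i by simp
  also have "\<dots> \<le> expectation (\<lambda>x. cmod (iexp (t * f x) - iexp (t * g x)))"
    by (rule integral_norm_bound)
  also have "\<dots> \<le> expectation (\<lambda>x. \<bar>t\<bar> * \<bar>f x - g x\<bar>)"
  proof (rule integral_mono)
    show "cmod (iexp (t * f x) - iexp (t * g x)) \<le> \<bar>t\<bar> * \<bar>f x - g x\<bar>" for x
      using lip[of "t * f x" "t * g x"] by (simp add: abs_mult[symmetric] right_diff_distrib)
  qed (use i i2 in auto)
  also have "\<dots> = \<bar>t\<bar> * expectation (\<lambda>x. \<bar>f x - g x\<bar>)" by simp
  also have "\<dots> \<le> \<bar>t\<bar> * sqrt s"
  proof (rule mult_left_mono)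
    have "(expectation (\<lambda>x. \<bar>f x - g x\<bar>))\<^sup>2 \<le> expectation (\<lambda>x. (\<bar>f x - g x\<bar>)\<^sup>2)"
      using int by (intro expectation_square_le) auto
    then show "expectation (\<lambda>x. \<bar>f x - g x\<bar>) \<le> sqrt s"
      using le by (intro real_le_rsqrt) simp
  qed simp
  finally show ?thesis .
qed

section \<open>Families of standardized variables with uniformly integrable squares\<close>

text \<open>The moment condition of order \<open>2 + \<epsilon>\<close> enters through
  \<open>ui\<close>, uniform integrability of the squares.\<close>

locale standardized_family = prob_space M for M :: "'a measure" +
  fixes X :: "nat \<Rightarrow> 'a \<Rightarrow> real"
  assumes indep: "indep_vars (\<lambda>_. borel) X {1..}"
    and mean: "\<And>k. 1 \<le> k \<Longrightarrow> expectation (X k) = 0"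
    and var: "\<And>k. 1 \<le> k \<Longrightarrow> expectation (\<lambda>\<omega>. (X k \<omega>)\<^sup>2) = 1"
    and ui: "\<And>e. 0 < e \<Longrightarrow> \<exists>L\<ge>1. \<forall>k\<ge>1. expectation (\<lambda>\<omega>. if \<bar>X k \<omega>\<bar> \<le> L then 0 else (X k \<omega>)\<^sup>2) \<le> e"
begin

lemma X_measurable: "1 \<le> k \<Longrightarrow> X k \<in> borel_measurable M"
  using indep by (auto simp: indep_vars_def)

text \<open>A function that is not integrable has Bochner integral 0 by convention, so the value 1
  already implies integrability.\<close>

lemma X_square_integrable: "1 \<le> k \<Longrightarrow> integrable M (\<lambda>\<omega>. (X k \<omega>)\<^sup>2)"
  using var[of k] not_integrable_integral_eq by force

lemma X_integrable: "1 \<le> k \<Longrightarrow> integrable M (X k)"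
  using X_measurable X_square_integrable by (rule square_integrable_imp_integrable)

text \<open>Recentred after truncation, because orthogonality of monomials rests on zero means, but
  not rescaled: the perturbation bound accepts second moments at most 1. The centring constant
  depends on the law of \<open>X k\<close>, hence the index.\<close>

definition trunc :: "real \<Rightarrow> nat \<Rightarrow> real \<Rightarrow> real" where
  "trunc L k x = (if \<bar>x\<bar> \<le> L then x else 0) - expectation (\<lambda>\<omega>. if \<bar>X k \<omega>\<bar> \<le> L then X k \<omega> else 0)"

lemma trunc_measurable [measurable]: "trunc L k \<in> borel_measurable borel"
  unfolding trunc_def[abs_def] by measurable

definition tail :: "real \<Rightarrow> nat \<Rightarrow> real" where
  "tail L k = expectation (\<lambda>\<omega>. if \<bar>X k \<omega>\<bar> \<le> L then 0 else (X k \<omega>)\<^sup>2)"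

text \<open>With \<open>Y\<close> the uncentred truncation and \<open>a\<close> its mean,
  \<open>X k * Y = Y\<^sup>2\<close> makes the mixed moment equal to that of
  \<open>Y\<^sup>2\<close>. It differs from 1 by the tail and from the second moment of the
  truncation by \<open>a\<^sup>2\<close>. As \<open>X k - Y\<close> has mean \<open>- a\<close>,
  Jensen's inequality bounds \<open>a\<^sup>2\<close> by the tail too.\<close>

lemma trunc_facts:
  assumes k: "1 \<le> k" and L: "1 \<le> L"
  shows "\<And>x. \<bar>trunc L k x\<bar> \<le> 2 * L"
    and "integrable M (\<lambda>\<omega>. (trunc L k (X k \<omega>))\<^sup>2)"
    and "expectation (\<lambda>\<omega>. trunc L k (X k \<omega>)) = 0"
    and "expectation (\<lambda>\<omega>. (trunc L k (X k \<omega>))\<^sup>2) \<le> 1"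
    and "\<bar>expectation (\<lambda>\<omega>. (X k \<omega>)\<^sup>2) - expectation (\<lambda>\<omega>. X k \<omega> * trunc L k (X k \<omega>))\<bar> \<le> tail L k"
    and "\<bar>expectation (\<lambda>\<omega>. (trunc L k (X k \<omega>))\<^sup>2) - expectation (\<lambda>\<omega>. X k \<omega> * trunc L k (X k \<omega>))\<bar> \<le> tail L k"
proof -
  note [measurable] = X_measurable[OF k]
  define Y where "Y \<omega> = (if \<bar>X k \<omega>\<bar> \<le> L then X k \<omega> else 0)" for \<omega>
  define a where "a = expectation Y"
  have [measurable]: "Y \<in> borel_measurable M" unfolding Y_def by measurable
  have YL: "\<bar>Y \<omega>\<bar> \<le> L" for \<omega> using L by (simp add: Y_def)
  have iY: "integrable M Y" using YL by (intro integrable_bounded) auto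
  have iY2: "integrable M (\<lambda>\<omega>. (Y \<omega>)\<^sup>2)"
    using power_mono[OF YL, of _ 2] by (intro integrable_bounded[where B="L\<^sup>2"]) auto
  have tr: "trunc L k (X k \<omega>) = Y \<omega> - a" for \<omega>
    by (simp add: trunc_def Y_def[abs_def] a_def)
  have aL: "\<bar>a\<bar> \<le> L"
  proof -
    have "\<bar>a\<bar> \<le> expectation (\<lambda>\<omega>. \<bar>Y \<omega>\<bar>)" unfolding a_def by (rule integral_abs_bound)
    also have "\<dots> \<le> expectation (\<lambda>\<omega>. L)" using iY YL by (intro integral_mono) auto
    finally show ?thesis by (simp add: prob_space)
  qed
  show "\<bar>trunc L k x\<bar> \<le> 2 * L" for x
  proof -
    have "expectation (\<lambda>\<omega>. if \<bar>X k \<omega>\<bar> \<le> L then X k \<omega> else 0) = a"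
      by (simp add: a_def Y_def[abs_def])
    then show ?thesis using aL L by (auto simp: trunc_def abs_le_iff)
  qed
  show "integrable M (\<lambda>\<omega>. (trunc L k (X k \<omega>))\<^sup>2)"
    unfolding tr power2_diff using iY iY2 by simp
  show "expectation (\<lambda>\<omega>. trunc L k (X k \<omega>)) = 0"
    unfolding tr using iY by (simp add: a_def prob_space)
  have XY: "X k \<omega> * Y \<omega> = (Y \<omega>)\<^sup>2" for \<omega> by (simp add: Y_def power2_eq_square)
  have e1: "expectation (\<lambda>\<omega>. X k \<omega> * trunc L k (X k \<omega>)) = expectation (\<lambda>\<omega>. (Y \<omega>)\<^sup>2)"
    unfolding tr right_diff_distrib XY using iY2 X_integrable[OF k] mean[OF k] by simp
  have e2: "expectation (\<lambda>\<omega>. (trunc L k (X k \<omega>))\<^sup>2) = expectation (\<lambda>\<omega>. (Y \<omega>)\<^sup>2) - a\<^sup>2"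
    unfolding tr power2_diff using iY iY2 by (simp add: a_def prob_space power2_eq_square)
  have split: "(X k \<omega>)\<^sup>2 = (Y \<omega>)\<^sup>2 + (if \<bar>X k \<omega>\<bar> \<le> L then 0 else (X k \<omega>)\<^sup>2)" for \<omega>
    by (simp add: Y_def)
  have it: "integrable M (\<lambda>\<omega>. if \<bar>X k \<omega>\<bar> \<le> L then 0 else (X k \<omega>)\<^sup>2)"
    by (rule Bochner_Integration.integrable_bound[OF X_square_integrable[OF k]]) auto
  have e3: "1 = expectation (\<lambda>\<omega>. (Y \<omega>)\<^sup>2) + tail L k"
    unfolding var[OF k, symmetric] tail_def using iY2 it by (subst split) simp
  have t0: "0 \<le> tail L k" unfolding tail_def by simp
  have a2: "a\<^sup>2 \<le> tail L k"
  proof -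
    have "expectation (\<lambda>\<omega>. X k \<omega> - Y \<omega>) = - a"
      using iY X_integrable[OF k] mean[OF k] by (simp add: a_def)
    moreover have sq: "(X k \<omega> - Y \<omega>)\<^sup>2 = (if \<bar>X k \<omega>\<bar> \<le> L then 0 else (X k \<omega>)\<^sup>2)" for \<omega>
      by (simp add: Y_def)
    have "(expectation (\<lambda>\<omega>. X k \<omega> - Y \<omega>))\<^sup>2 \<le> expectation (\<lambda>\<omega>. (X k \<omega> - Y \<omega>)\<^sup>2)"
      using it unfolding sq[symmetric] by (intro expectation_square_le) auto
    ultimately show ?thesis by (simp add: sq tail_def)
  qed
  show "expectation (\<lambda>\<omega>. (trunc L k (X k \<omega>))\<^sup>2) \<le> 1"
    using e2 e3 t0 zero_le_power2[of a] by linarith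
  show "\<bar>expectation (\<lambda>\<omega>. (X k \<omega>)\<^sup>2) - expectation (\<lambda>\<omega>. X k \<omega> * trunc L k (X k \<omega>))\<bar> \<le> tail L k"
    using e1 e3 t0 var[OF k] by simp
  show "\<bar>expectation (\<lambda>\<omega>. (trunc L k (X k \<omega>))\<^sup>2) - expectation (\<lambda>\<omega>. X k \<omega> * trunc L k (X k \<omega>))\<bar> \<le> tail L k"
    using e1 e2 a2 by simp
qed

end

section \<open>Rotations of two independent copies and their truncations\<close>

context standardized_family
begin

abbreviation MM :: "('a \<times> 'a) measure" where
  "MM \<equiv> M \<Otimes>\<^sub>M M"

definition rot :: "real \<Rightarrow> nat \<Rightarrow> 'a \<times> 'a \<Rightarrow> real" where
  "rot \<theta> i z = cos \<theta> * X i (fst z) + sin \<theta> * X i (snd z)"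

text \<open>The truncations are rotated, instead of the rotations truncated: second moments then do
  not depend on the angle, as the replacement argument demands.\<close>

definition rot_trunc :: "real \<Rightarrow> real \<Rightarrow> nat \<Rightarrow> 'a \<times> 'a \<Rightarrow> real" where
  "rot_trunc L \<theta> i z = cos \<theta> * trunc L i (X i (fst z)) + sin \<theta> * trunc L i (X i (snd z))"

lemma rot_measurable: "1 \<le> i \<Longrightarrow> rot \<theta> i \<in> borel_measurable MM"
  unfolding rot_def[abs_def] using X_measurable[of i] by measurable

text \<open>For each \<open>i\<close> all these variables are functions of the one pair
  \<open>(X i (fst z), X i (snd z))\<close>. The first family serves the L2 comparison, the second
  the replacement of one angle by another.\<close>

lemma indep_rot:
  assumes I: "finite I" "I \<subseteq> {1..}"
  shows "prob_space.indep_vars MM (\<lambda>_. borel \<Otimes>\<^sub>M borel) (\<lambda>i z. (rot \<theta> i z, rot_trunc L \<theta> i z)) I"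
    and "prob_space.indep_vars MM (\<lambda>_. borel \<Otimes>\<^sub>M borel) (\<lambda>i z. (rot_trunc L \<theta> i z, rot_trunc L \<theta>' i z)) I"
proof -
  interpret P: pair_prob_space M M by (rule pair_self)
  have ind: "P.indep_vars (\<lambda>_. borel \<Otimes>\<^sub>M borel) (\<lambda>i z. (X i (fst z), X i (snd z))) I"
    using I by (intro indep_vars_pair indep_vars_subset[OF indep]) auto
  have m1: "(\<lambda>y. (cos \<theta> * fst y + sin \<theta> * snd y, cos \<theta> * trunc L i (fst y) + sin \<theta> * trunc L i (snd y)))
    \<in> measurable (borel \<Otimes>\<^sub>M borel) (borel \<Otimes>\<^sub>M borel)" for i
    by measurable
  have m2: "(\<lambda>y. (cos \<theta> * trunc L i (fst y) + sin \<theta> * trunc L i (snd y), cos \<theta>' * trunc L i (fst y) + sin \<theta>' * trunc L i (snd y)))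
    \<in> measurable (borel \<Otimes>\<^sub>M borel) (borel \<Otimes>\<^sub>M borel)" for i
    by measurable
  show "P.indep_vars (\<lambda>_. borel \<Otimes>\<^sub>M borel) (\<lambda>i z. (rot \<theta> i z, rot_trunc L \<theta> i z)) I"
    using P.indep_vars_compose2[OF ind, of "\<lambda>i y. (cos \<theta> * fst y + sin \<theta> * snd y, cos \<theta> * trunc L i (fst y) + sin \<theta> * trunc L i (snd y))", OF m1]
    by (simp add: rot_def rot_trunc_def)
  show "P.indep_vars (\<lambda>_. borel \<Otimes>\<^sub>M borel) (\<lambda>i z. (rot_trunc L \<theta> i z, rot_trunc L \<theta>' i z)) I"
    using P.indep_vars_compose2[OF ind, of "\<lambda>i y. (cos \<theta> * trunc L i (fst y) + sin \<theta> * trunc L i (snd y), cos \<theta>' * trunc L i (fst y) + sin \<theta>' * trunc L i (snd y))", OF m2]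
    by (simp add: rot_trunc_def)
qed

lemma rot_facts:
  assumes k: "1 \<le> k"
  shows "integrable MM (\<lambda>z. (rot \<theta> k z)\<^sup>2)" "(\<integral>z. rot \<theta> k z \<partial>MM) = 0"
    "(\<integral>z. (rot \<theta> k z)\<^sup>2 \<partial>MM) = 1"
  unfolding rot_def
  using rotation_square_integrable[OF X_measurable[OF k] X_square_integrable[OF k]]
    rotation_mean[OF X_integrable[OF k] mean[OF k]]
    rotation_moment[OF X_measurable[OF k] X_square_integrable[OF k] mean[OF k] X_measurable[OF k] X_square_integrable[OF k] mean[OF k]]
    var[OF k]
  by (simp_all add: power2_eq_square)

lemma rot_trunc_facts:
  assumes k: "1 \<le> k" and L: "1 \<le> L"
  shows "integrable MM (\<lambda>z. (rot_trunc L \<theta> k z)\<^sup>2)" "(\<integral>z. rot_trunc L \<theta> k z \<partial>MM) = 0"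
    "(\<integral>z. (rot_trunc L \<theta> k z)\<^sup>2 \<partial>MM) = expectation (\<lambda>\<omega>. (trunc L k (X k \<omega>))\<^sup>2)"
    "(\<integral>z. rot \<theta> k z * rot_trunc L \<theta> k z \<partial>MM) = expectation (\<lambda>\<omega>. X k \<omega> * trunc L k (X k \<omega>))"
    "\<bar>rot_trunc L \<theta> k z\<bar> \<le> 4 * L"
proof -
  have m: "(\<lambda>\<omega>. trunc L k (X k \<omega>)) \<in> borel_measurable M"
    using X_measurable[OF k] by measurable
  note f = trunc_facts[OF k L]
  have i: "integrable M (\<lambda>\<omega>. trunc L k (X k \<omega>))"
    using m f(2) by (rule square_integrable_imp_integrable)
  show "integrable MM (\<lambda>z. (rot_trunc L \<theta> k z)\<^sup>2)" "(\<integral>z. rot_trunc L \<theta> k z \<partial>MM) = 0"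
    "(\<integral>z. (rot_trunc L \<theta> k z)\<^sup>2 \<partial>MM) = expectation (\<lambda>\<omega>. (trunc L k (X k \<omega>))\<^sup>2)"
    "(\<integral>z. rot \<theta> k z * rot_trunc L \<theta> k z \<partial>MM) = expectation (\<lambda>\<omega>. X k \<omega> * trunc L k (X k \<omega>))"
    unfolding rot_def rot_trunc_def
    using rotation_square_integrable[OF m f(2)] rotation_mean[OF i f(3)]
      rotation_moment[OF m f(2,3) m f(2,3)]
      rotation_moment[OF X_measurable[OF k] X_square_integrable[OF k] mean[OF k] m f(2,3)]
    by (simp_all add: power2_eq_square)
  have "\<bar>cos \<theta> * trunc L k (X k (fst z))\<bar> \<le> 1 * (2 * L)"
    "\<bar>sin \<theta> * trunc L k (X k (snd z))\<bar> \<le> 1 * (2 * L)"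
    unfolding abs_mult by (intro mult_mono f(1); simp)+
  then show "\<bar>rot_trunc L \<theta> k z\<bar> \<le> 4 * L"
    unfolding rot_trunc_def by linarith
qed

text \<open>Rotation preserves mixed second moments, so the tail bounds for single variables hold at
  every angle and feed the perturbation estimate.\<close>

lemma mlf_rot_L2:
  assumes I: "finite I" "I \<subseteq> {1..}" and deg: "\<And>S. S \<subseteq> I \<Longrightarrow> c S \<noteq> 0 \<Longrightarrow> card S \<le> p"
    and c: "(\<Sum>S\<in>{S \<in> Pow I. card S > 0}. (c S)\<^sup>2) \<le> 1"
    and L: "1 \<le> L" and \<rho>: "\<And>k. 1 \<le> k \<Longrightarrow> tail L k \<le> \<rho>" "0 \<le> \<rho>"
  shows "integrable MM (\<lambda>z. (mlf I c (\<lambda>i. rot \<theta> i z) - mlf I c (\<lambda>i. rot_trunc L \<theta> i z))\<^sup>2)"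
    and "(\<integral>z. (mlf I c (\<lambda>i. rot \<theta> i z) - mlf I c (\<lambda>i. rot_trunc L \<theta> i z))\<^sup>2 \<partial>MM) \<le> 2 * real p * \<rho>"
proof -
  interpret P: pair_prob_space M M by (rule pair_self)
  have k: "1 \<le> i" if "i \<in> I" for i using that I by auto
  have ra: "\<bar>(\<integral>z. (rot \<theta> i z)\<^sup>2 \<partial>MM) - (\<integral>z. rot \<theta> i z * rot_trunc L \<theta> i z \<partial>MM)\<bar> \<le> \<rho>"
    if "i \<in> I" for i
    using trunc_facts(5)[OF k[OF that] L] \<rho>(1)[OF k[OF that]] rot_facts(3)[OF k[OF that]] var[OF k[OF that]]
      rot_trunc_facts(4)[OF k[OF that] L] by (simp del: abs_le_iff)
  have rb: "\<bar>(\<integral>z. (rot_trunc L \<theta> i z)\<^sup>2 \<partial>MM) - (\<integral>z. rot \<theta> i z * rot_trunc L \<theta> i z \<partial>MM)\<bar> \<le> \<rho>"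
    if "i \<in> I" for i
    using trunc_facts(6)[OF k[OF that] L] \<rho>(1)[OF k[OF that]] rot_trunc_facts(3,4)[OF k[OF that] L] by simp
  have a: "(\<integral>z. (rot \<theta> i z)\<^sup>2 \<partial>MM) \<le> 1" "(\<integral>z. (rot_trunc L \<theta> i z)\<^sup>2 \<partial>MM) \<le> 1" if "i \<in> I" for i
    using rot_facts(3)[OF k[OF that]] rot_trunc_facts(3)[OF k[OF that] L] trunc_facts(4)[OF k[OF that] L] by simp_all
  note * = P.mlf_perturbation[OF I(1) indep_rot(1)[OF I] rot_facts(1)[OF k] rot_facts(2)[OF k]
      rot_trunc_facts(1)[OF k L] rot_trunc_facts(2)[OF k L] a ra rb deg c \<rho>(2)]
  show "integrable MM (\<lambda>z. (mlf I c (\<lambda>i. rot \<theta> i z) - mlf I c (\<lambda>i. rot_trunc L \<theta> i z))\<^sup>2)"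
    by (rule *(1))
  show "(\<integral>z. (mlf I c (\<lambda>i. rot \<theta> i z) - mlf I c (\<lambda>i. rot_trunc L \<theta> i z))\<^sup>2 \<partial>MM) \<le> 2 * real p * \<rho>"
    by (rule *(2))
qed

lemma rot_trunc_measurable: "1 \<le> i \<Longrightarrow> rot_trunc L \<theta> i \<in> borel_measurable MM"
  unfolding rot_trunc_def[abs_def] using X_measurable[of i] by measurable

text \<open>Truncate at angle 0, replace angle 0 by \<open>\<theta>\<close> in the truncated form,
  and undo the truncation at \<open>\<theta>\<close>. The L2 error occurs twice, the replacement
  error once. A rotated truncation is bounded by \<open>4 * L\<close>, twice the bound
  \<open>2 * L\<close> of a single one.\<close>

lemma char_rot_diff:
  assumes I: "finite I" "I \<subseteq> {1..}" and deg: "\<And>S. S \<subseteq> I \<Longrightarrow> c S \<noteq> 0 \<Longrightarrow> card S \<le> p"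
    and c: "(\<Sum>S\<in>{S \<in> Pow I. card S > 0}. (c S)\<^sup>2) \<le> 1"
    and inf: "\<And>k. k \<in> I \<Longrightarrow> (\<Sum>S\<in>{S \<in> Pow I. k \<in> S}. (c S)\<^sup>2) \<le> \<tau>" and l: "0 < l" and \<tau>: "0 \<le> \<tau>"
    and L: "1 \<le> L" and \<rho>: "\<And>k. 1 \<le> k \<Longrightarrow> tail L k \<le> \<rho>" "0 \<le> \<rho>"
  shows "cmod ((\<integral>z. iexp (t * mlf I c (\<lambda>i. rot 0 i z)) \<partial>MM) - (\<integral>z. iexp (t * mlf I c (\<lambda>i. rot \<theta> i z)) \<partial>MM))
    \<le> 2 * (\<bar>t\<bar> * sqrt (2 * real p * \<rho>))
      + (4 * L) ^ 3 / 3 * (\<bar>t\<bar> ^ 3 * ((l * (4 * (4 * L)\<^sup>2) ^ p + ((4 * (4 * L)\<^sup>2) ^ p)\<^sup>2 * \<tau> / l) / 2)) * real p"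
proof -
  interpret P: pair_prob_space M M by (rule pair_self)
  have k: "1 \<le> i" if "i \<in> I" for i using that I by auto
  have m: "(\<lambda>z. mlf I c (\<lambda>i. rot \<theta> i z)) \<in> borel_measurable MM"
    "(\<lambda>z. mlf I c (\<lambda>i. rot_trunc L \<theta> i z)) \<in> borel_measurable MM" for \<theta>
    using k rot_measurable rot_trunc_measurable by (auto intro!: mlf_measurable)
  have 1: "cmod ((\<integral>z. iexp (t * mlf I c (\<lambda>i. rot \<theta> i z)) \<partial>MM) - (\<integral>z. iexp (t * mlf I c (\<lambda>i. rot_trunc L \<theta> i z)) \<partial>MM))
    \<le> \<bar>t\<bar> * sqrt (2 * real p * \<rho>)" for \<theta>
    by (rule P.iexp_dist_le[OF m mlf_rot_L2[OF I deg c L \<rho>]])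
  have 2: "cmod ((\<integral>z. iexp (t * mlf I c (\<lambda>i. rot_trunc L 0 i z)) \<partial>MM) - (\<integral>z. iexp (t * mlf I c (\<lambda>i. rot_trunc L \<theta> i z)) \<partial>MM))
    \<le> (4 * L) ^ 3 / 3 * (\<bar>t\<bar> ^ 3 * ((l * (4 * (4 * L)\<^sup>2) ^ p + ((4 * (4 * L)\<^sup>2) ^ p)\<^sup>2 * \<tau> / l) / 2)) * real p"
  proof (rule P.mlf_invariance[OF I(1) indep_rot(2)[OF I] _ _ _ _ _ _ deg c inf l \<tau>])
    show "(\<integral>z. (rot_trunc L 0 i z)\<^sup>2 \<partial>MM) = (\<integral>z. (rot_trunc L \<theta> i z)\<^sup>2 \<partial>MM)" if "i \<in> I" for i
      using rot_trunc_facts(3)[OF k[OF that] L] by simp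
  qed (use rot_trunc_facts[OF k L] L in simp_all)
  have tri: "cmod (a - d) \<le> cmod (a - b) + cmod (b - c) + cmod (d - c)" for a b c d
    using norm_triangle_ineq[of "a - b" "b - c"] norm_triangle_ineq[of "a - c" "c - d"] norm_minus_commute[of d c]
    by simp
  have "cmod ((\<integral>z. iexp (t * mlf I c (\<lambda>i. rot 0 i z)) \<partial>MM) - (\<integral>z. iexp (t * mlf I c (\<lambda>i. rot \<theta> i z)) \<partial>MM))
    \<le> \<bar>t\<bar> * sqrt (2 * real p * \<rho>)
      + (4 * L) ^ 3 / 3 * (\<bar>t\<bar> ^ 3 * ((l * (4 * (4 * L)\<^sup>2) ^ p + ((4 * (4 * L)\<^sup>2) ^ p)\<^sup>2 * \<tau> / l) / 2)) * real p
      + \<bar>t\<bar> * sqrt (2 * real p * \<rho>)"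
    by (rule order_trans[OF tri add_mono[OF add_mono[OF 1 2] 1]])
  then show ?thesis by simp
qed

text \<open>The order of choices matters: \<open>L\<close> makes the truncation error small, then
  \<open>l\<close>, depending on \<open>L\<close>, makes the first replacement term small, and
  finally \<open>j\<close> is taken so large that \<open>\<tau> j\<close> beats
  \<open>1 / l\<close>.\<close>

lemma char_rot_limit:
  fixes c :: "nat \<Rightarrow> nat set \<Rightarrow> real" and I :: "nat \<Rightarrow> nat set"
  assumes I: "\<And>j. finite (I j)" "\<And>j. I j \<subseteq> {1..}"
    and deg: "\<And>j S. S \<subseteq> I j \<Longrightarrow> c j S \<noteq> 0 \<Longrightarrow> card S \<le> p"
    and c: "\<And>j. (\<Sum>S\<in>{S \<in> Pow (I j). card S > 0}. (c j S)\<^sup>2) \<le> 1"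
    and inf: "\<And>j k. k \<in> I j \<Longrightarrow> (\<Sum>S\<in>{S \<in> Pow (I j). k \<in> S}. (c j S)\<^sup>2) \<le> \<tau> j"
    and \<tau>: "\<And>j. 0 \<le> \<tau> j" "\<tau> \<longlonglongrightarrow> 0"
  shows "(\<lambda>j. (\<integral>z. iexp (t * mlf (I j) (c j) (\<lambda>i. rot 0 i z)) \<partial>MM)
      - (\<integral>z. iexp (t * mlf (I j) (c j) (\<lambda>i. rot \<theta> i z)) \<partial>MM)) \<longlonglongrightarrow> 0"
    (is "?d \<longlonglongrightarrow> 0")
proof (rule LIMSEQ_I)
  fix e :: real assume e: "0 < e"
  \<comment> \<open>Chosen so that
    \<open>\<bar>t\<bar> * sqrt (2 * real p * \<rho>) \<le> e / 6\<close>; the added ones exclude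
    division by zero for \<open>t = 0\<close> or \<open>p = 0\<close>.\<close>
  define \<rho> where "\<rho> = (e / (6 * (\<bar>t\<bar> + 1)))\<^sup>2 / (2 * real p + 1)"
  have \<rho>0: "0 < \<rho>" unfolding \<rho>_def using e by (intro divide_pos_pos zero_less_power) auto
  obtain L where L: "1 \<le> L" "\<And>k. 1 \<le> k \<Longrightarrow> tail L k \<le> \<rho>"
    using ui[OF \<rho>0] unfolding tail_def by auto
  have "2 * real p * \<rho> \<le> (2 * real p + 1) * \<rho>" using \<rho>0 by simp
  also have "\<dots> = (e / (6 * (\<bar>t\<bar> + 1)))\<^sup>2" by (simp add: \<rho>_def)
  finally have "sqrt (2 * real p * \<rho>) \<le> e / (6 * (\<bar>t\<bar> + 1))"
    using e by (intro real_le_lsqrt) auto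
  then have "\<bar>t\<bar> * sqrt (2 * real p * \<rho>) \<le> (\<bar>t\<bar> + 1) * (e / (6 * (\<bar>t\<bar> + 1)))"
    using \<rho>0 by (intro mult_mono) auto
  also have "\<dots> = e / 6" by (simp add: field_simps)
  finally have 1: "\<bar>t\<bar> * sqrt (2 * real p * \<rho>) \<le> e / 6" .
  \<comment> \<open>With \<open>D\<close> and \<open>\<kappa>\<close> the replacement error reads
    \<open>D * \<kappa> * l + D * \<kappa>\<^sup>2 / l * \<tau> j\<close>.\<close>
  define D where "D = (4 * L) ^ 3 / 3 * \<bar>t\<bar> ^ 3 * real p / 2"
  define \<kappa> where "\<kappa> = (4 * (4 * L)\<^sup>2) ^ p"
  have D0: "0 \<le> D" and \<kappa>0: "0 \<le> \<kappa>" using L by (auto simp: D_def \<kappa>_def)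
  define l where "l = e / (6 * (D * \<kappa> + 1))"
  have l0: "0 < l" using e D0 \<kappa>0 by (auto simp: l_def intro!: divide_pos_pos add_nonneg_pos)
  have "D * \<kappa> * l \<le> (D * \<kappa> + 1) * l" using l0 by simp
  also have "\<dots> = e / 6"
  proof -
    have "0 < D * \<kappa> + 1" using D0 \<kappa>0 by (simp add: add_nonneg_pos)
    then show ?thesis by (simp add: l_def field_simps)
  qed
  finally have 2: "D * \<kappa> * l \<le> e / 6" .
  have "(\<lambda>j. D * \<kappa>\<^sup>2 / l * \<tau> j) \<longlonglongrightarrow> D * \<kappa>\<^sup>2 / l * 0"
    by (intro tendsto_intros \<tau>)
  then have lim0: "(\<lambda>j. D * \<kappa>\<^sup>2 / l * \<tau> j) \<longlonglongrightarrow> 0" by (simp only: mult_zero_right)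
  obtain N where "\<forall>j\<ge>N. norm (D * \<kappa>\<^sup>2 / l * \<tau> j - 0) < e / 6"
    using LIMSEQ_D[OF lim0, of "e / 6"] e by auto
  then have N: "\<And>j. N \<le> j \<Longrightarrow> \<bar>D * \<kappa>\<^sup>2 / l * \<tau> j\<bar> < e / 6" by simp
  show "\<exists>N. \<forall>j\<ge>N. norm (?d j - 0) < e"
  proof (intro exI[of _ N] allI impI)
    fix j assume j: "N \<le> j"
    have "cmod (?d j) \<le> 2 * (\<bar>t\<bar> * sqrt (2 * real p * \<rho>))
      + (4 * L) ^ 3 / 3 * (\<bar>t\<bar> ^ 3 * ((l * (4 * (4 * L)\<^sup>2) ^ p + ((4 * (4 * L)\<^sup>2) ^ p)\<^sup>2 * \<tau> j / l) / 2)) * real p"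
      using \<rho>0 by (intro char_rot_diff I deg c inf l0 \<tau> L) auto
    also have "\<dots> = 2 * (\<bar>t\<bar> * sqrt (2 * real p * \<rho>)) + D * \<kappa> * l + D * \<kappa>\<^sup>2 / l * \<tau> j"
      unfolding \<kappa>_def[symmetric] D_def by (simp add: field_simps)
    also have "\<dots> < e" using 1 2 N[OF j] e by linarith
    finally show "norm (?d j - 0) < e" by simp
  qed
qed

end

section \<open>Limits in law of low-influence forms\<close>

lemma lebesgue_integral_restrict_Icc:
  fixes g :: "real \<Rightarrow> real"
  assumes "continuous_on {a..b} g"
  shows "integral\<^sup>L (restrict_space lborel {a..b}) g = integral {a..b} g"
proof -
  have "integral\<^sup>L (restrict_space lborel {a..b}) g = set_lebesgue_integral lborel {a..b} g"
    by (simp add: integral_restrict_space set_lebesgue_integral_def)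
  also have "\<dots> = integral {a..b} g"
    by (rule set_borel_integral_eq_integral(2)[OF borel_integrable_atLeastAtMost'[OF assms]])
  finally show ?thesis .
qed

text \<open>The index \<open>j\<close> runs along the subsequence, and \<open>\<tau> j\<close> is
  any bound on the influences that tends to zero.\<close>

locale low_influence_limit = standardized_family M X for M :: "'a measure" and X +
  fixes I :: "nat \<Rightarrow> nat set" and c :: "nat \<Rightarrow> nat set \<Rightarrow> real" and p :: nat
    and \<tau> :: "nat \<Rightarrow> real" and \<mu> :: "real measure"
  assumes I: "\<And>j. finite (I j)" "\<And>j. I j \<subseteq> {1..}"
    and deg: "\<And>j S. S \<subseteq> I j \<Longrightarrow> c j S \<noteq> 0 \<Longrightarrow> card S \<le> p"
    and c: "\<And>j. (\<Sum>S\<in>{S \<in> Pow (I j). card S > 0}. (c j S)\<^sup>2) = 1"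
    and inf: "\<And>j k. k \<in> I j \<Longrightarrow> (\<Sum>S\<in>{S \<in> Pow (I j). k \<in> S}. (c j S)\<^sup>2) \<le> \<tau> j"
    and \<tau>: "\<And>j. 0 \<le> \<tau> j" "\<tau> \<longlonglongrightarrow> 0"
    and \<mu>: "real_distribution \<mu>"
    and conv: "weak_conv_m (\<lambda>j. distr M borel (\<lambda>\<omega>. mlf (I j) (c j) (\<lambda>i. X i \<omega>))) \<mu>"
begin

sublocale P: pair_prob_space M M by (rule pair_self)

sublocale mu: real_distribution \<mu> by (rule \<mu>)

sublocale mu2: pair_prob_space \<mu> \<mu> by (rule mu.pair_self)

definition Q :: "nat \<Rightarrow> 'a \<Rightarrow> real" where
  "Q j \<omega> = mlf (I j) (c j) (\<lambda>i. X i \<omega>)"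

definition T :: "nat \<Rightarrow> real \<Rightarrow> 'a \<times> 'a \<Rightarrow> real" where
  "T j \<theta> z = mlf (I j) (c j) (\<lambda>i. rot \<theta> i z)"

text \<open>The law of the difference of two independent copies of the limit;
  \<open>measure \<nu> {0}\<close> is their coincidence probability.\<close>

definition \<nu> :: "real measure" where
  "\<nu> = distr (\<mu> \<Otimes>\<^sub>M \<mu>) borel (\<lambda>z. snd z - fst z)"

lemma index_ge_1: "i \<in> I j \<Longrightarrow> 1 \<le> i"
  using I(2)[of j] by auto

lemma Q_measurable [measurable]: "Q j \<in> borel_measurable M"
  unfolding Q_def[abs_def] by (intro mlf_measurable X_measurable index_ge_1)

lemma T_measurable [measurable]: "T j \<theta> \<in> borel_measurable MM"
  unfolding T_def[abs_def] by (intro mlf_measurable rot_measurable index_ge_1)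

lemma T_endpoints: "T j 0 z = Q j (fst z)" "T j (pi / 2) z = Q j (snd z)"
  by (simp_all add: T_def Q_def rot_def)

lemma T_trig_poly: "trig_poly p (\<lambda>\<theta>. T j \<theta> z)"
  unfolding T_def rot_def by (rule trig_poly_mlf[OF I(1) deg])

lemma real_distribution_Q: "real_distribution (distr M borel (Q j))"
  by (rule real_distribution_distr) simp

lemma real_distribution_T: "real_distribution (distr MM borel (T j \<theta>))"
  by (rule P.real_distribution_distr) simp

lemma char_Q_limit: "(\<lambda>j. char (distr M borel (Q j)) t) \<longlonglongrightarrow> char \<mu> t"
  using real_distribution_Q \<mu> conv unfolding Q_def[symmetric] by (rule levy_continuity1)

lemma char_Q: "char (distr M borel (Q j)) t = expectation (\<lambda>\<omega>. iexp (t * Q j \<omega>))"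
  by (simp add: char_def integral_distr)

lemma iexp_Q_integrable: "integrable M (\<lambda>\<omega>. iexp (t * Q j \<omega>))"
  by (intro integrable_const_bound[where B=1]) auto

text \<open>Angle 0 reproduces the law of \<open>Q j\<close>. The vanishing difference of
  characteristic functions carries its limit to every other angle, and Levy's continuity theorem
  returns to weak convergence.\<close>

lemma T_weak_limit: "weak_conv_m (\<lambda>j. distr MM borel (T j \<theta>)) \<mu>"
proof (rule levy_continuity[OF real_distribution_T \<mu>])
  fix t
  have 1: "complex_integrable M (\<lambda>_. 1)" by simp
  have "(\<integral>z. iexp (t * T j 0 z) \<partial>MM) = char (distr M borel (Q j)) t" for j
    using P.integral_product_function(2)[OF iexp_Q_integrable[of t j] 1]
    by (simp add: T_endpoints char_Q prob_space)
  then have "(\<lambda>j. char (distr M borel (Q j)) t - (\<integral>z. iexp (t * T j \<theta> z) \<partial>MM)) \<longlonglongrightarrow> 0"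
    using char_rot_limit[where t=t and \<theta>=\<theta>, OF I deg eq_refl[OF c] inf \<tau>] by (simp add: T_def)
  from tendsto_diff[OF char_Q_limit[of t] this]
  show "(\<lambda>j. char (distr MM borel (T j \<theta>)) t) \<longlonglongrightarrow> char \<mu> t"
    by (simp add: char_def integral_distr)
qed

lemma real_distribution_\<nu>: "real_distribution \<nu>"
  unfolding \<nu>_def by (rule mu2.real_distribution_distr) measurable

text \<open>The endpoints depend on different coordinates of the product space, so the
  characteristic function of the increment factors exactly, as does that of
  \<open>\<nu>\<close>.\<close>

lemma difference_weak_limit: "weak_conv_m (\<lambda>j. distr MM borel (\<lambda>z. T j (pi / 2) z - T j 0 z)) \<nu>"
proof (rule levy_continuity[OF P.real_distribution_distr real_distribution_\<nu>])
  fix t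
  have 1: "char (distr MM borel (\<lambda>z. T j (pi / 2) z - T j 0 z)) t
    = char (distr M borel (Q j)) (- t) * char (distr M borel (Q j)) t" for j
  proof -
    have "char (distr MM borel (\<lambda>z. T j (pi / 2) z - T j 0 z)) t
      = (\<integral>z. iexp ((- t) * Q j (fst z)) * iexp (t * Q j (snd z)) \<partial>MM)"
      by (simp add: char_def integral_distr T_endpoints exp_add[symmetric] algebra_simps)
    also have "\<dots> = char (distr M borel (Q j)) (- t) * char (distr M borel (Q j)) t"
      unfolding char_Q by (rule P.integral_product_function(2)[OF iexp_Q_integrable iexp_Q_integrable])
    finally show ?thesis .
  qed
  have i: "integrable \<mu> (\<lambda>x. iexp (s * x))" for s
    by (intro mu.integrable_const_bound[where B=1]) auto
  have 2: "char \<nu> t = char \<mu> (- t) * char \<mu> t"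
  proof -
    have "char \<nu> t = (\<integral>z. iexp ((- t) * fst z) * iexp (t * snd z) \<partial>(\<mu> \<Otimes>\<^sub>M \<mu>))"
      unfolding \<nu>_def by (simp add: char_def integral_distr exp_add[symmetric] algebra_simps)
    also have "\<dots> = char \<mu> (- t) * char \<mu> t"
      unfolding char_def by (rule mu2.integral_product_function(2)[OF i i])
    finally show ?thesis .
  qed
  show "(\<lambda>j. char (distr MM borel (\<lambda>z. T j (pi / 2) z - T j 0 z)) t) \<longlonglongrightarrow> char \<nu> t"
    unfolding 1 2 by (intro tendsto_mult char_Q_limit)
qed measurable

text \<open>The constant \<open>a\<close> is absorbed into the coefficient of the empty set;
  orthogonality with unit variances then gives the sum of squared coefficients.\<close>

lemma T_second_moment:
  shows "integrable MM (\<lambda>z. (T j \<theta> z - a)\<^sup>2)"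
    and "P.expectation (\<lambda>z. (T j \<theta> z - a)\<^sup>2) = 1 + (c j {} - a)\<^sup>2"
proof -
  define c' where "c' = (c j)({} := c j {} - a)"
  have eq: "T j \<theta> z - a = mlf (I j) c' (\<lambda>i. rot \<theta> i z)" for z
    unfolding T_def c'_def using I(1) by (rule mlf_diff_const)
  have ind: "P.indep_vars (\<lambda>_. borel \<Otimes>\<^sub>M borel) (\<lambda>i z. (rot \<theta> i z, rot \<theta> i z)) (I j)"
    using P.indep_vars_compose2[OF indep_rot(1)[OF I, of \<theta> 1 j], of "\<lambda>_ y. (fst y, fst y)" "\<lambda>_. borel \<Otimes>\<^sub>M borel"]
    by simp
  note f = rot_facts[OF index_ge_1]
  note m = P.mlf_product_moment[where c=c' and d=c', OF I(1) ind f(1,2) f(1,2)]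
  have one: "(\<integral>z. rot \<theta> i z * rot \<theta> i z \<partial>MM) = 1" if "i \<in> I j" for i
    using f(3)[OF that] by (simp add: power2_eq_square)
  have "(\<Sum>S\<in>Pow (I j). c' S * c' S * (\<Prod>i\<in>S. \<integral>z. rot \<theta> i z * rot \<theta> i z \<partial>MM)) = (\<Sum>S\<in>Pow (I j). (c' S)\<^sup>2)"
  proof (intro sum.cong refl)
    fix S assume "S \<in> Pow (I j)"
    then have "(\<Prod>i\<in>S. \<integral>z. rot \<theta> i z * rot \<theta> i z \<partial>MM) = 1"
      using one by (intro prod.neutral) auto
    then show "c' S * c' S * (\<Prod>i\<in>S. \<integral>z. rot \<theta> i z * rot \<theta> i z \<partial>MM) = (c' S)\<^sup>2"
      by (simp only: power2_eq_square mult_1_right)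
  qed
  also have "\<dots> = 1 + (c j {} - a)\<^sup>2"
    unfolding c'_def sum_squares_shift[OF I(1)] c by simp
  finally show "P.expectation (\<lambda>z. (T j \<theta> z - a)\<^sup>2) = 1 + (c j {} - a)\<^sup>2"
    using m(2) by (simp add: eq power2_eq_square)
  show "integrable MM (\<lambda>z. (T j \<theta> z - a)\<^sup>2)"
    using m(1) by (simp add: eq power2_eq_square)
qed

text \<open>Centring at the form's own mean gives a bound that is uniform in \<open>j\<close>,
  whatever the size of \<open>c j {}\<close>.\<close>

lemma T_centered_moment:
  shows "integrable MM (\<lambda>z. \<bar>T j \<theta> z - c j {}\<bar>)"
    and "P.expectation (\<lambda>z. \<bar>T j \<theta> z - c j {}\<bar>) \<le> 1"
proof -
  note i = T_second_moment(1)[of j \<theta> "c j {}"]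
  have "integrable MM (\<lambda>z. T j \<theta> z - c j {})"
    using i by (rule P.square_integrable_imp_integrable[rotated]) measurable
  then show "integrable MM (\<lambda>z. \<bar>T j \<theta> z - c j {}\<bar>)" by simp
  have "(P.expectation (\<lambda>z. \<bar>T j \<theta> z - c j {}\<bar>))\<^sup>2 \<le> P.expectation (\<lambda>z. \<bar>T j \<theta> z - c j {}\<bar>\<^sup>2)"
    using i by (intro P.expectation_square_le) auto
  then have "\<bar>P.expectation (\<lambda>z. \<bar>T j \<theta> z - c j {}\<bar>)\<bar> \<le> 1"
    using T_second_moment(2)[of j \<theta> "c j {}"] by (simp add: abs_square_le_1)
  then show "P.expectation (\<lambda>z. \<bar>T j \<theta> z - c j {}\<bar>) \<le> 1" by linarith
qed

abbreviation \<Lambda> :: "real measure" where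
  "\<Lambda> \<equiv> restrict_space lborel {0..2 * pi}"

lemma finite_\<Lambda>: "finite_measure \<Lambda>"
  by (rule finite_measureI) (simp add: emeasure_restrict_space space_restrict_space)

lemma pair_\<Lambda>: "pair_sigma_finite \<Lambda> MM"
proof -
  interpret L: finite_measure \<Lambda> by (rule finite_\<Lambda>)
  show ?thesis ..
qed

lemma T_joint_measurable: "(\<lambda>y. T j (fst y) (snd y)) \<in> borel_measurable (\<Lambda> \<Otimes>\<^sub>M MM)"
  unfolding T_def
proof (rule mlf_measurable)
  fix i assume "i \<in> I j"
  then have [measurable]: "X i \<in> borel_measurable M" by (intro X_measurable index_ge_1)
  have [measurable]: "cos \<in> borel_measurable \<Lambda>" "sin \<in> borel_measurable \<Lambda>"
    by (auto intro!: measurable_restrict_space1 borel_measurable_continuous_onI continuous_intros)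
  show "(\<lambda>y. rot (fst y) i (snd y)) \<in> borel_measurable (\<Lambda> \<Otimes>\<^sub>M MM)"
    unfolding rot_def by measurable
qed

text \<open>Fubini exchanges the circle and the sample space. At each angle the expectation tends to
  the integral against the same law \<open>\<mu>\<close>, and dominated convergence integrates this
  over the circle.\<close>

lemma expectation_occupation:
  fixes f :: "real \<Rightarrow> real"
  assumes f: "continuous_on UNIV f" "\<And>x. 0 \<le> f x" "\<And>x. f x \<le> 1"
  shows "integrable MM (\<lambda>z. integral {0..2 * pi} (\<lambda>\<theta>. f (T j \<theta> z)))"
    and "(\<lambda>j. P.expectation (\<lambda>z. integral {0..2 * pi} (\<lambda>\<theta>. f (T j \<theta> z)))) \<longlonglongrightarrow> 2 * pi * (\<integral>x. f x \<partial>\<mu>)"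
proof -
  interpret L: finite_measure \<Lambda> by (rule finite_\<Lambda>)
  interpret LP: pair_sigma_finite \<Lambda> MM by (rule pair_\<Lambda>)
  interpret fin: finite_measure "\<Lambda> \<Otimes>\<^sub>M MM"
    by (intro finite_measure_pair_measure finite_\<Lambda>) unfold_locales
  have fm [measurable]: "f \<in> borel_measurable borel"
    using f(1) by (rule borel_measurable_continuous_onI)
  have m: "(\<lambda>y. f (T j (fst y) (snd y))) \<in> borel_measurable (\<Lambda> \<Otimes>\<^sub>M MM)" for j
    using T_joint_measurable by measurable
  have i: "integrable (\<Lambda> \<Otimes>\<^sub>M MM) (case_prod (\<lambda>\<theta> z. f (T j \<theta> z)))" for j
    using m f by (intro fin.integrable_const_bound[where B=1]) (auto simp: case_prod_beta)
  have eq: "integral {0..2 * pi} (\<lambda>\<theta>. f (T j \<theta> z)) = (\<integral>\<theta>. f (T j \<theta> z) \<partial>\<Lambda>)" for j z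
    using trig_poly_continuous[OF T_trig_poly]
    by (intro lebesgue_integral_restrict_Icc[symmetric] continuous_on_compose2[OF f(1)]) auto
  show "integrable MM (\<lambda>z. integral {0..2 * pi} (\<lambda>\<theta>. f (T j \<theta> z)))"
    unfolding eq by (rule LP.integrable_snd[OF i])
  have eq2: "P.expectation (\<lambda>z. integral {0..2 * pi} (\<lambda>\<theta>. f (T j \<theta> z))) = (\<integral>\<theta>. P.expectation (\<lambda>z. f (T j \<theta> z)) \<partial>\<Lambda>)" for j
    unfolding eq by (rule LP.Fubini_integral[OF i])
  have "(\<lambda>j. \<integral>\<theta>. P.expectation (\<lambda>z. f (T j \<theta> z)) \<partial>\<Lambda>) \<longlonglongrightarrow> (\<integral>\<theta>. (\<integral>x. f x \<partial>\<mu>) \<partial>\<Lambda>)"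
  proof (rule integral_dominated_convergence[where w="\<lambda>_. 1"])
    show "(\<lambda>\<theta>. P.expectation (\<lambda>z. f (T j \<theta> z))) \<in> borel_measurable \<Lambda>" for j
      using LP.integrable_fst[OF i] by auto
    show "AE \<theta> in \<Lambda>. (\<lambda>j. P.expectation (\<lambda>z. f (T j \<theta> z))) \<longlonglongrightarrow> (\<integral>x. f x \<partial>\<mu>)"
    proof (rule AE_I2)
      fix \<theta>
      have "(\<lambda>j. integral\<^sup>L (distr MM borel (T j \<theta>)) f) \<longlonglongrightarrow> integral\<^sup>L \<mu> f"
        using f by (intro weak_conv_imp_integral_bdd_continuous_conv[OF real_distribution_T \<mu> T_weak_limit, where B=1])
          (auto simp: continuous_on_eq_continuous_at)
      then show "(\<lambda>j. P.expectation (\<lambda>z. f (T j \<theta> z))) \<longlonglongrightarrow> (\<integral>x. f x \<partial>\<mu>)"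
        by (simp add: integral_distr)
    qed
    show "AE \<theta> in \<Lambda>. norm (P.expectation (\<lambda>z. f (T j \<theta> z))) \<le> 1" for j
    proof (rule AE_I2)
      fix \<theta>
      have "norm (P.expectation (\<lambda>z. f (T j \<theta> z))) \<le> P.expectation (\<lambda>z. norm (f (T j \<theta> z)))"
        by (rule integral_norm_bound)
      also have "\<dots> \<le> P.expectation (\<lambda>z. 1)"
        using f by (intro integral_mono P.integrable_const_bound[where B=1]) auto
      finally show "norm (P.expectation (\<lambda>z. f (T j \<theta> z))) \<le> 1" by (simp add: P.prob_space)
    qed
  qed auto
  also have "(\<integral>\<theta>. (\<integral>x. f x \<partial>\<mu>) \<partial>\<Lambda>) = 2 * pi * (\<integral>x. f x \<partial>\<mu>)"
    by (simp add: measure_restrict_space space_restrict_space)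
  finally show "(\<lambda>j. P.expectation (\<lambda>z. integral {0..2 * pi} (\<lambda>\<theta>. f (T j \<theta> z)))) \<longlonglongrightarrow> 2 * pi * (\<integral>x. f x \<partial>\<mu>)"
    unfolding eq2 .
qed

text \<open>Supplies the L1 norm occurring in the occupation bound: its expectation is bounded
  independently of \<open>j\<close>.\<close>

lemma expectation_oscillation:
  shows "integrable MM (\<lambda>z. integral {0..2 * pi} (\<lambda>\<theta>. \<bar>T j \<theta> z - c j {}\<bar>))"
    and "P.expectation (\<lambda>z. integral {0..2 * pi} (\<lambda>\<theta>. \<bar>T j \<theta> z - c j {}\<bar>)) \<le> 2 * pi"
proof -
  interpret L: finite_measure \<Lambda> by (rule finite_\<Lambda>)
  interpret LP: pair_sigma_finite \<Lambda> MM by (rule pair_\<Lambda>)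
  have m: "(\<lambda>y. \<bar>T j (fst y) (snd y) - c j {}\<bar>) \<in> borel_measurable (\<Lambda> \<Otimes>\<^sub>M MM)"
    using T_joint_measurable by measurable
  have i0: "integrable \<Lambda> (\<lambda>\<theta>. P.expectation (\<lambda>z. \<bar>T j \<theta> z - c j {}\<bar>))"
  proof (rule L.integrable_const_bound[where B=1])
    show "AE \<theta> in \<Lambda>. norm (P.expectation (\<lambda>z. \<bar>T j \<theta> z - c j {}\<bar>)) \<le> 1"
      using T_centered_moment(2) by (intro AE_I2) simp
    show "(\<lambda>\<theta>. P.expectation (\<lambda>z. \<bar>T j \<theta> z - c j {}\<bar>)) \<in> borel_measurable \<Lambda>"
      using m by (intro P.borel_measurable_lebesgue_integral) (simp add: case_prod_beta)
  qed
  have i: "integrable (\<Lambda> \<Otimes>\<^sub>M MM) (case_prod (\<lambda>\<theta> z. \<bar>T j \<theta> z - c j {}\<bar>))"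
    using m i0 T_centered_moment(1) by (intro LP.Fubini_integrable) (auto simp: case_prod_beta)
  have eq: "integral {0..2 * pi} (\<lambda>\<theta>. \<bar>T j \<theta> z - c j {}\<bar>) = (\<integral>\<theta>. \<bar>T j \<theta> z - c j {}\<bar> \<partial>\<Lambda>)" for z
    using trig_poly_continuous[OF T_trig_poly]
    by (intro lebesgue_integral_restrict_Icc[symmetric] continuous_intros) auto
  show "integrable MM (\<lambda>z. integral {0..2 * pi} (\<lambda>\<theta>. \<bar>T j \<theta> z - c j {}\<bar>))"
    unfolding eq by (rule LP.integrable_snd[OF i])
  have "P.expectation (\<lambda>z. integral {0..2 * pi} (\<lambda>\<theta>. \<bar>T j \<theta> z - c j {}\<bar>)) = (\<integral>\<theta>. P.expectation (\<lambda>z. \<bar>T j \<theta> z - c j {}\<bar>) \<partial>\<Lambda>)"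
    unfolding eq by (rule LP.Fubini_integral[OF i])
  also have "\<dots> \<le> (\<integral>\<theta>. 1 \<partial>\<Lambda>)"
    using i0 T_centered_moment(2) by (intro integral_mono) auto
  also have "\<dots> = 2 * pi" by (simp add: measure_restrict_space space_restrict_space)
  finally show "P.expectation (\<lambda>z. integral {0..2 * pi} (\<lambda>\<theta>. \<bar>T j \<theta> z - c j {}\<bar>)) \<le> 2 * pi" .
qed

end

section \<open>The limit law on Lebesgue null sets and its atoms\<close>

context low_influence_limit
begin

text \<open>Compactness makes \<open>K\<close> closed, so a continuous \<open>f\<close> can separate
  it from the complement of a small open neighbourhood, and weak convergence applies to
  \<open>f\<close>. The occupation bound is used where the increment of \<open>T\<close> is at least
  \<open>\<delta>\<close>; the rest is charged to a cut-off of the increment, whose limit is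
  governed by \<open>\<nu>\<close> near 0.\<close>

lemma compact_null_bound:
  assumes K: "compact K" "emeasure lborel K = 0"
  shows "measure \<mu> K \<le> measure \<nu> {0}"
proof (rule field_le_epsilon)
  fix e :: real assume e: "0 < e"
  interpret nu: real_distribution \<nu> by (rule real_distribution_\<nu>)
  \<comment> \<open>Continuity from above along intervals shrinking to \<open>{0}\<close>.
    \<open>\<delta>\<close> is fixed first, since \<open>C\<close> depends on it,
    \<open>\<kappa>\<close> on \<open>C\<close>, and \<open>U\<close> on
    \<open>\<kappa>\<close>.\<close>
  obtain \<delta> where \<delta>: "0 < \<delta>" "measure \<nu> {- 2 * \<delta>..2 * \<delta>} \<le> measure \<nu> {0} + e / 4"
  proof -
    define A where "A n = {- 2 * inverse (real (Suc n))..2 * inverse (real (Suc n))}" for n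
    have "(\<lambda>n. measure \<nu> (A n)) \<longlonglongrightarrow> measure \<nu> (\<Inter>n. A n)"
    proof (rule nu.finite_Lim_measure_decseq)
      show "decseq A" unfolding A_def decseq_def
        by (auto intro!: le_imp_inverse_le elim!: order_trans[rotated] order_trans simp del: of_nat_Suc)
    qed (auto simp: A_def)
    moreover have "(\<Inter>n. A n) = {0}"
    proof (intro equalityI subsetI)
      fix x assume x: "x \<in> (\<Inter>n. A n)"
      show "x \<in> {0}"
      proof (rule ccontr)
        assume "x \<notin> {0}"
        then obtain n where "inverse (real (Suc n)) < \<bar>x\<bar> / 2"
          using reals_Archimedean[of "\<bar>x\<bar> / 2"] by auto
        moreover have "x \<in> A n" using x by blast
        ultimately show False by (auto simp: A_def)
      qed
    qed (auto simp: A_def)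
    ultimately have "(\<lambda>n. measure \<nu> (A n)) \<longlonglongrightarrow> measure \<nu> {0}" by simp
    then have "eventually (\<lambda>n. measure \<nu> (A n) < measure \<nu> {0} + e / 4) sequentially"
      using e by (intro order_tendstoD) auto
    then obtain n where "measure \<nu> (A n) < measure \<nu> {0} + e / 4"
      by (auto simp: eventually_sequentially)
    then show thesis by (intro that[of "inverse (real (Suc n))"]) (auto simp: A_def)
  qed
  \<comment> \<open>A continuous cut-off: 1 for \<open>\<bar>u\<bar> \<le> \<delta>\<close> and 0
    for \<open>\<bar>u\<bar> \<ge> 2 * \<delta>\<close>.\<close>
  define g where "g u = max 0 (min 1 (2 - \<bar>u\<bar> / \<delta>))" for u :: real
  have g: "continuous_on UNIV g" "\<And>u. 0 \<le> g u" "\<And>u. g u \<le> 1"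
    unfolding g_def using \<delta>(1) by (auto intro!: continuous_intros)
  have [measurable]: "g \<in> borel_measurable borel"
    using g(1) by (rule borel_measurable_continuous_onI)
  have "(\<integral>u. g u \<partial>\<nu>) \<le> (\<integral>u. indicator {- 2 * \<delta>..2 * \<delta>} u \<partial>\<nu>)"
  proof (rule integral_mono)
    show "integrable \<nu> g" using g by (intro nu.integrable_const_bound[where B=1]) auto
    show "g u \<le> indicator {- 2 * \<delta>..2 * \<delta>} u" for u
      using \<delta>(1) by (auto simp: g_def indicator_def field_simps abs_if split: if_splits)
    show "integrable \<nu> (\<lambda>u. indicator {- 2 * \<delta>..2 * \<delta>} u :: real)"
      by (intro nu.integrable_const_bound[where B=1]) auto
  qed
  then have g\<nu>: "(\<integral>u. g u \<partial>\<nu>) \<le> measure \<nu> {0} + e / 4" using \<delta>(2) by simp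
  obtain C where C: "0 \<le> C" "\<And>T f \<kappa> c. trig_poly p T \<Longrightarrow> \<delta> \<le> \<bar>T (pi / 2) - T 0\<bar> \<Longrightarrow> continuous_on UNIV f \<Longrightarrow>
      (\<And>x. 0 \<le> f x \<and> f x \<le> 1) \<Longrightarrow> (\<And>a b. integral {a..b} f \<le> \<kappa>) \<Longrightarrow>
      integral {0..2 * pi} (\<lambda>x. f (T x)) \<le> C * \<kappa> * integral {0..2 * pi} (\<lambda>x. \<bar>T x - c\<bar>) + e / 4"
    using trig_poly_occupation[of "e / 4" \<delta> p] e \<delta>(1) by (auto; blast)
  define \<kappa> where "\<kappa> = e / (4 * (C + 1))"
  have \<kappa>: "0 < \<kappa>" "C * \<kappa> \<le> e / 4"
  proof -
    show "0 < \<kappa>" using e C(1) by (auto simp: \<kappa>_def)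
    then have "C * \<kappa> \<le> (C + 1) * \<kappa>" by simp
    also have "\<dots> = e / 4" using C(1) by (simp add: \<kappa>_def field_simps)
    finally show "C * \<kappa> \<le> e / 4" .
  qed
  have Kb: "K \<in> sets borel" using K(1) by (intro borel_closed compact_imp_closed)
  obtain U where U: "open U" "K \<subseteq> U" "emeasure lborel (U - K) \<le> \<kappa>"
    using outer_regular_lborel_le[OF Kb \<kappa>(1)] by blast
  have eU: "emeasure lborel U \<le> \<kappa>"
  proof -
    have "emeasure lborel U = emeasure lborel ((U - K) \<union> K)" using U(2) by (simp add: Un_absorb2)
    also have "\<dots> \<le> emeasure lborel (U - K) + emeasure lborel K"
      using U(1) Kb by (intro emeasure_subadditive) auto
    also have "\<dots> \<le> \<kappa>" using U(3) K(2) by simp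
    finally show ?thesis .
  qed
  \<comment> \<open>\<open>f\<close> is 1 on \<open>K\<close> and lives on \<open>U\<close>, so its
    integral over any interval is at most the Lebesgue measure of \<open>U\<close>, hence at most
    \<open>\<kappa>\<close>.\<close>
  obtain f :: "real \<Rightarrow> real" where f: "continuous_on UNIV f" "\<And>x. f x \<in> closed_segment 0 1"
      "\<And>x. x \<in> - U \<Longrightarrow> f x = 0" "\<And>x. x \<in> K \<Longrightarrow> f x = 1"
  proof (rule Urysohn[of "- U" K 0 "1::real"])
    show "closed (- U)" "closed K" "- U \<inter> K = {}"
      using U K(1) by (auto intro: compact_imp_closed)
  qed blast
  have f01: "0 \<le> f x" "f x \<le> 1" for x using f(2)[of x] by (simp_all add: closed_segment_eq_real_ivl)
  have [measurable]: "f \<in> borel_measurable borel"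
    using f(1) by (rule borel_measurable_continuous_onI)
  have fint: "integral {a..b} f \<le> \<kappa>" for a b
  proof -
    define A where "A = U \<inter> {a..b}"
    have A: "A \<in> sets borel" using U(1) by (auto simp: A_def)
    have eA: "emeasure lborel A \<le> \<kappa>"
      using eU U(1) by (intro order_trans[OF emeasure_mono eU]) (auto simp: A_def)
    then have "((\<lambda>x. 1 :: real) has_integral measure lborel A) A"
      using A by (intro has_integral_measure_lborel) (auto simp: top_unique less_top[symmetric])
    moreover have "A \<subseteq> {a..b}" by (auto simp: A_def)
    ultimately have h: "((\<lambda>x. if x \<in> A then 1 else 0 :: real) has_integral measure lborel A) {a..b}"
      by (simp only: has_integral_restrict)
    have "integral {a..b} f \<le> integral {a..b} (\<lambda>x. if x \<in> A then 1 else 0 :: real)"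
    proof (rule integral_le)
      show "f integrable_on {a..b}"
        using f(1) by (intro integrable_continuous_real) (rule continuous_on_subset, auto)
      show "f x \<le> (if x \<in> A then 1 else 0)" if "x \<in> {a..b}" for x
        using that f01[of x] f(3)[of x] by (auto simp: A_def)
    qed (use h in blast)
    also have "\<dots> = measure lborel A" using h by (rule integral_unique)
    also have "\<dots> \<le> \<kappa>"
      using eA \<kappa>(1) by (simp add: measure_def enn2real_leI)
    finally show ?thesis .
  qed
  define J where "J j z = integral {0..2 * pi} (\<lambda>\<theta>. \<bar>T j \<theta> z - c j {}\<bar>)" for j z
  \<comment> \<open>For a small increment the cut-off equals 1, and \<open>2 * pi\<close> bounds the
    occupation integral trivially because \<open>f \<le> 1\<close>.\<close>
  have pw: "integral {0..2 * pi} (\<lambda>\<theta>. f (T j \<theta> z)) \<le> 2 * pi * g (T j (pi / 2) z - T j 0 z) + C * \<kappa> * J j z + e / 4" for j z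
  proof (cases "\<delta> \<le> \<bar>T j (pi / 2) z - T j 0 z\<bar>")
    case True
    have "integral {0..2 * pi} (\<lambda>\<theta>. f (T j \<theta> z)) \<le> C * \<kappa> * J j z + e / 4"
      unfolding J_def using T_trig_poly True f(1) f01 fint by (intro C(2)) auto
    moreover have "0 \<le> 2 * pi * g (T j (pi / 2) z - T j 0 z)" using g(2) by simp
    ultimately show ?thesis by linarith
  next
    case False
    then have "\<bar>T j (pi / 2) z - T j 0 z\<bar> / \<delta> \<le> 1" using \<delta>(1) by simp
    then have g1: "g (T j (pi / 2) z - T j 0 z) = 1" by (simp add: g_def)
    note cT = trig_poly_continuous[OF T_trig_poly]
    have "integral {0..2 * pi} (\<lambda>\<theta>. f (T j \<theta> z)) \<le> integral {0..2 * pi} (\<lambda>\<theta>. 1 :: real)"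
      using f01 by (intro integral_le integrable_continuous_real continuous_on_compose2[OF f(1) cT]) auto
    moreover have "0 \<le> J j z" unfolding J_def
      by (intro integral_nonneg integrable_continuous_real continuous_intros cT) auto
    moreover then have "0 \<le> C * \<kappa> * J j z" using C(1) \<kappa>(1) by simp
    ultimately show ?thesis using g1 e by simp
  qed
  have gi: "integrable MM (\<lambda>z. g (T j (pi / 2) z - T j 0 z))" for j
    using g by (intro P.integrable_const_bound[where B=1]) auto
  have le: "P.expectation (\<lambda>z. integral {0..2 * pi} (\<lambda>\<theta>. f (T j \<theta> z)))
    \<le> 2 * pi * P.expectation (\<lambda>z. g (T j (pi / 2) z - T j 0 z)) + C * \<kappa> * (2 * pi) + e / 4" for j
  proof -
    have "P.expectation (\<lambda>z. integral {0..2 * pi} (\<lambda>\<theta>. f (T j \<theta> z)))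
      \<le> P.expectation (\<lambda>z. 2 * pi * g (T j (pi / 2) z - T j 0 z) + C * \<kappa> * J j z + e / 4)"
      using gi expectation_oscillation(1)[of j] pw
      by (intro integral_mono expectation_occupation(1)[OF f(1) f01]) (auto simp: J_def)
    also have "\<dots> = 2 * pi * P.expectation (\<lambda>z. g (T j (pi / 2) z - T j 0 z)) + C * \<kappa> * P.expectation (J j) + e / 4"
      using gi[of j] expectation_oscillation(1)[of j] by (simp add: J_def[abs_def] P.prob_space)
    also have "C * \<kappa> * P.expectation (J j) \<le> C * \<kappa> * (2 * pi)"
      using expectation_oscillation(2)[of j] C(1) \<kappa>(1) by (intro mult_left_mono) (auto simp: J_def[abs_def])
    finally show ?thesis by simp
  qed
  have lim: "(\<lambda>j. P.expectation (\<lambda>z. g (T j (pi / 2) z - T j 0 z))) \<longlonglongrightarrow> (\<integral>u. g u \<partial>\<nu>)"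
  proof -
    have rd: "real_distribution (distr MM borel (\<lambda>z. T j (pi / 2) z - T j 0 z))" for j
      by (rule P.real_distribution_distr) measurable
    have "(\<lambda>j. integral\<^sup>L (distr MM borel (\<lambda>z. T j (pi / 2) z - T j 0 z)) g) \<longlonglongrightarrow> integral\<^sup>L \<nu> g"
      using g by (intro weak_conv_imp_integral_bdd_continuous_conv[OF rd real_distribution_\<nu> difference_weak_limit, where B=1])
        (auto simp: continuous_on_eq_continuous_at)
    then show ?thesis by (simp add: integral_distr)
  qed
  have "2 * pi * (\<integral>x. f x \<partial>\<mu>) \<le> 2 * pi * (\<integral>u. g u \<partial>\<nu>) + C * \<kappa> * (2 * pi) + e / 4"
  proof (rule LIMSEQ_le[OF expectation_occupation(2)[OF f(1) f01]])
    show "(\<lambda>j. 2 * pi * P.expectation (\<lambda>z. g (T j (pi / 2) z - T j 0 z)) + C * \<kappa> * (2 * pi) + e / 4)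
      \<longlonglongrightarrow> 2 * pi * (\<integral>u. g u \<partial>\<nu>) + C * \<kappa> * (2 * pi) + e / 4"
      by (intro tendsto_intros lim)
  qed (use le in blast)
  also have "\<dots> \<le> 2 * pi * (measure \<nu> {0} + e / 4) + e / 4 * (2 * pi) + e / 4 * (2 * pi)"
  proof (intro add_mono mult_left_mono g\<nu> mult_right_mono \<kappa>(2))
    have "1 \<le> 2 * pi" using pi_gt3 by simp
    then show "e / 4 \<le> e / 4 * (2 * pi)" using e by simp
  qed auto
  also have "\<dots> \<le> 2 * pi * (measure \<nu> {0} + e)"
    using e by (simp add: algebra_simps)
  finally have "(\<integral>x. f x \<partial>\<mu>) \<le> measure \<nu> {0} + e" by simp
  moreover have "measure \<mu> K \<le> (\<integral>x. f x \<partial>\<mu>)"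
  proof -
    have "measure \<mu> K = (\<integral>x. indicator K x \<partial>\<mu>)" by simp
    also have "\<dots> \<le> (\<integral>x. f x \<partial>\<mu>)"
    proof (rule integral_mono)
      show "integrable \<mu> f" using f01 by (intro mu.integrable_const_bound[where B=1]) auto
      show "indicator K x \<le> f x" for x using f01[of x] f(4)[of x] by (auto simp: indicator_def)
    qed (use Kb in \<open>auto simp: mu.emeasure_eq_measure\<close>)
    finally show ?thesis .
  qed
  ultimately show "measure \<mu> K \<le> measure \<nu> {0} + e" by linarith
qed

text \<open>Inner regularity of the finite measure \<open>\<mu>\<close> reduces the claim to compact
  subsets, which are again null.\<close>

lemma null_bound:
  assumes N: "N \<in> null_sets lborel"
  shows "measure \<mu> N \<le> measure \<nu> {0}"
proof -
  have Nb: "N \<in> sets borel" using N by auto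
  have "emeasure \<mu> N = (SUP K\<in>{K. K \<subseteq> N \<and> compact K}. emeasure \<mu> K)"
    using Nb by (intro inner_regular) (auto simp: mu.emeasure_eq_measure)
  also have "\<dots> \<le> ennreal (measure \<nu> {0})"
  proof (rule SUP_least)
    fix K assume "K \<in> {K. K \<subseteq> N \<and> compact K}"
    then have K: "K \<subseteq> N" "compact K" by auto
    then have "K \<in> sets borel" by (intro borel_closed compact_imp_closed)
    then have "emeasure lborel K = 0"
      using null_sets_subset[OF N _ K(1)] by auto
    then show "emeasure \<mu> K \<le> ennreal (measure \<nu> {0})"
      using compact_null_bound[OF K(2)] by (simp add: mu.emeasure_eq_measure)
  qed
  finally show ?thesis by (simp add: mu.emeasure_eq_measure)
qed

text \<open>Truncation makes the squares of the forms uniformly integrable, so the variance survives in the limit.\<close>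

lemma not_concentrated: "measure \<mu> {a} \<noteq> 1"
proof
  assume a: "measure \<mu> {a} = 1"
  \<comment> \<open>Vanishes at \<open>a\<close> and equals 1 once
    \<open>\<bar>u - a\<bar> \<ge> 1 / 2\<close>; its expectation dominates the probability of being
    that far from \<open>a\<close>.\<close>
  define g where "g u = min 1 (2 * \<bar>u - a\<bar>)" for u :: real
  have g: "continuous_on UNIV g" "\<And>u. 0 \<le> g u" "\<And>u. g u \<le> 1"
    unfolding g_def by (auto intro!: continuous_intros)
  have [measurable]: "g \<in> borel_measurable borel"
    using g(1) by (rule borel_measurable_continuous_onI)
  have "AE x in \<mu>. x = a"
    using a mu.prob_eq_1[of "{a}"] by (simp add: mu.AE_in_set_eq_1)
  then have "(\<integral>u. g u \<partial>\<mu>) = (\<integral>u. 0 \<partial>\<mu>)"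
    by (intro integral_cong_AE) (auto simp: g_def)
  moreover have "(\<lambda>j. integral\<^sup>L (distr MM borel (T j 0)) g) \<longlonglongrightarrow> integral\<^sup>L \<mu> g"
    using g by (intro weak_conv_imp_integral_bdd_continuous_conv[OF real_distribution_T \<mu> T_weak_limit, where B=1])
      (auto simp: continuous_on_eq_continuous_at)
  ultimately have lim: "(\<lambda>j. P.expectation (\<lambda>z. g (T j 0 z))) \<longlonglongrightarrow> 0"
    by (simp add: integral_distr)
  define \<rho> where "\<rho> = 1 / (16 * (real p + 1))"
  have \<rho>: "0 < \<rho>" "2 * (2 * real p * \<rho>) \<le> 1 / 4"
    by (auto simp: \<rho>_def field_simps)
  obtain L where L: "1 \<le> L" "\<And>k. 1 \<le> k \<Longrightarrow> tail L k \<le> \<rho>"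
    using ui[OF \<rho>(1)] unfolding tail_def by auto
  define \<kappa> where "\<kappa> = 4 * (4 * L)\<^sup>2"
  have "1 \<le> L\<^sup>2" using L(1) by simp
  then have \<kappa>: "1 \<le> \<kappa>" by (simp add: \<kappa>_def power_mult_distrib)
  define B where "B = (\<kappa> ^ p)\<^sup>2"
  have B: "0 < B" using \<kappa> by (simp add: B_def)
  have "eventually (\<lambda>j. P.expectation (\<lambda>z. g (T j 0 z)) < 1 / (32 * B)) sequentially"
    using B by (intro order_tendstoD(2)[OF lim]) simp
  then obtain j where j: "P.expectation (\<lambda>z. g (T j 0 z)) < 1 / (32 * B)"
    by (auto simp: eventually_sequentially)
  \<comment> \<open>The exact second moment of \<open>T j 0 - a\<close>. Having no prescribed upper
    bound on \<open>c j {}\<close>, the estimates are scaled by \<open>v\<close>.\<close>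
  define v where "v = 1 + (c j {} - a)\<^sup>2"
  have v: "1 \<le> v" by (simp add: v_def)
  define c' where "c' = (c j)({} := c j {} - a)"
  define Z' where "Z' z = mlf (I j) c' (\<lambda>i. rot_trunc L 0 i z)" for z
  have Z': "Z' z = mlf (I j) (c j) (\<lambda>i. rot_trunc L 0 i z) - a" for z
    unfolding Z'_def c'_def using I(1) by (rule mlf_diff_const[symmetric])
  have Z'm [measurable]: "Z' \<in> borel_measurable MM"
    unfolding Z'_def by (intro mlf_measurable rot_trunc_measurable index_ge_1)
  have Zdiff: "T j 0 z - a - Z' z = mlf (I j) (c j) (\<lambda>i. rot 0 i z) - mlf (I j) (c j) (\<lambda>i. rot_trunc L 0 i z)" for z
    by (simp add: Z' T_def)
  have diff: "integrable MM (\<lambda>z. (T j 0 z - a - Z' z)\<^sup>2)"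
    "P.expectation (\<lambda>z. (T j 0 z - a - Z' z)\<^sup>2) \<le> 2 * real p * \<rho>"
    unfolding Zdiff using mlf_rot_L2[OF I deg[of _ j] eq_refl[OF c] L less_imp_le[OF \<rho>(1)]] by blast+
  have ind: "P.indep_vars (\<lambda>_. borel) (\<lambda>i z. rot_trunc L 0 i z) (I j)"
    using P.indep_vars_compose2[OF indep_rot(2)[OF I(1)[of j] I(2)[of j], where L=L and \<theta>=0 and \<theta>'=0], of "\<lambda>_ y. fst y" "\<lambda>_. borel"] by simp
  have Z'bd: "\<bar>Z' z\<bar> \<le> (\<Sum>S\<in>Pow (I j). \<bar>c' S\<bar> * (4 * L) ^ card S)" for z
    unfolding Z'_def by (intro mlf_bounded rot_trunc_facts(5) index_ge_1 L(1))
  have i4: "integrable MM (\<lambda>z. Z' z ^ 4)"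
    using power_mono[OF Z'bd, where n=4] by (intro P.integrable_bounded) (auto simp: power_abs)
  have "P.expectation (\<lambda>z. Z' z ^ 4) \<le> (\<kappa> ^ p * (\<Sum>S\<in>Pow (I j). (c' S)\<^sup>2))\<^sup>2"
    unfolding Z'_def \<kappa>_def
  proof (rule P.mlf_fourth_moment_degree[OF I(1) ind rot_trunc_facts(2)[OF index_ge_1[of _ j] L(1)]
        rot_trunc_facts(5)[OF index_ge_1[of _ j] L(1)]])
    show "1 \<le> 4 * L" using L(1) by linarith
    show "card S \<le> p" if "S \<subseteq> I j" "c' S \<noteq> 0" for S
      using that deg[of S j] by (cases "S = {}") (auto simp: c'_def)
  qed
  also have "(\<Sum>S\<in>Pow (I j). (c' S)\<^sup>2) = v"
    unfolding c'_def sum_squares_shift[OF I(1)] c v_def ..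
  also have "(\<kappa> ^ p * v)\<^sup>2 = B * v\<^sup>2" by (simp add: B_def power_mult_distrib)
  finally have e4: "P.expectation (\<lambda>z. Z' z ^ 4) \<le> B * v\<^sup>2" .
  \<comment> \<open>Balances the last two terms: the fourth moment contributes \<open>v / 4\<close>
    and the cut-off \<open>v / 8\<close>. With the two quarters this gives
    \<open>v \<le> 1 / 2 + 3 * v / 8\<close>, impossible for \<open>v \<ge> 1\<close>.\<close>
  define l where "l = 1 / (4 * B * v)"
  have l: "0 < l" using B v by (simp add: l_def)
  have gi: "integrable MM (\<lambda>z. g (T j 0 z))"
    using g by (intro P.integrable_const_bound[where B=1]) auto
  \<comment> \<open>Near \<open>a\<close> the constant \<open>1 / 4\<close> suffices. Far from
    \<open>a\<close> the square is split into truncation error and truncated form, and the latter is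
    bounded by its fourth power plus \<open>1 / l\<close>.\<close>
  have pw: "(T j 0 z - a)\<^sup>2 \<le> 1 / 4 + 2 * (T j 0 z - a - Z' z)\<^sup>2 + l * Z' z ^ 4 + g (T j 0 z) / l" for z
  proof (cases "\<bar>T j 0 z - a\<bar> < 1 / 2")
    case True
    then have "\<bar>T j 0 z - a\<bar>\<^sup>2 \<le> (1 / 2)\<^sup>2" by (intro power_mono) auto
    then have "(T j 0 z - a)\<^sup>2 \<le> 1 / 4" by (simp add: power2_eq_square)
    moreover have "0 \<le> 2 * (T j 0 z - a - Z' z)\<^sup>2" "0 \<le> l * Z' z ^ 4" "0 \<le> g (T j 0 z) / l"
      using l g(2) by auto
    ultimately show ?thesis by linarith
  next
    case False
    then have g1: "g (T j 0 z) = 1" by (simp add: g_def)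
    define u w where "u = T j 0 z - a" and "w = Z' z"
    have "0 \<le> (u - 2 * w)\<^sup>2" by simp
    then have "u\<^sup>2 \<le> 2 * (u - w)\<^sup>2 + 2 * w\<^sup>2" by (simp add: power2_eq_square algebra_simps)
    moreover have "2 * w\<^sup>2 \<le> l * w ^ 4 + 1 / l"
    proof -
      have "0 \<le> (l * w\<^sup>2 - 1)\<^sup>2 / l" using l by simp
      also have "\<dots> = l * w ^ 4 - 2 * w\<^sup>2 + 1 / l"
        using l by (simp add: power2_eq_square power4_eq_xxxx field_simps)
      finally show ?thesis by simp
    qed
    ultimately show ?thesis using g1 by (simp add: u_def w_def)
  qed
  have "v = P.expectation (\<lambda>z. (T j 0 z - a)\<^sup>2)"
    by (simp add: T_second_moment(2) v_def)
  also have "\<dots> \<le> P.expectation (\<lambda>z. 1 / 4 + 2 * (T j 0 z - a - Z' z)\<^sup>2 + l * Z' z ^ 4 + g (T j 0 z) / l)"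
    using T_second_moment(1) diff(1) i4 gi pw by (intro integral_mono) auto
  also have "\<dots> = 1 / 4 + 2 * P.expectation (\<lambda>z. (T j 0 z - a - Z' z)\<^sup>2) + l * P.expectation (\<lambda>z. Z' z ^ 4)
      + P.expectation (\<lambda>z. g (T j 0 z)) / l"
    using diff(1) i4 gi by (simp add: P.prob_space)
  also have "\<dots> \<le> 1 / 4 + 1 / 4 + l * (B * v\<^sup>2) + 1 / (32 * B) / l"
    using diff(2) \<rho>(2) e4 j l by (intro add_mono mult_left_mono divide_right_mono) auto
  also have "l * (B * v\<^sup>2) = v / 4"
    using B v by (simp add: l_def power2_eq_square)
  also have "1 / (32 * B) / l = v / 8"
    using B v by (simp add: l_def)
  finally show False using v by simp
qed

text \<open>Fubini on the diagonal, whose section at \<open>x\<close> is \<open>{x}\<close>. The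
  integral is the sum of the squared atom masses.\<close>

lemma measure_\<nu>_0: "measure \<nu> {0} = (\<integral>x. measure \<mu> {x} \<partial>\<mu>)"
  and atom_measure_measurable: "(\<lambda>x. measure \<mu> {x}) \<in> borel_measurable \<mu>"
proof -
  define \<Delta> where "\<Delta> = {z :: real \<times> real. snd z - fst z = 0}"
  have \<Delta>: "\<Delta> \<in> sets (\<mu> \<Otimes>\<^sub>M \<mu>)"
  proof -
    have "{z \<in> space (\<mu> \<Otimes>\<^sub>M \<mu>). snd z - fst z = 0} \<in> sets (\<mu> \<Otimes>\<^sub>M \<mu>)" by measurable
    then show ?thesis by (simp add: \<Delta>_def space_pair_measure)
  qed
  have sec: "Pair x -` \<Delta> = {x}" for x by (auto simp: \<Delta>_def)
  show m: "(\<lambda>x. measure \<mu> {x}) \<in> borel_measurable \<mu>"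
    using mu.measurable_emeasure_Pair[OF \<Delta>] by (simp add: sec measure_def)
  have "emeasure \<nu> {0} = emeasure (\<mu> \<Otimes>\<^sub>M \<mu>) \<Delta>"
    unfolding \<nu>_def by (subst emeasure_distr) (auto simp: \<Delta>_def space_pair_measure intro!: arg_cong[where f="emeasure _"])
  also have "\<dots> = (\<integral>\<^sup>+x. ennreal (measure \<mu> {x}) \<partial>\<mu>)"
    using mu.emeasure_pair_measure_alt[OF \<Delta>] by (simp add: sec mu.emeasure_eq_measure)
  also have "\<dots> = ennreal (\<integral>x. measure \<mu> {x} \<partial>\<mu>)"
    using m by (intro nn_integral_eq_integral mu.integrable_const_bound[where B=1]) auto
  finally show "measure \<nu> {0} = (\<integral>x. measure \<mu> {x} \<partial>\<mu>)"
    by (simp add: measure_def integral_nonneg)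
qed

text \<open>Applied to the countable set of atoms, the bound for null sets gives \<open>\<Sum>\<^sub>a \<mu>{a} \<le> \<Sum>\<^sub>a \<mu>{a}\<^sup>2\<close>,
  so every atom has mass 1 and hence there is none; but then the bound itself is zero.\<close>

lemma absolutely_continuous_limit: "absolutely_continuous lborel \<mu>"
proof -
  define m where "m x = measure \<mu> {x}" for x
  define D where "D = {x. m x \<noteq> 0}"
  have "countable D" unfolding D_def m_def by (rule mu.countable_support)
  then have D: "D \<in> null_sets lborel" by (rule countable_imp_null_set_lborel)
  have [measurable]: "m \<in> borel_measurable \<mu>" "D \<in> sets \<mu>"
    using atom_measure_measurable D by (auto simp: m_def[abs_def])
  have m1: "0 \<le> m x" "m x \<le> 1" for x by (auto simp: m_def)
  have im: "integrable \<mu> m" using m1 by (intro mu.integrable_const_bound[where B=1]) auto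
  have iD: "integrable \<mu> (indicator D :: real \<Rightarrow> real)"
    by (intro mu.integrable_const_bound[where B=1]) auto
  \<comment> \<open>The integral of this nonnegative function is the total mass of the atoms minus
    the sum of their squares. The null set bound makes it at most 0, so the function vanishes almost
    everywhere.\<close>
  have nn: "0 \<le> indicator D x - m x" for x
    using m1[of x] by (auto simp: D_def indicator_def)
  have i: "integrable \<mu> (\<lambda>x. indicator D x - m x)" using im iD by simp
  have "(\<integral>x. indicator D x - m x \<partial>\<mu>) = measure \<mu> D - measure \<nu> {0}"
    using im iD measure_\<nu>_0 by (simp add: m_def[abs_def])
  also have "\<dots> \<le> 0" using null_bound[OF D] by simp
  finally have "(\<integral>x. indicator D x - m x \<partial>\<mu>) = 0"
    using nn by (intro antisym integral_nonneg) auto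
  then have ae: "AE x in \<mu>. indicator D x - m x = 0"
    using integral_nonneg_eq_0_iff_AE[OF i] nn by simp
  have "D = {}"
  proof (rule ccontr)
    assume "D \<noteq> {}"
    then obtain x where x: "x \<in> D" by blast
    obtain N where N: "{y \<in> space \<mu>. \<not> indicator D y - m y = 0} \<subseteq> N" "emeasure \<mu> N = 0" "N \<in> sets \<mu>"
      using ae by (rule AE_E)
    \<comment> \<open>A statement that holds almost everywhere holds at every atom, since a null set
      contains none.\<close>
    have "x \<notin> N"
    proof
      assume "x \<in> N"
      then have "emeasure \<mu> {x} \<le> emeasure \<mu> N" using N(3) by (intro emeasure_mono) auto
      then have "m x = 0" using N(2) by (simp add: m_def measure_def)
      then show False using x by (simp add: D_def)
    qed
    then have "indicator D x - m x = 0" using N(1) by auto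
    then have "m x = 1" using x by simp
    then show False using not_concentrated by (simp add: m_def)
  qed
  then have "measure \<nu> {0} = 0"
    unfolding measure_\<nu>_0 by (auto simp: D_def m_def intro!: integral_eq_zero_AE)
  then have "N \<in> null_sets \<mu>" if "N \<in> null_sets lborel" for N
    using null_bound[OF that] measure_nonneg[of \<mu> N] that by (auto simp: null_sets_def mu.emeasure_eq_measure)
  then show ?thesis
    unfolding absolutely_continuous_def by blast
qed

end

section \<open>From the moment hypothesis to the theorem\<close>

text \<open>Where \<open>\<bar>x\<bar> > L\<close>, the square is at most
  \<open>\<bar>x\<bar> powr (2 + \<epsilon>) / L powr \<epsilon>\<close>, so a common bound on the
  higher moments makes the tails uniformly small.\<close>

lemma (in prob_space) uniformly_integrable_squares:
  fixes X :: "'i \<Rightarrow> 'a \<Rightarrow> real" and \<epsilon> e :: real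
  assumes X: "\<And>k. k \<in> A \<Longrightarrow> X k \<in> borel_measurable M"
    and \<epsilon>: "0 < \<epsilon>" and sup: "(SUP k\<in>A. \<integral>\<^sup>+\<omega>. ennreal (\<bar>X k \<omega>\<bar> powr (2 + \<epsilon>)) \<partial>M) < \<infinity>" and e: "0 < e"
  shows "\<exists>L\<ge>1. \<forall>k\<in>A. expectation (\<lambda>\<omega>. if \<bar>X k \<omega>\<bar> \<le> L then 0 else (X k \<omega>)\<^sup>2) \<le> e"
proof -
  define C where "C = enn2real (SUP k\<in>A. \<integral>\<^sup>+\<omega>. ennreal (\<bar>X k \<omega>\<bar> powr (2 + \<epsilon>)) \<partial>M)"
  have C0: "0 \<le> C" by (simp add: C_def)
  have C: "(\<integral>\<^sup>+\<omega>. ennreal (\<bar>X k \<omega>\<bar> powr (2 + \<epsilon>)) \<partial>M) \<le> ennreal C" if "k \<in> A" for k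
    using sup SUP_upper[OF that, of "\<lambda>k. \<integral>\<^sup>+\<omega>. ennreal (\<bar>X k \<omega>\<bar> powr (2 + \<epsilon>)) \<partial>M"]
    by (simp add: C_def less_top)
  \<comment> \<open>Solves \<open>C + 1 \<le> e * L powr \<epsilon>\<close>; the added 1 keeps the
    base positive.\<close>
  define L where "L = max 1 (((C + 1) / e) powr (1 / \<epsilon>))"
  have L1: "1 \<le> L" by (simp add: L_def)
  have "(C + 1) / e = (((C + 1) / e) powr (1 / \<epsilon>)) powr \<epsilon>"
    using C0 e \<epsilon> by (simp add: powr_powr)
  also have "\<dots> \<le> L powr \<epsilon>" using \<epsilon> by (intro powr_mono2) (auto simp: L_def)
  finally have Le: "C + 1 \<le> e * L powr \<epsilon>" using e by (simp add: field_simps)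
  have Lp: "0 < L powr \<epsilon>" using L1 by simp
  have "expectation (\<lambda>\<omega>. if \<bar>X k \<omega>\<bar> \<le> L then 0 else (X k \<omega>)\<^sup>2) \<le> e" if k: "k \<in> A" for k
  proof -
    note [measurable] = X[OF k]
    have i: "integrable M (\<lambda>\<omega>. \<bar>X k \<omega>\<bar> powr (2 + \<epsilon>))"
      using le_less_trans[OF C[OF k]] by (intro integrableI_nonneg) (auto simp: less_top)
    have E: "expectation (\<lambda>\<omega>. \<bar>X k \<omega>\<bar> powr (2 + \<epsilon>)) \<le> C"
      using C[OF k] i C0 by (simp add: nn_integral_eq_integral)
    have pw: "(if \<bar>x\<bar> \<le> L then 0 else x\<^sup>2) \<le> \<bar>x\<bar> powr (2 + \<epsilon>) / L powr \<epsilon>" for x :: real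
    proof (cases "\<bar>x\<bar> \<le> L")
      case False
      then have x: "0 < \<bar>x\<bar>" "L \<le> \<bar>x\<bar>" using L1 by auto
      have "x\<^sup>2 * L powr \<epsilon> \<le> x\<^sup>2 * \<bar>x\<bar> powr \<epsilon>"
        using x L1 \<epsilon> by (intro mult_left_mono powr_mono2) auto
      also have "\<dots> = \<bar>x\<bar> powr (2 + \<epsilon>)"
        using x powr_realpow[OF x(1), of 2] by (simp add: powr_add)
      finally show ?thesis using False Lp by (simp add: field_simps)
    qed simp
    have "expectation (\<lambda>\<omega>. if \<bar>X k \<omega>\<bar> \<le> L then 0 else (X k \<omega>)\<^sup>2) \<le> expectation (\<lambda>\<omega>. \<bar>X k \<omega>\<bar> powr (2 + \<epsilon>) / L powr \<epsilon>)"
    proof (rule integral_mono)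
      show "integrable M (\<lambda>\<omega>. if \<bar>X k \<omega>\<bar> \<le> L then 0 else (X k \<omega>)\<^sup>2)"
        by (rule Bochner_Integration.integrable_bound[of M "\<lambda>\<omega>. \<bar>X k \<omega>\<bar> powr (2 + \<epsilon>) / L powr \<epsilon>"])
          (use i pw in \<open>auto intro!: AE_I2 order_trans[OF _ abs_ge_self] split: if_splits\<close>)
    qed (use i pw in auto)
    also have "\<dots> = expectation (\<lambda>\<omega>. \<bar>X k \<omega>\<bar> powr (2 + \<epsilon>)) / L powr \<epsilon>" by simp
    also have "\<dots> \<le> (e * L powr \<epsilon>) / L powr \<epsilon>"
      using E Le Lp by (intro divide_right_mono) auto
    also have "\<dots> = e" using Lp by simp
    finally show ?thesis .
  qed
  with L1 show ?thesis by blast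
qed

theorem theorem3p2:
  fixes M :: "'a measure" and X :: "nat \<Rightarrow> 'a \<Rightarrow> real"
    and N :: "'b measure" and F :: "'b \<Rightarrow> real"
    and p :: nat and n :: "nat \<Rightarrow> nat" and c :: "nat \<Rightarrow> nat set \<Rightarrow> real"
    and r :: "nat \<Rightarrow> nat"
  assumes "p \<ge> 1"
    and "prob_space M"
    and "prob_space.indep_vars M (\<lambda>_. borel) X {1..}"
    and "\<And>k. k \<ge> 1 \<Longrightarrow> prob_space.expectation M (X k) = 0"
    and "\<And>k. k \<ge> 1 \<Longrightarrow> prob_space.expectation M (\<lambda>\<omega>. (X k \<omega>)\<^sup>2) = 1"
    and "\<exists>\<epsilon>::real. \<epsilon> > 0 \<and> (SUP k\<in>{1..}. \<integral>\<^sup>+\<omega>. ennreal (\<bar>X k \<omega>\<bar> powr (2 + \<epsilon>)) \<partial>M) < \<infinity>"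
    and "\<And>m. m \<ge> 1 \<Longrightarrow> n m \<ge> 1"
    and "\<And>m. m \<ge> 1 \<Longrightarrow> (\<Sum>S\<in>{S \<in> Pow {1..n m}. card S > 0}. (c m S)\<^sup>2) = 1"
    and "(\<lambda>m. max_influence (n m) (c m)) \<longlonglongrightarrow> 0"
    and "\<And>m. m \<ge> 1 \<Longrightarrow> multilinear_degree (n m) (c m) \<le> p"
    and "prob_space N"
    and "F \<in> borel_measurable N"
    and "strict_mono r" and "\<And>j. r j \<ge> 1"
    and "weak_conv_m
           (\<lambda>j. distr M borel (\<lambda>\<omega>. multilinear_eval (n (r j)) (c (r j)) (\<lambda>i. X i \<omega>)))
           (distr N borel F)"
  shows "\<exists>f. distributed N lborel F f"
proof -
  interpret prob_space M by fact
  interpret N: prob_space N by fact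
  obtain \<epsilon> :: real where \<epsilon>: "0 < \<epsilon>"
    "(SUP k\<in>{1..}. \<integral>\<^sup>+\<omega>. ennreal (\<bar>X k \<omega>\<bar> powr (2 + \<epsilon>)) \<partial>M) < \<infinity>"
    using assms(6) by blast
  have X: "X k \<in> borel_measurable M" if "k \<in> {1..}" for k
    using assms(3) that by (auto simp: indep_vars_def)
  define I where "I j = {1..n (r j)}" for j
  define d where "d j = c (r j)" for j
  define \<tau> where "\<tau> j = max_influence (n (r j)) (c (r j))" for j
  have mlf: "multilinear_eval (n (r j)) (c (r j)) x = mlf (I j) (d j) x" for j x
    by (simp add: multilinear_eval_def mlf_def I_def d_def)
  have inf: "(\<Sum>S\<in>{S \<in> Pow (I j). k \<in> S}. (d j S)\<^sup>2) \<le> \<tau> j" if "k \<in> I j" for j k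
    using that unfolding \<tau>_def max_influence_def I_def d_def
    by (intro cSUP_upper bdd_above_finite) auto
  interpret low_influence_limit M X I d p \<tau> "distr N borel F"
  proof (intro low_influence_limit.intro standardized_family.intro standardized_family_axioms.intro
      low_influence_limit_axioms.intro)
    show "\<exists>L\<ge>1. \<forall>k\<ge>1. expectation (\<lambda>\<omega>. if \<bar>X k \<omega>\<bar> \<le> L then 0 else (X k \<omega>)\<^sup>2) \<le> e" if "0 < e" for e :: real
      using uniformly_integrable_squares[OF X \<epsilon> that] by auto
    show "card S \<le> p" if "S \<subseteq> I j" "d j S \<noteq> 0" for S j
    proof -
      \<comment> \<open>The nonzero coefficient makes the set under \<open>Max\<close> nonempty, so
        the unspecified value of \<open>Max {}\<close> does not occur.\<close>
      have "card S \<le> multilinear_degree (n (r j)) (c (r j))"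
        using that unfolding multilinear_degree_def I_def d_def by (intro Max_ge) auto
      then show ?thesis using assms(10)[OF assms(14)[of j]] by linarith
    qed
    show "(\<Sum>S\<in>{S \<in> Pow (I j). card S > 0}. (d j S)\<^sup>2) = 1" for j
      using assms(8)[OF assms(14)[of j]] by (simp add: I_def d_def)
    show "0 \<le> \<tau> j" for j
    proof -
      have "1 \<in> I j" using assms(7)[OF assms(14)[of j]] by (simp add: I_def)
      then show ?thesis by (intro order_trans[OF _ inf] sum_nonneg) auto
    qed
    show "\<tau> \<longlonglongrightarrow> 0"
      using LIMSEQ_subseq_LIMSEQ[OF assms(9,13)] by (simp add: \<tau>_def[abs_def] comp_def)
    show "real_distribution (distr N borel F)"
      using assms(12) by (rule N.real_distribution_distr)
    show "weak_conv_m (\<lambda>j. distr M borel (\<lambda>\<omega>. mlf (I j) (d j) (\<lambda>i. X i \<omega>))) (distr N borel F)"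
      using assms(15) unfolding mlf .
  qed (use assms inf in \<open>auto simp: I_def\<close>)
  obtain f where f: "f \<in> borel_measurable lborel" "density lborel f = distr N borel F"
    using sigma_finite_measure.Radon_Nikodym[OF sigma_finite_lborel absolutely_continuous_limit] by auto
  have "distr N lborel F = distr N borel F"
    by (rule distr_cong) auto
  then have "distributed N lborel F f"
    using f assms(12) by (simp add: distributed_def)
  then show ?thesis by blast
qed

end
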